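(* Suppose that the radial sampling density $q:\mathbb{R}^d\to(0,\infty)$ has superexponential decay, with associated function $\psi$. (1) If $r_n\,\psi'(\psi^{\leftarrow}(\log n))=o(\log\log n)$, then with high probability $G(\mathcal{P}_n,r_n)$ is disconnected. (2) If $r_n\,\psi'(\psi^{\leftarrow}(\log n))=\omega(\log\log n)$, then there exist increasing sequences of real numbers $(R_n^{(0)})_n$ and $(R_n^{(1)})_n$ such that $R_n^{(1)}-R_n^{(0)}=o(r_n)$, such that with high probability $$\mathcal{P}_n\cap B(0,R_n^{(1)})^c=\emptyset,$$ and such that for every choice of a positive sequence $\gamma_n=o(1)$ with $\gamma_n\,\psi'(\psi^{\leftarrow}(\log n))=\omega(1)$, with high probability, for all $i\in S_n(R_n^{(0)})$, $$(1-\gamma_n)\,n\,\nu(Q_{i,n})\le \mathcal{P}_n(Q_{i,n})\le (1+\gamma_n)\,n\,\nu(Q_{i,n}),$$ where $\mathcal{P}_n(A):=|\mathcal{P}_n\cap A|$ and the index set $S_n(R_n^{(0)})$ and the sets $Q_{i,n}$ are those built from the grid of side width $\gamma_n r_n$ with $R_n=R_n^{(0)}$.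
   Context: Let $d\ge 2$ and let $\nu$ be a probability measure on $\mathbb{R}^d$ with density $q:\mathbb{R}^d\to(0,\infty)$ that is radial, i.e. $q(x)$ depends only on $|x|$. $\mathcal{P}_n$ is the Poisson point process of intensity $n\nu$: $\mathcal{P}_n=\{x_1,\dots,x_N\}$ with $N\sim \mathrm{Po}(n)$ independent of the $x_i$, which are i.i.d. with law $\nu$. The radius $r_n$ satisfies $0<r_n\le 1$ and is non-increasing in $n$. $G(\mathcal{P}_n,r_n)$ is the graph with vertex set $\mathcal{P}_n$ in which two distinct points are joined by an edge iff their Euclidean distance is less than $r_n$. An event $A_n$ holds with high probability if $\lim_{n\to\infty}\mathbb{P}(A_n)=1$. $f(n)=\omega(g(n))$ means that for every $C>0$, $|f(n)|\ge C|g(n)|$ for all sufficiently large $n$. $B(0,R)$ is the Euclidean ball of radius $R$ centred at the origin. A function $f:(0,\infty)\to(0,\infty)$ is regularly varying with exponent $\alpha\in\mathbb{R}$, written $f\in RV_\alpha$, if $\lim_{R\to\infty} f(tR)/f(R)=t^\alpha$ for all $t>0$. A function $\psi\in C^2([0,\infty);[0,\infty))$ is of von Mises type if $\psi'(z)>0$ for all sufficiently large $z$, $\psi(z)\to\infty$ as $z\to\infty$, and $a'(z)\to 0$ as $z\to\infty$, where $a(z):=1/\psi'(z)$; then $\psi^{\leftarrow}$ denotes any function that is asymptotically (for large arguments) the inverse of $\psi$. A radial density $q$ has a light tail if it can be written as $q(x)=L(|x|)\exp(-\psi(|x|))$ where $\psi\in C^2([0,\infty);[0,\infty))$ is of von Mises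 type, $\psi'$ is eventually monotone, and $L\in RV_\alpha$ for some $\alpha\in\mathbb{R}$. The density $q$ has superexponential decay if it has a light tail with $\psi\in RV_v$ for some $v>1$. Cubes: given $\gamma_n=o(1)$, divide $\mathbb{R}^d$ into a grid of cubes $\{Q'_{i,n}: i\in\mathbb{N}\}$ of side width $\gamma_n r_n$; denote the centre of $Q'_{i,n}$ by $z_{i,n}$ and assume the origin is one of the centres. Given $R_n>0$, let $S_n(R_n):=\{i\in\mathbb{N}: Q'_{i,n}\subset B(0,R_n)\}$. For $i\in S_n(R_n)$ let $I(i,n):=\{j\in\mathbb{N}: \forall i'\in S_n(R_n)\setminus\{i\},\ |z_{i,n}-z_{j,n}|<|z_{i',n}-z_{j,n}|\}$ and $Q_{i,n}:=\bigcup_{j\in I(i,n)}(Q'_{j,n}\cap B(0,R_n))$.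
   Formalization: The final concentration claim of (2) is proved under the added assumption that q is bounded away from 0 on every ball (automatic for continuous q>0); without it the claim fails, e.g. if q gets arbitrarily close to 0 very fast near the unit sphere. *)

theory Defs
  imports
    "HOL-Probability.Probability"
    "HOL-Library.Landau_Symbols"
    "Graph_Theory.Digraph_Component"
begin

subsection \<open>Regular variation, von Mises functions and light tails\<close>

text \<open>Functions on the open or closed half-line are represented by total functions on the reals
  of which only the values on the half-line matter.\<close>

definition regularly_varying :: "(real \<Rightarrow> real) \<Rightarrow> real \<Rightarrow> bool" where
  "regularly_varying f \<alpha> \<longleftrightarrow>
     (\<forall>x>0. f x > 0) \<and>
     (\<forall>t>0. ((\<lambda>R. f (t * R) / f R) \<longlongrightarrow> t powr \<alpha>) at_top)"

definition C2_halfline :: "(real \<Rightarrow> real) \<Rightarrow> bool" where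
  "C2_halfline \<psi> \<longleftrightarrow>
     (\<exists>\<psi>' \<psi>''.
        (\<forall>z\<ge>0. (\<psi> has_real_derivative \<psi>' z) (at z within {0..})) \<and>
        (\<forall>z\<ge>0. (\<psi>' has_real_derivative \<psi>'' z) (at z within {0..})) \<and>
        continuous_on {0..} \<psi>'')"

text \<open>At positive arguments \<open>deriv \<psi>\<close> is the derivative on the half-line; its value at 0 plays no
  role below, all conditions on it being asymptotic.\<close>

definition von_Mises_type :: "(real \<Rightarrow> real) \<Rightarrow> bool" where
  "von_Mises_type \<psi> \<longleftrightarrow>
     C2_halfline \<psi> \<and> (\<forall>z\<ge>0. \<psi> z \<ge> 0) \<and>
     (\<forall>\<^sub>F z in at_top. deriv \<psi> z > 0) \<and>
     filterlim \<psi> at_top at_top \<and>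
     ((\<lambda>z. deriv (\<lambda>y. 1 / deriv \<psi> y) z) \<longlongrightarrow> 0) at_top"

definition inverse_at_top :: "(real \<Rightarrow> real) \<Rightarrow> (real \<Rightarrow> real) \<Rightarrow> bool" where
  "inverse_at_top \<psi> \<psi>inv \<longleftrightarrow>
     (\<forall>\<^sub>F z in at_top. \<psi>inv z \<ge> 0 \<and> \<psi> (\<psi>inv z) = z) \<and>
     (\<forall>\<^sub>F z in at_top. \<psi>inv (\<psi> z) = z)"

definition light_tail :: "('a::real_normed_vector \<Rightarrow> real) \<Rightarrow> (real \<Rightarrow> real) \<Rightarrow> bool" where
  "light_tail q \<psi> \<longleftrightarrow>
     von_Mises_type \<psi> \<and>
     (\<exists>z0. mono_on {z0..} (deriv \<psi>) \<or> antimono_on {z0..} (deriv \<psi>)) \<and>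
     (\<exists>L \<alpha>. regularly_varying L \<alpha> \<and> (\<forall>x. q x = L (norm x) * exp (- \<psi> (norm x))))"

definition superexponential_decay ::
  "('a::real_normed_vector \<Rightarrow> real) \<Rightarrow> (real \<Rightarrow> real) \<Rightarrow> bool" where
  "superexponential_decay q \<psi> \<longleftrightarrow> light_tail q \<psi> \<and> (\<exists>v>1. regularly_varying \<psi> v)"

text \<open>Positivity of a density with a superexponential tail does not exclude that it comes arbitrarily
  close to 0 on a bounded set: the factor \<open>L\<close> is only constrained near infinity. If, say,
  \<open>L t = exp (- exp (1 / \<bar>t - 1\<bar>))\<close> near \<open>t = 1\<close>, cubes of side \<open>(ln n) powr - \<epsilon>\<close> near the unit sphere
  have positive mass of smaller order than \<open>1 / n\<close>, and the number of sample points in them cannot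
  concentrate in relative terms. The following condition excludes
  this; on Euclidean space it holds for every continuous positive \<open>q\<close>.\<close>

definition locally_bounded_away_from_0 :: "('a::real_normed_vector \<Rightarrow> real) \<Rightarrow> bool" where
  "locally_bounded_away_from_0 q \<longleftrightarrow> (\<forall>\<rho>. \<exists>c>0. \<forall>x \<in> cball 0 \<rho>. q x \<ge> c)"


subsection \<open>The Poisson process and its geometric graph\<close>

text \<open>\<open>N\<close> has law \<open>Po(t)\<close>, the \<open>X i\<close> are independent with law \<open>\<nu>\<close>, and \<open>N\<close> is independent of the
  whole sequence. The last condition is stated through the generated sigma-algebras because
  \<^const>\<open>prob_space.indep_var\<close> needs both variables to have the same type.\<close>

definition poisson_sample ::
  "'w measure \<Rightarrow> ('w \<Rightarrow> nat) \<Rightarrow> (nat \<Rightarrow> 'w \<Rightarrow> 'a::euclidean_space) \<Rightarrow> real \<Rightarrow> 'a measure \<Rightarrow> bool" where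
  "poisson_sample M N X t \<nu> \<longleftrightarrow>
     prob_space M \<and>
     N \<in> measurable M (count_space UNIV) \<and>
     distr M (count_space UNIV) N = measure_pmf (poisson_pmf t) \<and>
     prob_space.indep_vars M (\<lambda>_. borel) X UNIV \<and>
     (\<forall>i. distr M borel (X i) = \<nu>) \<and>
     prob_space.indep_set M
       (sets (vimage_algebra (space M) N (count_space UNIV)))
       (sets (vimage_algebra (space M) (\<lambda>\<omega> i. X i \<omega>) (\<Pi>\<^sub>M i\<in>UNIV. borel)))"

definition poisson_points :: "('w \<Rightarrow> nat) \<Rightarrow> (nat \<Rightarrow> 'w \<Rightarrow> 'a) \<Rightarrow> 'w \<Rightarrow> 'a set" where
  "poisson_points N X \<omega> = (\<lambda>i. X i \<omega>) ` {..<N \<omega>}"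

definition whp :: "(nat \<Rightarrow> 'w measure) \<Rightarrow> (nat \<Rightarrow> 'w \<Rightarrow> bool) \<Rightarrow> bool" where
  "whp M A \<longleftrightarrow> (\<lambda>n. measure (M n) {\<omega> \<in> space (M n). A n \<omega>}) \<longlonglongrightarrow> 1"

text \<open>An undirected graph is represented by the digraph containing both orientations of each edge.\<close>

definition geometric_graph :: "'a::metric_space set \<Rightarrow> real \<Rightarrow> ('a, 'a \<times> 'a) pre_digraph" where
  "geometric_graph P r =
     with_proj \<lparr>pverts = P, parcs = {(x, y). x \<in> P \<and> y \<in> P \<and> x \<noteq> y \<and> dist x y < r}\<rparr>"


subsection \<open>The cubes\<close>

text \<open>The grid of side \<open>s\<close> with the origin among its centres is indexed by the integer lattice.
  The cubes are half-open so that they partition the space.\<close>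

definition cube_centre :: "real \<Rightarrow> int ^ 'd \<Rightarrow> real ^ 'd" where
  "cube_centre s i = (\<chi> k. s * real_of_int (i $ k))"

definition grid_cube :: "real \<Rightarrow> int ^ 'd \<Rightarrow> (real ^ 'd) set" where
  "grid_cube s i =
     {x. \<forall>k. cube_centre s i $ k - s / 2 \<le> x $ k \<and> x $ k < cube_centre s i $ k + s / 2}"

definition inner_cubes :: "real \<Rightarrow> real \<Rightarrow> (int ^ 'd) set" where
  "inner_cubes s R = {i. grid_cube s i \<subseteq> ball 0 R}"

definition cell_indices :: "real \<Rightarrow> real \<Rightarrow> int ^ 'd \<Rightarrow> (int ^ 'd) set" where
  "cell_indices s R i =
     {j. \<forall>i' \<in> inner_cubes s R - {i}.
           dist (cube_centre s i) (cube_centre s j) < dist (cube_centre s i') (cube_centre s j)}"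

definition cell :: "real \<Rightarrow> real \<Rightarrow> int ^ 'd \<Rightarrow> (real ^ 'd) set" where
  "cell s R i = (\<Union>j \<in> cell_indices s R i. grid_cube s j \<inter> ball 0 R)"

end

(* Write x = ln n, rho = psi_inv x and b = psi' rho, so that 1/b is the length scale on which the
   density at distance rho from the origin changes by a constant factor. Since psi varies regularly
   with exponent v > 1, rho and b both lie between positive powers of x, and the radii R with
   |psi(R) - x| <= K ln x form an annulus around radius rho of width of order ln x / b.

   (1) If r = o(ln x / b), we may enlarge r to eps ln x / b. On a ball of that radius near distance
   rho the density varies by at most a small power of x. Choose R such that a ball centred at
   distance R contains just under one point on average. Then each of about R well separated places
   on the sphere of radius R carries an isolated cluster with probability at least a small negative
   power of x, whereas R is at least a fixed positive power of x. These events are pairwise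
   independent, so by the second moment method one of them occurs.

   (2) Take psi(R0) = x - K ln x and psi(R1) = x + K ln x with K large. The expected number of points
   beyond R1 is of order at most 1/x, and R1 - R0 is of order ln x / b. Inside R0 every cell contains
   on average at least a large power of x points, while there are only polynomially many (in x)
   cells, so a Chernoff bound and a union bound give the concentration. *)
theory Submission
  imports Defs "HOL-Real_Asymp.Real_Asymp"
begin

section \<open>Regular variation\<close>

text \<open>Regular variation controls \<open>\<psi>\<close> and \<open>L\<close> along fixed ratios
  only, whereas the estimates need one constant for all radii between \<rho> / 4 and 4 \<rho>, and
  need it for \<open>deriv \<psi>\<close> too. Uniform boundedness of regularly varying functions
  supplies it, and monotonicity of \<open>deriv \<psi>\<close> carries it over to the derivative,
  which has the order of \<open>\<psi> R / R\<close>. In (1) two powers of \<open>x\<close> compete: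
  the density oscillates by a power that shrinks with \<epsilon>, while the number of places is at
  least of order \<open>x powr (1 / (v + 1))\<close>; this fixes \<epsilon>. In (2) every loss (cube
  volume, squared tolerance, number of cells, \<open>L\<close>) is a power of \<open>x\<close> whose
  exponent does not depend on \<open>K\<close>, so one \<open>K\<close> serves every \<gamma>.
  Independence of disjoint regions is not part of the definition of the sample. All probabilities
  are read off the generating function of a single count, and pairwise independence comes from
  applying it to unions of regions.\<close>

text \<open>Uniform boundedness in additive form. The exceptional sets \<open>B x\<close> have
  measure tending to 0 by dominated convergence, so for every \<open>s\<close> some \<open>u\<close>
  is good for \<open>x\<close> and, shifted by \<open>s\<close>, for \<open>x + s\<close>; comparing
  \<open>h x\<close> and \<open>h (x + s)\<close> through \<open>h (x + u)\<close> bounds their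
  difference.\<close>

lemma increments_bounded:
  fixes h :: "real \<Rightarrow> real"
  assumes [measurable]: "h \<in> borel_measurable borel"
    and lim: "\<And>u. ((\<lambda>x. h (x + u) - h x) \<longlongrightarrow> \<alpha> * u) at_top"
  shows "\<exists>C. \<forall>\<^sub>F x in at_top. \<forall>s\<in>{0..2}. \<bar>h (x + s) - h x\<bar> \<le> C"
proof -
  define B where "B x = {u \<in> {0..4}. \<bar>h (x + u) - h x - \<alpha> * u\<bar> > 1}" for x
  have B_meas[measurable]: "B x \<in> sets borel" for x
    unfolding B_def by measurable
  have B_sub: "B x \<subseteq> {0..4}" for x by (auto simp: B_def)
  have B_fin: "emeasure lborel (B x) < \<infinity>" for x
    using emeasure_mono[OF B_sub[of x], of lborel] by (simp add: order_le_less_trans)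
  have "((\<lambda>x. integral\<^sup>L lborel (indicat_real (B x))) \<longlongrightarrow> integral\<^sup>L lborel (\<lambda>u::real. 0::real)) at_top"
  proof (rule integral_dominated_convergence_at_top[where w = "indicat_real {0..4}"])
    show "\<forall>\<^sub>F x in at_top. AE u in lborel. norm (indicator (B x) u :: real) \<le> indicator {0..4} u"
      by (intro always_eventually allI AE_I2) (auto simp: indicator_def B_def)
    show "AE u in lborel. ((\<lambda>x. indicator (B x) u :: real) \<longlongrightarrow> 0) at_top"
    proof (rule AE_I2)
      fix u :: real
      have "((\<lambda>x. h (x + u) - h x - \<alpha> * u) \<longlongrightarrow> \<alpha> * u - \<alpha> * u) at_top"
        by (intro tendsto_diff lim tendsto_const)
      then have "((\<lambda>x. \<bar>h (x + u) - h x - \<alpha> * u\<bar>) \<longlongrightarrow> 0) at_top"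
        by (auto intro: tendsto_rabs_zero)
      then have "\<forall>\<^sub>F x in at_top. \<bar>h (x + u) - h x - \<alpha> * u\<bar> < 1"
        by (rule order_tendstoD) auto
      then have "\<forall>\<^sub>F x in at_top. indicator (B x) u = (0 :: real)"
        by eventually_elim (auto simp: B_def indicator_def)
      then show "((\<lambda>x. indicator (B x) u :: real) \<longlongrightarrow> 0) at_top"
        by (rule tendsto_eventually)
    qed
  qed auto
  then have "((\<lambda>x. measure lborel (B x)) \<longlongrightarrow> 0) at_top"
    by simp
  then have "\<forall>\<^sub>F x in at_top. measure lborel (B x) < 1 / 2"
    by (rule order_tendstoD) auto
  then obtain x0 where x0: "\<And>x. x \<ge> x0 \<Longrightarrow> measure lborel (B x) < 1 / 2"
    by (auto simp: eventually_at_top_linorder)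
  have "\<bar>h (x + s) - h x\<bar> \<le> 2 + 2 * \<bar>\<alpha>\<bar>" if x: "x \<ge> x0" and s: "s \<in> {0..2}" for x s
  proof -
    let ?T = "(\<lambda>u. u - s) -` B (x + s)"
    have T_meas: "?T \<in> sets borel"
      by (rule measurable_sets_borel[OF _ B_meas]) measurable
    have "emeasure lborel (B (x + s)) = emeasure (distr lborel borel ((+) (- s))) (B (x + s))"
      by (simp add: lborel_distr_plus)
    also have "\<dots> = emeasure lborel ?T"
      by (subst emeasure_distr) (auto simp: vimage_def)
    finally have T: "emeasure lborel ?T = emeasure lborel (B (x + s))" ..
    \<comment> \<open>The interval has length at least 2 because \<open>s\<close> is at most 2,
      while the two exceptional sets together have measure below 1.\<close>
    have "\<not> {s..4} \<subseteq> B x \<union> ?T"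
    proof
      assume sub: "{s..4} \<subseteq> B x \<union> ?T"
      have "ennreal 2 \<le> emeasure lborel {s..4}"
        using s by (auto intro!: ennreal_leI)
      also have "\<dots> \<le> emeasure lborel (B x \<union> ?T)"
        using sub T_meas by (intro emeasure_mono) auto
      also have "\<dots> \<le> emeasure lborel (B x) + emeasure lborel ?T"
        using T_meas by (intro emeasure_subadditive) auto
      also have "\<dots> = ennreal (measure lborel (B x) + measure lborel (B (x + s)))"
        using B_fin by (simp add: T emeasure_eq_ennreal_measure less_top ennreal_plus)
      also have "\<dots> < ennreal 2"
        using x0[of x] x0[of "x + s"] x s by (intro ennreal_lessI) auto
      finally show False by simp
    qed
    then obtain u where u: "u \<in> {s..4}" "u \<notin> B x" "u - s \<notin> B (x + s)"
      by blast
    then have "\<bar>h (x + u) - h x - \<alpha> * u\<bar> \<le> 1" "\<bar>h (x + u) - h (x + s) - \<alpha> * (u - s)\<bar> \<le> 1"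
      using s by (auto simp: B_def)
    then have "\<bar>h (x + s) - h x\<bar> \<le> 2 + \<bar>\<alpha> * s\<bar>"
      by (auto simp: algebra_simps abs_if split: if_splits)
    also have "\<bar>\<alpha> * s\<bar> \<le> 2 * \<bar>\<alpha>\<bar>"
      using s mult_right_mono[of s 2 "\<bar>\<alpha>\<bar>"] by (auto simp: abs_mult mult.commute)
    finally show ?thesis by simp
  qed
  then show ?thesis
    unfolding eventually_at_top_linorder by blast
qed

text \<open>Unit steps of slope below \<beta>, strictly between \<alpha> and \<kappa>, are iterated
  from a starting point in \<open>{x0..x0 + 1}\<close>; boundedness of the increments makes the
  start uniform, and the gap between \<kappa> and \<beta> absorbs the additive constant.\<close>

lemma increments_linear_bound:
  fixes h :: "real \<Rightarrow> real"
  assumes [measurable]: "h \<in> borel_measurable borel"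
    and lim: "\<And>u. ((\<lambda>x. h (x + u) - h x) \<longlongrightarrow> \<alpha> * u) at_top"
    and \<kappa>: "\<alpha> < \<kappa>"
  shows "\<forall>\<^sub>F x in at_top. h x \<le> \<kappa> * x"
proof -
  define \<beta> where "\<beta> = (\<alpha> + \<kappa>) / 2"
  have \<beta>: "\<alpha> < \<beta>" "\<beta> < \<kappa>" using \<kappa> by (auto simp: \<beta>_def)
  obtain C where C: "\<forall>\<^sub>F x in at_top. \<forall>s\<in>{0..2}. \<bar>h (x + s) - h x\<bar> \<le> C"
    using increments_bounded[OF assms(1) lim] by auto
  have "\<forall>\<^sub>F x in at_top. h (x + 1) - h x < \<beta>"
    using order_tendstoD(2)[OF lim[of 1], of \<beta>] \<beta> by simp
  with C have "\<forall>\<^sub>F x in at_top. h (x + 1) - h x < \<beta> \<and> (\<forall>s\<in>{0..2}. \<bar>h (x + s) - h x\<bar> \<le> C)"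
    by eventually_elim auto
  then obtain x0 where step: "\<And>x. x \<ge> x0 \<Longrightarrow> h (x + 1) - h x < \<beta>"
    and C: "\<And>s. s \<in> {0..2} \<Longrightarrow> \<bar>h (x0 + s) - h x0\<bar> \<le> C"
    unfolding eventually_at_top_linorder by blast
  have iter: "h (y + real n) \<le> h y + \<beta> * real n" if "y \<ge> x0" for y n
  proof (induction n)
    case (Suc n)
    have "h (y + real n + 1) - h (y + real n) < \<beta>"
      using that by (intro step) auto
    with Suc show ?case by (simp add: algebra_simps)
  qed auto
  define D where "D = h x0 + C + \<bar>\<beta>\<bar> - \<beta> * x0"
  have bound: "h x \<le> \<beta> * x + D" if x: "x \<ge> x0" for x
  proof -
    define n where "n = nat \<lfloor>x - x0\<rfloor>"
    define s where "s = x - x0 - real n"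
    have s: "0 \<le> s" "s \<le> 1" using x by (auto simp: n_def s_def) linarith
    have "h x = h (x0 + s + real n)" by (simp add: s_def)
    also have "\<dots> \<le> h (x0 + s) + \<beta> * real n" using s by (intro iter) auto
    also have "h (x0 + s) \<le> h x0 + C" using C[of s] s by auto
    also have "\<beta> * real n = \<beta> * x - \<beta> * x0 + - (\<beta> * s)" by (simp add: s_def algebra_simps)
    finally have "h x \<le> h x0 + C + (\<beta> * x - \<beta> * x0 + - (\<beta> * s))" by simp
    moreover have "- (\<beta> * s) \<le> \<bar>\<beta>\<bar> * 1"
      unfolding minus_mult_left using s by (intro mult_mono) auto
    ultimately show ?thesis by (simp add: D_def)
  qed
  have "\<forall>\<^sub>F x in at_top. x \<ge> D / (\<kappa> - \<beta>)" by (rule eventually_ge_at_top)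
  moreover have "\<forall>\<^sub>F x in at_top. x \<ge> x0" by (rule eventually_ge_at_top)
  ultimately show ?thesis
  proof eventually_elim
    case (elim x)
    then have "D \<le> (\<kappa> - \<beta>) * x" using \<beta> by (simp add: field_simps)
    with bound[of x] elim show ?case by (simp add: algebra_simps)
  qed
qed

text \<open>The substitution \<open>R = exp x\<close> turns ratios into the increments treated
  above.\<close>

lemma regularly_varying_log_increments:
  assumes "regularly_varying f \<alpha>"
  shows "((\<lambda>x. ln (f (exp (x + u))) - ln (f (exp x))) \<longlongrightarrow> \<alpha> * u) at_top"
proof -
  have pos: "f x > 0" if "x > 0" for x
    using assms that by (auto simp: regularly_varying_def)
  have "((\<lambda>R. f (exp u * R) / f R) \<longlongrightarrow> exp u powr \<alpha>) at_top"
    using assms by (auto simp: regularly_varying_def)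
  then have "((\<lambda>R. ln (f (exp u * R) / f R)) \<longlongrightarrow> ln (exp u powr \<alpha>)) at_top"
    by (rule tendsto_ln) auto
  then have "((\<lambda>x. ln (f (exp u * exp x) / f (exp x))) \<longlongrightarrow> ln (exp u powr \<alpha>)) at_top"
    by (rule filterlim_compose[OF _ exp_at_top])
  also have "(\<lambda>x. ln (f (exp u * exp x) / f (exp x))) = (\<lambda>x. ln (f (exp (x + u))) - ln (f (exp x)))"
  proof
    fix x
    show "ln (f (exp u * exp x) / f (exp x)) = ln (f (exp (x + u))) - ln (f (exp x))"
      using pos[of "exp u * exp x"] pos[of "exp x"] by (simp add: ln_div exp_add mult.commute)
  qed
  finally show ?thesis by (simp add: ln_powr)
qed

text \<open>Measurability of \<open>f\<close> on the half-line is stated after the substitution \<open>R = exp x\<close>, since the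
  values of \<open>f\<close> at nonpositive arguments are arbitrary.\<close>

lemma regularly_varying_bounded_ratio:
  assumes f: "regularly_varying f \<alpha>" and [measurable]: "(\<lambda>x. f (exp x)) \<in> borel_measurable borel"
  shows "\<exists>C\<ge>1. \<forall>\<^sub>F R in at_top. \<forall>s\<in>{R/4..4*R}. f R / C \<le> f s \<and> f s \<le> C * f R"
proof -
  have pos: "f x > 0" if "x > 0" for x
    using f that by (auto simp: regularly_varying_def)
  obtain C where C: "\<forall>\<^sub>F x in at_top. \<forall>s\<in>{0..2}. \<bar>ln (f (exp (x + s))) - ln (f (exp x))\<bar> \<le> C"
    using increments_bounded[OF _ regularly_varying_log_increments[OF f]] by auto
  then obtain x0 where x0: "\<And>x s. x \<ge> x0 \<Longrightarrow> s \<in> {0..2} \<Longrightarrow>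
      \<bar>ln (f (exp (x + s))) - ln (f (exp x))\<bar> \<le> C"
    unfolding eventually_at_top_linorder by blast
  have C0: "C \<ge> 0" using x0[of x0 0] by auto
  \<comment> \<open>On the logarithmic scale the range from \<open>R / 4\<close> to
    \<open>4 * R\<close> has half-width \<open>ln 4\<close>, which increments of length up to 2
    cover.\<close>
  have ln4: "ln (4::real) \<le> 2" using ln_add_one_self_le_self[of 1] ln_realpow[of 2 2] by simp
  have "\<forall>\<^sub>F R in at_top. R \<ge> exp (x0 + 2)" by (rule eventually_ge_at_top)
  then have "\<forall>\<^sub>F R in at_top. \<forall>s\<in>{R/4..4*R}. f R / exp C \<le> f s \<and> f s \<le> exp C * f R"
  proof eventually_elim
    case (elim R)
    show ?case
    proof
      fix s assume s: "s \<in> {R/4..4*R}"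
      have R0: "R > 0" using elim exp_gt_zero[of "x0 + 2"] by linarith
      then have s0: "s > 0" using s by auto
      have lnR: "ln R \<ge> x0 + 2" using elim R0 by (simp add: ln_ge_iff)
      have "ln s \<le> ln (4 * R)" "ln (R / 4) \<le> ln s" using s s0 R0 by auto
      then have d: "\<bar>ln s - ln R\<bar> \<le> 2" using ln4 R0 by (auto simp: ln_mult ln_div)
      have "\<bar>ln (f s) - ln (f R)\<bar> \<le> C"
      proof (cases "s \<ge> R")
        case True
        then show ?thesis using x0[of "ln R" "ln s - ln R"] d lnR s0 R0 by (auto simp: abs_if)
      next
        case False
        then show ?thesis using x0[of "ln s" "ln R - ln s"] d lnR s0 R0 
          by (simp add: abs_minus_commute)
      qed
      then have "ln (f s) \<le> ln (exp C * f R)" "ln (f R) \<le> ln (exp C * f s)"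
        using pos[OF s0] pos[OF R0] by (auto simp: ln_mult)
      then show "f R / exp C \<le> f s \<and> f s \<le> exp C * f R"
        using pos[OF s0] pos[OF R0] by (simp add: field_simps)
    qed
  qed
  then show ?thesis using C0 by (intro exI[of _ "exp C"]) auto
qed

text \<open>Upper half of Potter's bounds; the lower half below results from passing to the
  reciprocal.\<close>

lemma regularly_varying_le_powr:
  assumes f: "regularly_varying f \<alpha>" and [measurable]: "(\<lambda>x. f (exp x)) \<in> borel_measurable borel"
    and "\<alpha> < \<kappa>"
  shows "\<forall>\<^sub>F R in at_top. f R \<le> R powr \<kappa>"
proof -
  have pos: "f x > 0" if "x > 0" for x
    using f that by (auto simp: regularly_varying_def)
  have "\<forall>\<^sub>F x in at_top. ln (f (exp x)) \<le> \<kappa> * x"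
    by (rule increments_linear_bound[OF _ regularly_varying_log_increments[OF f] assms(3)]) simp
  then have "\<forall>\<^sub>F R in at_top. ln (f (exp (ln R))) \<le> \<kappa> * ln R"
    using ln_at_top by (rule eventually_compose_filterlim)
  moreover have "\<forall>\<^sub>F R in at_top. (0::real) < R" by (rule eventually_gt_at_top)
  ultimately show ?thesis
  proof eventually_elim
    case (elim R)
    then have "f R \<le> exp (\<kappa> * ln R)" using pos[of R] by (simp flip: ln_le_cancel_iff)
    then show ?case using elim by (simp add: powr_def)
  qed
qed

lemma regularly_varying_inverse:
  assumes "regularly_varying f \<alpha>"
  shows "regularly_varying (\<lambda>x. inverse (f x)) (- \<alpha>)"
proof -
  have "((\<lambda>R. inverse (f (t * R) / f R)) \<longlongrightarrow> inverse (t powr \<alpha>)) at_top" if "t > 0" for t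
    using assms that by (intro tendsto_inverse) (auto simp: regularly_varying_def)
  then show ?thesis
    using assms by (auto simp: regularly_varying_def field_simps powr_minus)
qed

lemma regularly_varying_ge_powr:
  assumes f: "regularly_varying f \<alpha>" and [measurable]: "(\<lambda>x. f (exp x)) \<in> borel_measurable borel"
    and "\<kappa> < \<alpha>"
  shows "\<forall>\<^sub>F R in at_top. R powr \<kappa> \<le> f R"
proof -
  have pos: "f x > 0" if "x > 0" for x
    using f that by (auto simp: regularly_varying_def)
  have "\<forall>\<^sub>F R in at_top. inverse (f R) \<le> R powr (- \<kappa>)"
    using assms by (intro regularly_varying_le_powr[OF regularly_varying_inverse[OF f]]) auto
  moreover have "\<forall>\<^sub>F R in at_top. (0::real) < R" by (rule eventually_gt_at_top)
  ultimately show ?thesis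
    by eventually_elim (use pos in \<open>auto simp: powr_minus\<close>)
qed

section \<open>Superexponential exponents\<close>

lemma C2_halfline_has_derivative:
  assumes "C2_halfline \<psi>" "z > 0"
  shows "(\<psi> has_real_derivative deriv \<psi> z) (at z)"
proof -
  obtain \<psi>' where "\<forall>z\<ge>0. (\<psi> has_real_derivative \<psi>' z) (at z within {0..})"
    using assms by (auto simp: C2_halfline_def)
  then have "(\<psi> has_real_derivative \<psi>' z) (at z within {0..})"
    using assms by auto
  then have "(\<psi> has_real_derivative \<psi>' z) (at z)"
    using assms(2) by (subst (asm) at_within_interior) (auto simp: interior_Ici[where b="-1"])
  then show ?thesis
    by (simp add: DERIV_imp_deriv)
qed

text \<open>A decreasing derivative would make the gain of \<psi> from \<open>2 * R\<close> to
  \<open>4 * R\<close> at most twice the gain from \<open>R\<close> to \<open>2 * R\<close>. Divided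
  by \<open>\<psi> R\<close>, the limit reads
  \<open>(2 powr v - 1) * (2 powr v - 2) \<le> 0\<close>, which fails for \<open>v > 1\<close>. So
  \<psi> is convex far out.\<close>

lemma superexponential_mono_deriv:
  fixes q :: "real ^ 'd \<Rightarrow> real"
  assumes "superexponential_decay q \<psi>"
  shows "\<exists>z1>0. mono_on {z1..} (deriv \<psi>) \<and> (\<forall>z\<ge>z1. deriv \<psi> z > 0)"
proof -
  from assms obtain v where v: "v > 1" "regularly_varying \<psi> v"
    and vM: "von_Mises_type \<psi>"
    and "\<exists>z0. mono_on {z0..} (deriv \<psi>) \<or> antimono_on {z0..} (deriv \<psi>)"
    by (auto simp: superexponential_decay_def light_tail_def)
  then obtain z0 where z0: "mono_on {z0..} (deriv \<psi>) \<or> antimono_on {z0..} (deriv \<psi>)"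
    by blast
  have der: "(\<psi> has_real_derivative deriv \<psi> z) (at z)" if "z > 0" for z
    using vM that by (intro C2_halfline_has_derivative) (auto simp: von_Mises_type_def)
  have mvt: "\<exists>\<xi>. x < \<xi> \<and> \<xi> < y \<and> \<psi> y - \<psi> x = (y - x) * deriv \<psi> \<xi>" if "0 < x" "x < y" for x y
    using that by (intro MVT2) (auto intro: der)
  have "\<not> antimono_on {z0..} (deriv \<psi>)"
  proof
    assume anti: "antimono_on {z0..} (deriv \<psi>)"
    have ge: "\<psi> (4 * R) / \<psi> R - \<psi> (2 * R) / \<psi> R \<le> 2 * (\<psi> (2 * R) / \<psi> R - 1)" if R: "R \<ge> max z0 1" for R
    proof -
      obtain \<xi> where \<xi>: "R < \<xi>" "\<xi> < 2 * R" "\<psi> (2 * R) - \<psi> R = (2 * R - R) * deriv \<psi> \<xi>"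
        using mvt[of R "2 * R"] R by auto
      obtain \<eta> where \<eta>: "2 * R < \<eta>" "\<eta> < 4 * R" "\<psi> (4 * R) - \<psi> (2 * R) = (4 * R - 2 * R) * deriv \<psi> \<eta>"
        using mvt[of "2 * R" "4 * R"] R by auto
      have "deriv \<psi> \<eta> \<le> deriv \<psi> \<xi>"
        using anti R \<xi> \<eta> by (auto simp: monotone_on_def)
      then have "R * deriv \<psi> \<eta> \<le> R * deriv \<psi> \<xi>"
        using R by (intro mult_left_mono) auto
      then have "\<psi> (4 * R) - \<psi> (2 * R) \<le> 2 * (\<psi> (2 * R) - \<psi> R)"
        using \<xi>(3) \<eta>(3) by (simp add: algebra_simps)
      then have "(\<psi> (4 * R) - \<psi> (2 * R)) / \<psi> R \<le> 2 * (\<psi> (2 * R) - \<psi> R) / \<psi> R"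
        using v R by (intro divide_right_mono) (auto simp: regularly_varying_def less_imp_le)
      moreover have "\<psi> R > 0" using v R by (auto simp: regularly_varying_def)
      ultimately show ?thesis by (simp add: diff_divide_distrib right_diff_distrib)
    qed
    have "4 powr v - 2 powr v \<le> 2 * (2 powr v - 1)"
    proof (rule tendsto_le[OF trivial_limit_at_top_linorder])
      show "((\<lambda>R. \<psi> (4 * R) / \<psi> R - \<psi> (2 * R) / \<psi> R) \<longlongrightarrow> 4 powr v - 2 powr v) at_top"
        "((\<lambda>R. 2 * (\<psi> (2 * R) / \<psi> R - 1)) \<longlongrightarrow> 2 * (2 powr v - 1)) at_top"
        using v unfolding regularly_varying_def by (intro tendsto_intros; simp)+
      show "\<forall>\<^sub>F R in at_top. \<psi> (4 * R) / \<psi> R - \<psi> (2 * R) / \<psi> R \<le> 2 * (\<psi> (2 * R) / \<psi> R - 1)"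
        using ge eventually_ge_at_top[of "max z0 1"] by (auto elim: eventually_mono)
    qed
    moreover have "4 powr v = 2 powr v * (2 powr v :: real)"
      using powr_mult[of 2 2 v] by simp
    moreover have "2 powr v > (2::real)"
      using powr_less_mono[of 1 v 2] v by simp
    moreover have "(2 powr v - 1) * (2 powr v - 2 :: real) > 0"
      using calculation(3) by (intro mult_pos_pos) auto
    ultimately show False by (simp add: algebra_simps)
  qed
  with z0 have mono: "mono_on {z0..} (deriv \<psi>)" by auto
  obtain z2 where "\<And>z. z \<ge> z2 \<Longrightarrow> deriv \<psi> z > 0"
    using vM by (auto simp: von_Mises_type_def eventually_at_top_linorder)
  with mono show ?thesis
    by (intro exI[of _ "max (max z0 z2) 1"]) (auto simp: monotone_on_def)
qed

locale superexponential =
  fixes \<psi> \<psi>inv :: "real \<Rightarrow> real" and v z1 :: real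
  assumes rv: "regularly_varying \<psi> v" and v_gt_1: "v > 1"
    and der: "\<And>z. z > 0 \<Longrightarrow> (\<psi> has_real_derivative deriv \<psi> z) (at z)"
    and cont: "continuous_on {0..} \<psi>"
    and z1_pos: "z1 > 0"
    and deriv_mono: "\<And>x y. z1 \<le> x \<Longrightarrow> x \<le> y \<Longrightarrow> deriv \<psi> x \<le> deriv \<psi> y"
    and deriv_pos: "\<And>x. z1 \<le> x \<Longrightarrow> deriv \<psi> x > 0"
    and inv: "inverse_at_top \<psi> \<psi>inv"
begin

lemma \<psi>_pos: "x > 0 \<Longrightarrow> \<psi> x > 0"
  using rv by (auto simp: regularly_varying_def)

lemma \<psi>_exp_measurable[measurable]: "(\<lambda>x. \<psi> (exp x)) \<in> borel_measurable borel"
  by (intro borel_measurable_continuous_onI continuous_on_compose2[OF cont] continuous_intros) auto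

lemma mvt:
  assumes "0 < x" "x < y"
  obtains \<xi> where "x < \<xi>" "\<xi> < y" "\<psi> y - \<psi> x = (y - x) * deriv \<psi> \<xi>"
  using MVT2[of x y \<psi> "deriv \<psi>"] assms der by (meson less_le_trans)

lemma \<psi>_diff_ge:
  assumes "z1 \<le> x" "x \<le> y"
  shows "(y - x) * deriv \<psi> x \<le> \<psi> y - \<psi> x"
proof (cases "x = y")
  case False
  then obtain \<xi> where "x < \<xi>" "\<xi> < y" "\<psi> y - \<psi> x = (y - x) * deriv \<psi> \<xi>"
    using mvt[of x y] assms z1_pos by auto
  then show ?thesis using deriv_mono[of x \<xi>] assms by (auto intro!: mult_left_mono)
qed auto

lemma \<psi>_diff_le:
  assumes "z1 \<le> x" "x \<le> y"
  shows "\<psi> y - \<psi> x \<le> (y - x) * deriv \<psi> y"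
proof (cases "x = y")
  case False
  then obtain \<xi> where "x < \<xi>" "\<xi> < y" "\<psi> y - \<psi> x = (y - x) * deriv \<psi> \<xi>"
    using mvt[of x y] assms z1_pos by auto
  then show ?thesis using deriv_mono[of \<xi> y] assms by (auto intro!: mult_left_mono)
qed auto

lemma \<psi>_strict_mono: "z1 \<le> x \<Longrightarrow> x < y \<Longrightarrow> \<psi> x < \<psi> y"
  using \<psi>_diff_ge[of x y] deriv_pos[of x] mult_pos_pos[of "y - x" "deriv \<psi> x"] by linarith

lemma \<psi>_mono: "z1 \<le> x \<Longrightarrow> x \<le> y \<Longrightarrow> \<psi> x \<le> \<psi> y"
  using \<psi>_strict_mono[of x y] by (cases "x = y") auto

lemma ratio_less:
  assumes "t > 0" "t powr v < c"
  shows "\<forall>\<^sub>F R in at_top. \<psi> (t * R) < c * \<psi> R"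
proof -
  have "((\<lambda>R. \<psi> (t * R) / \<psi> R) \<longlongrightarrow> t powr v) at_top"
    using rv assms by (auto simp: regularly_varying_def)
  then have "\<forall>\<^sub>F R in at_top. \<psi> (t * R) / \<psi> R < c"
    using assms(2) by (rule order_tendstoD)
  moreover have "\<forall>\<^sub>F R in at_top. (0::real) < R" by (rule eventually_gt_at_top)
  ultimately show ?thesis
    by eventually_elim (use \<psi>_pos in \<open>auto simp: field_simps\<close>)
qed

lemma half_powr_v: "(1/2) powr v < (1/2 :: real)"
  using powr_less_mono'[of "1/2" 1 v] v_gt_1 by simp

text \<open>For \<open>v > 1\<close> the limit ratio \<open>(1/2) powr v\<close> lies strictly below
  1/2. This superlinear growth localises \<open>\<psi>inv\<close> and bounds the derivative from
  below.\<close>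

lemma \<psi>_half: "\<forall>\<^sub>F R in at_top. \<psi> (R / 2) < \<psi> R / 2"
  using ratio_less[of "1/2" "1/2"] half_powr_v by simp

lemma \<psi>_double: "\<forall>\<^sub>F R in at_top. 2 * \<psi> R < \<psi> (2 * R)"
proof -
  have "\<forall>\<^sub>F R in at_top. \<psi> (2 * R / 2) < \<psi> (2 * R) / 2"
    by (rule eventually_compose_filterlim[OF \<psi>_half])
       (rule filterlim_tendsto_pos_mult_at_top[OF tendsto_const _ filterlim_ident], simp)
  then show ?thesis by eventually_elim auto
qed

section \<open>Order of magnitude of the derivative of \<psi>\<close>

text \<open>At least half of \<open>\<psi> R\<close> is gained between \<open>R / 2\<close> and
  \<open>R\<close>, where the derivative is largest at \<open>R\<close>.\<close>

lemma deriv_ge: "\<forall>\<^sub>F R in at_top. \<psi> R / R \<le> deriv \<psi> R"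
  using \<psi>_half eventually_ge_at_top[of "2 * z1"]
proof eventually_elim
  case (elim R)
  have "\<psi> R - \<psi> (R / 2) \<le> (R / 2) * deriv \<psi> R"
    using \<psi>_diff_le[of "R / 2" R] elim z1_pos by (auto simp: field_simps)
  with elim have "\<psi> R \<le> R * deriv \<psi> R" by auto
  then show ?case using elim z1_pos by (auto simp: field_simps)
qed

text \<open>The mirror image between \<open>R\<close> and \<open>2 * R\<close>, where the derivative
  is smallest at \<open>R\<close>; the exponent \<open>v + 1\<close> leaves room above the limit
  ratio \<open>2 powr v\<close>.\<close>

lemma deriv_le: "\<forall>\<^sub>F R in at_top. deriv \<psi> R \<le> 2 powr (v + 1) * \<psi> R / R"
  using ratio_less[of 2 "2 powr (v + 1)", simplified] eventually_ge_at_top[of z1]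
proof eventually_elim
  case (elim R)
  have "R * deriv \<psi> R \<le> \<psi> (2 * R) - \<psi> R"
    using \<psi>_diff_ge[of R "2 * R"] elim z1_pos by (auto simp: field_simps)
  with elim have "R * deriv \<psi> R \<le> 2 powr (v + 1) * \<psi> R" 
    using \<psi>_pos[of R] z1_pos by auto
  then show ?case using elim z1_pos by (auto simp: field_simps)
qed

lemma deriv_le_\<psi>: "\<forall>\<^sub>F R in at_top. deriv \<psi> R \<le> \<psi> R"
  using deriv_le eventually_ge_at_top[of z1] eventually_ge_at_top[of "2 powr (v + 1)"]
proof eventually_elim
  case (elim R)
  have R: "R > 0" using elim z1_pos by auto
  have "2 powr (v + 1) * \<psi> R / R \<le> R * \<psi> R / R"
    using elim R \<psi>_pos[of R] by (intro divide_right_mono mult_right_mono) auto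
  then show ?case using elim R by simp
qed


text \<open>The derivative has order \<open>\<psi> R / R\<close>, and \<psi> changes at most by the
  factor \<open>D\<close> on this range. \<open>C\<close> collects \<open>2 powr (v + 1)\<close>
  from the upper bound, \<open>D\<close>, and the factor 4 between \<open>s\<close> and
  \<open>R\<close>.\<close>

lemma deriv_comparable:
  "\<exists>C\<ge>1. \<forall>\<^sub>F R in at_top. \<forall>s\<in>{R/4..4*R}. deriv \<psi> R / C \<le> deriv \<psi> s \<and> deriv \<psi> s \<le> C * deriv \<psi> R"
proof -
  obtain D where D: "D \<ge> 1" "\<forall>\<^sub>F R in at_top. \<forall>s\<in>{R/4..4*R}. \<psi> R / D \<le> \<psi> s \<and> \<psi> s \<le> D * \<psi> R"
    using regularly_varying_bounded_ratio[OF rv] by auto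
  define C where "C = 2 powr (v + 1) * D * 4"
  have C: "C \<ge> 1"
    unfolding C_def using v_gt_1 D ge_one_powr_ge_zero[of 2 "v + 1"]
      mult_mono[of 1 "2 powr (v + 1)" 1 D] by auto
  obtain R1 where R1: "\<And>R. R \<ge> R1 \<Longrightarrow> deriv \<psi> R \<le> 2 powr (v + 1) * \<psi> R / R \<and> \<psi> R / R \<le> deriv \<psi> R"
    using eventually_conj[OF deriv_le deriv_ge] by (auto simp: eventually_at_top_linorder)
  show ?thesis
  proof (intro exI[of _ C] conjI C)
    show "\<forall>\<^sub>F R in at_top. \<forall>s\<in>{R/4..4*R}. deriv \<psi> R / C \<le> deriv \<psi> s \<and> deriv \<psi> s \<le> C * deriv \<psi> R"
      using D(2) eventually_ge_at_top[of "4 * R1"] eventually_ge_at_top[of "4 * z1"]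
    proof eventually_elim
      case (elim R)
      show ?case
      proof
        fix s assume s: "s \<in> {R/4..4*R}"
        have R: "R > 0" using elim z1_pos by auto
        have pos: "\<psi> R > 0" "\<psi> s > 0" using R s by (auto intro!: \<psi>_pos)
        have "deriv \<psi> R / C \<le> (2 powr (v + 1) * \<psi> R / R) / C"
          using R1[of R] elim C R by (intro divide_right_mono) auto
        also have "\<dots> = (\<psi> R / D) / (4 * R)"
          using R D by (simp add: C_def field_simps)
        also have "\<dots> \<le> \<psi> s / s"
          using elim s R pos by (intro frac_le) auto
        also have "\<dots> \<le> deriv \<psi> s"
          using R1[of s] elim s by auto
        finally have 1: "deriv \<psi> R / C \<le> deriv \<psi> s" .
        have "deriv \<psi> s \<le> 2 powr (v + 1) * \<psi> s / s"
          using R1[of s] elim s by auto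
        also have "\<dots> \<le> 2 powr (v + 1) * (D * \<psi> R) / (R / 4)"
          using elim s R pos D by (intro frac_le mult_left_mono) auto
        also have "\<dots> = C * (\<psi> R / R)"
          using R D by (simp add: C_def field_simps)
        also have "\<dots> \<le> C * deriv \<psi> R"
          using R1[of R] elim C R by (intro mult_left_mono) auto
        finally show "deriv \<psi> R / C \<le> deriv \<psi> s \<and> deriv \<psi> s \<le> C * deriv \<psi> R"
          using 1 by auto
      qed
    qed
  qed
qed

lemma \<psi>_le_powr: "\<forall>\<^sub>F R in at_top. \<psi> R \<le> R powr (v + 1)"
  by (rule regularly_varying_le_powr[OF rv]) auto

lemma \<psi>_ge_powr: "\<kappa> < v \<Longrightarrow> \<forall>\<^sub>F R in at_top. R powr \<kappa> \<le> \<psi> R"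
  by (rule regularly_varying_ge_powr[OF rv]) auto

lemma \<psi>_bounded_initially:
  obtains B where "\<And>t. 0 \<le> t \<Longrightarrow> t \<le> K \<Longrightarrow> \<psi> t \<le> B"
proof -
  have "bounded (\<psi> ` {0..K})"
    by (intro compact_imp_bounded compact_continuous_image continuous_on_subset[OF cont]) auto
  then obtain a where "\<forall>x\<in>{0..K}. \<bar>\<psi> x\<bar> \<le> a"
    by (auto simp: bounded_iff)
  then show ?thesis
    by (intro that[of a]) (auto dest!: bspec)
qed

section \<open>Asymptotics of \<open>\<psi>inv\<close> and of the inverse length scale
  \<open>b\<close>\<close>

text \<open>Since \<psi> is bounded on \<open>{0..K}\<close>, it can take a large value
  \<open>z\<close> on the half-line only beyond \<open>K\<close>.\<close>

lemma \<psi>inv_at_top: "filterlim \<psi>inv at_top at_top"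
  unfolding filterlim_at_top
proof
  fix K
  obtain B where B: "\<And>t. 0 \<le> t \<Longrightarrow> t \<le> K \<Longrightarrow> \<psi> t \<le> B"
    by (rule \<psi>_bounded_initially) blast
  have "\<forall>\<^sub>F z in at_top. \<psi>inv z \<ge> 0 \<and> \<psi> (\<psi>inv z) = z"
    using inv by (auto simp: inverse_at_top_def)
  then show "\<forall>\<^sub>F z in at_top. K \<le> \<psi>inv z"
    using eventually_gt_at_top[of B]
  proof eventually_elim
    case (elim z)
    then show ?case using B[of "\<psi>inv z"] by (cases "K \<le> \<psi>inv z") auto
  qed
qed

lemma \<psi>_\<psi>inv: "\<forall>\<^sub>F z in at_top. \<psi> (\<psi>inv z) = z"
  using inv by (auto simp: inverse_at_top_def elim: eventually_mono)

text \<open>Eventually \<open>z\<close> differs from \<open>x\<close> by at most a quarter of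
  \<open>x\<close>, while \<psi> is below \<open>x / 2\<close> at half of \<open>\<psi>inv x\<close>
  and above \<open>2 * x\<close> at its double; monotonicity traps \<open>\<psi>inv z\<close> in
  between. All critical radii have this form, so \<open>deriv_comparable\<close> and its analogue
  for \<open>L\<close> apply to them with the common centre \<open>\<psi>inv x\<close>.\<close>

lemma \<psi>inv_window:
  "\<forall>\<^sub>F x in at_top. \<forall>z. \<bar>z - x\<bar> \<le> K * ln x \<longrightarrow>
     \<psi> (\<psi>inv z) = z \<and> \<psi>inv x / 2 \<le> \<psi>inv z \<and> \<psi>inv z \<le> 2 * \<psi>inv x"
proof -
  have "\<forall>\<^sub>F z in at_top. \<psi> (\<psi>inv z) = z \<and> \<psi>inv z \<ge> z1"
    using \<psi>_\<psi>inv \<psi>inv_at_top by (auto simp: filterlim_at_top eventually_conj_iff)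
  then obtain z2 where z2: "\<And>z. z \<ge> z2 \<Longrightarrow> \<psi> (\<psi>inv z) = z \<and> \<psi>inv z \<ge> z1"
    by (auto simp: eventually_at_top_linorder)
  have ev: "\<forall>\<^sub>F R in at_top. \<psi> (R / 2) < \<psi> R / 2 \<and> 2 * \<psi> R < \<psi> (2 * R) \<and> R \<ge> 2 * z1"
    using \<psi>_half \<psi>_double eventually_ge_at_top[of "2 * z1"] by (auto simp: eventually_conj_iff)
  have "\<forall>\<^sub>F x in at_top. K * ln x < x / 4"
    by real_asymp
  moreover have "\<forall>\<^sub>F x in at_top. x \<ge> max 1 (2 * z2)"
    by (rule eventually_ge_at_top)
  ultimately show ?thesis
    using eventually_compose_filterlim[OF ev \<psi>inv_at_top]
  proof eventually_elim
    case (elim x)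
    show ?case
    proof (intro allI impI)
      fix z assume z: "\<bar>z - x\<bar> \<le> K * ln x"
      let ?r = "\<psi>inv x"
      have zx: "3 / 4 * x \<le> z" "z \<le> 5 / 4 * x" using z elim by (auto simp: abs_if split: if_splits)
      have z2z: "\<psi> (\<psi>inv z) = z" "\<psi>inv z \<ge> z1" using z2[of z] zx elim by auto
      have z2x: "\<psi> ?r = x" "?r \<ge> z1" using z2[of x] zx elim by auto
      have "?r / 2 \<le> \<psi>inv z"
      proof (rule ccontr)
        assume "\<not> ?r / 2 \<le> \<psi>inv z"
        then have "z \<le> \<psi> (?r / 2)" using \<psi>_mono[of "\<psi>inv z" "?r / 2"] z2z by auto
        then show False using elim zx z2x by auto
      qed
      moreover have "\<psi>inv z \<le> 2 * ?r"
      proof (rule ccontr)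
        assume "\<not> \<psi>inv z \<le> 2 * ?r"
        then have "\<psi> (2 * ?r) \<le> z" using \<psi>_mono[of "2 * ?r" "\<psi>inv z"] z2z z2x z1_pos by auto
        then show False using elim zx z2x by auto
      qed
      ultimately show "\<psi> (\<psi>inv z) = z \<and> ?r / 2 \<le> \<psi>inv z \<and> \<psi>inv z \<le> 2 * ?r"
        using z2z by auto
    qed
  qed
qed

abbreviation b where "b x \<equiv> deriv \<psi> (\<psi>inv x)"

lemma \<psi>inv_le: "\<forall>\<^sub>F x in at_top. \<psi>inv x \<le> x"
proof -
  have "\<forall>\<^sub>F x in at_top. \<psi>inv x powr 1 \<le> \<psi> (\<psi>inv x)"
    by (rule eventually_compose_filterlim[OF \<psi>_ge_powr \<psi>inv_at_top]) (use v_gt_1 in auto)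
  moreover have "\<forall>\<^sub>F x in at_top. \<psi>inv x \<ge> 1"
    using \<psi>inv_at_top by (auto simp: filterlim_at_top)
  ultimately show ?thesis
    using \<psi>_\<psi>inv by eventually_elim auto
qed

lemma b_le: "\<forall>\<^sub>F x in at_top. b x \<le> x"
  using eventually_compose_filterlim[OF deriv_le_\<psi> \<psi>inv_at_top] \<psi>_\<psi>inv
  by eventually_elim auto

lemma \<psi>inv_ge_powr: "\<forall>\<^sub>F x in at_top. x powr (1 / (v + 1)) \<le> \<psi>inv x"
proof -
  have "\<forall>\<^sub>F x in at_top. \<psi>inv x \<ge> 1"
    using \<psi>inv_at_top by (auto simp: filterlim_at_top)
  then show ?thesis
    using eventually_compose_filterlim[OF \<psi>_le_powr \<psi>inv_at_top] \<psi>_\<psi>inv eventually_gt_at_top[of 0]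
  proof eventually_elim
    case (elim x)
    then have "x powr (1 / (v + 1)) \<le> (\<psi>inv x powr (v + 1)) powr (1 / (v + 1))"
      using v_gt_1 by (intro powr_mono2) auto
    then show ?case using elim v_gt_1 by (simp add: powr_powr)
  qed
qed

text \<open>The lower bound \<open>\<psi> R / R\<close> for the derivative is at least
  \<open>R powr \<delta>\<close>, where \<delta> is positive because \<open>v > 1\<close>, and
  \<open>\<psi>inv x\<close> is at least a power of \<open>x\<close>.\<close>

lemma b_ge_powr: "\<exists>\<eta>>0. \<forall>\<^sub>F x in at_top. x powr \<eta> \<le> b x"
proof -
  define \<delta> where "\<delta> = (v - 1) / 2"
  have \<delta>: "\<delta> > 0" "1 + \<delta> < v" using v_gt_1 by (auto simp: \<delta>_def field_simps)
  have "\<forall>\<^sub>F R in at_top. R powr \<delta> \<le> deriv \<psi> R"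
    using \<psi>_ge_powr[OF \<delta>(2)] deriv_ge eventually_gt_at_top[of 0]
  proof eventually_elim
    case (elim R)
    have "R powr \<delta> = R powr (1 + \<delta>) / R" using elim by (simp add: powr_add)
    also have "\<dots> \<le> \<psi> R / R" using elim by (intro divide_right_mono) auto
    finally show ?case using elim by auto
  qed
  then have "\<forall>\<^sub>F x in at_top. \<psi>inv x powr \<delta> \<le> b x"
    using \<psi>inv_at_top by (rule eventually_compose_filterlim)
  then have "\<forall>\<^sub>F x in at_top. x powr (\<delta> / (v + 1)) \<le> b x"
    using \<psi>inv_ge_powr
  proof eventually_elim
    case (elim x)
    have "x powr (\<delta> / (v + 1)) = (x powr (1 / (v + 1))) powr \<delta>"
      by (simp add: powr_powr)
    also have "\<dots> \<le> \<psi>inv x powr \<delta>"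
      using elim \<delta> by (intro powr_mono2) auto
    finally show ?case using elim by auto
  qed
  then show ?thesis using \<delta> v_gt_1 by (intro exI[of _ "\<delta> / (v + 1)"]) auto
qed

lemma b_at_top: "filterlim b at_top at_top"
proof -
  obtain \<eta> where \<eta>: "\<eta> > 0" "\<forall>\<^sub>F x in at_top. x powr \<eta> \<le> b x" using b_ge_powr by auto
  have "filterlim (\<lambda>x::real. x powr \<eta>) at_top at_top" using \<eta>(1) by real_asymp
  then show ?thesis using \<eta>(2) by (rule filterlim_at_top_mono)
qed

lemma ln_over_b: "((\<lambda>x. ln x / b x) \<longlongrightarrow> 0) at_top"
proof -
  obtain \<eta> where \<eta>: "\<eta> > 0" "\<forall>\<^sub>F x in at_top. x powr \<eta> \<le> b x" using b_ge_powr by auto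
  have "((\<lambda>x. ln x / x powr \<eta>) \<longlongrightarrow> 0) at_top" using \<eta>(1) by real_asymp
  moreover have "\<forall>\<^sub>F x in at_top. norm (ln x / b x) \<le> ln x / x powr \<eta>"
    using \<eta>(2) eventually_ge_at_top[of 1]
  proof eventually_elim
    case (elim x)
    have "b x > 0" using elim by (smt (verit) powr_gt_zero)
    then show ?case using elim by (auto intro!: divide_left_mono)
  qed
  ultimately show ?thesis by (rule Lim_null_comparison[rotated])
qed

end

section \<open>Poisson samples\<close>

text \<open>For negative \<open>x\<close> the product
  \<open>(1 - x) * (1 + x + x\<^sup>2) = 1 - x ^ 3\<close> is at least 1, and
  \<open>1 - x \<le> exp (- x)\<close>.\<close>

lemma exp_le_quadratic:
  fixes x :: real
  assumes "\<bar>x\<bar> \<le> 1"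
  shows "exp x \<le> 1 + x + x\<^sup>2"
proof (cases "x \<ge> 0")
  case True
  then show ?thesis using exp_bound assms by auto
next
  case False
  have "1 \<le> (1 - x) * (1 + x + x\<^sup>2)"
    using False assms mult_nonneg_nonneg[of "- x" "x\<^sup>2"] by (simp add: algebra_simps power2_eq_square)
  also have "\<dots> \<le> exp (- x) * (1 + x + x\<^sup>2)"
    using exp_ge_add_one_self[of "- x"] False assms by (intro mult_right_mono) auto
  finally show ?thesis by (simp add: exp_minus field_simps)
qed

section \<open>Connectivity of geometric graphs and the second moment method\<close>

lemma connected_geometric_graph_iff:
  "Digraph_Component.connected (geometric_graph P r) \<longleftrightarrow>
     P \<noteq> {} \<and> (\<forall>u\<in>P. \<forall>v\<in>P. (u, v) \<in> {(x, y). x \<in> P \<and> y \<in> P \<and> dist x y < r}\<^sup>*)"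
proof -
  define E where "E = {(x, y). x \<in> P \<and> y \<in> P \<and> x \<noteq> y \<and> dist x y < r}"
  have arcs: "parcs (mk_symmetric (geometric_graph P r)) = E"
    by (auto simp: mk_symmetric_def geometric_graph_def E_def dist_commute)
  have verts: "pverts (mk_symmetric (geometric_graph P r)) = P"
    by (simp add: geometric_graph_def)
  have "{(x, y). x \<in> P \<and> y \<in> P \<and> dist x y < r}\<^sup>* = E\<^sup>*"
    by (rule rtrancl_subset) (auto simp: E_def intro: rtrancl.rtrancl_refl)
  moreover have "(u, v) \<in> rtrancl_on P E \<longleftrightarrow> (u, v) \<in> E\<^sup>*" if "u \<in> P" "v \<in> P" for u v
  proof
    assume "(u, v) \<in> E\<^sup>*"
    then show "(u, v) \<in> rtrancl_on P E"
      using that by (rule rtrancl_consistent_rtrancl_on) (simp add: E_def)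
  qed (rule rtrancl_on_rtranclI)
  moreover have "verts (geometric_graph P r) = P"
    by (simp add: geometric_graph_def)
  ultimately show ?thesis
    by (simp add: Digraph_Component.connected_def strongly_connected_def reachable_def verts arcs)
qed

text \<open>Edges are shorter than \<open>r\<close>, so a path leaving the inner ball would have to
  visit the surrounding shell of width \<open>r\<close>, which contains no vertex.\<close>

lemma not_connected_if_isolated_ball:
  assumes "u \<in> P \<inter> ball y s" "P \<inter> (ball y (s + r) - ball y s) = {}" "w \<in> P - ball y s"
  shows "\<not> Digraph_Component.connected (geometric_graph P r)"
proof
  assume "Digraph_Component.connected (geometric_graph P r)"
  then have "(u, w) \<in> {(x, y). x \<in> P \<and> y \<in> P \<and> dist x y < r}\<^sup>*"
    using assms by (auto simp: connected_geometric_graph_iff)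
  then have "w \<in> ball y s"
  proof induction
    case base
    then show ?case using assms by auto
  next
    case (step x z)
    then have "z \<in> P" "dist y z < s + r"
      using dist_triangle[of y z x] by auto
    with assms(2) show ?case by auto
  qed
  with assms show False by auto
qed

text \<open>Chebyshev's argument: where no event occurs, the centred count equals minus its mean
  \<open>S\<close>, and by pairwise independence its variance is at most \<open>S\<close>, whence
  \<open>prob ?A * S\<^sup>2 \<le> S\<close>.\<close>

lemma (in prob_space) prob_none_le_inverse_expectation:
  assumes J: "finite J" and E[measurable]: "\<And>k. k \<in> J \<Longrightarrow> E k \<in> events"
    and indep: "\<And>k l. k \<in> J \<Longrightarrow> l \<in> J \<Longrightarrow> k \<noteq> l \<Longrightarrow> prob (E k \<inter> E l) = prob (E k) * prob (E l)"
    and S_pos: "(\<Sum>k\<in>J. prob (E k)) > 0"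
  shows "prob {\<omega>\<in>space M. \<forall>k\<in>J. \<omega> \<notin> E k} \<le> 1 / (\<Sum>k\<in>J. prob (E k))"
proof -
  define S where "S = (\<Sum>k\<in>J. prob (E k))"
  let ?I = "\<lambda>k \<omega>. indicat_real (E k) \<omega> - prob (E k)"
  let ?A = "{\<omega>\<in>space M. \<forall>k\<in>J. \<omega> \<notin> E k}"
  have A: "?A \<in> events" using J by measurable
  have int_ind: "integrable M (indicat_real A)" if "A \<in> events" for A
    using that by (intro integrable_const_bound[where B = 1]) auto
  have intI: "integrable M (\<lambda>\<omega>. ?I k \<omega> * ?I l \<omega>)" if "k \<in> J" "l \<in> J" for k l
    by (rule integrable_const_bound[where B = 1])
       (use that in \<open>auto simp: indicator_def abs_mult intro!: mult_le_one\<close>)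
  have E_I: "(\<integral>\<omega>. ?I k \<omega> * ?I l \<omega> \<partial>M) = prob (E k \<inter> E l) - prob (E k) * prob (E l)"
    if "k \<in> J" "l \<in> J" for k l
  proof -
    have "(\<integral>\<omega>. ?I k \<omega> * ?I l \<omega> \<partial>M) = (\<integral>\<omega>. indicat_real (E k \<inter> E l) \<omega>
        - prob (E l) * indicat_real (E k) \<omega> - prob (E k) * indicat_real (E l) \<omega> + prob (E k) * prob (E l) \<partial>M)"
      by (intro Bochner_Integration.integral_cong) (auto simp: indicator_def algebra_simps)
    also have "\<dots> = prob (E k \<inter> E l) - prob (E k) * prob (E l)"
      using that E[OF that(1)] E[OF that(2)] by (simp add: int_ind prob_space)
    finally show ?thesis .
  qed
  have "prob ?A * S\<^sup>2 = (\<integral>\<omega>. indicat_real ?A \<omega> * S\<^sup>2 \<partial>M)"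
    using A by simp
  also have "\<dots> \<le> (\<integral>\<omega>. (\<Sum>k\<in>J. \<Sum>l\<in>J. ?I k \<omega> * ?I l \<omega>) \<partial>M)"
  proof (intro integral_mono Bochner_Integration.integrable_sum intI)
    show "integrable M (\<lambda>\<omega>. indicat_real ?A \<omega> * S\<^sup>2)" using int_ind[OF A] by simp
    fix \<omega>
    have "indicat_real ?A \<omega> * S\<^sup>2 \<le> (\<Sum>k\<in>J. ?I k \<omega>) * (\<Sum>l\<in>J. ?I l \<omega>)"
      by (auto simp: indicator_def S_def sum_negf power2_eq_square)
    then show "indicat_real ?A \<omega> * S\<^sup>2 \<le> (\<Sum>k\<in>J. \<Sum>l\<in>J. ?I k \<omega> * ?I l \<omega>)"
      by (simp only: sum_product)
  qed
  also have "\<dots> = (\<Sum>k\<in>J. \<Sum>l\<in>J. prob (E k \<inter> E l) - prob (E k) * prob (E l))"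
    by (simp add: Bochner_Integration.integral_sum Bochner_Integration.integrable_sum intI E_I)
  also have "\<dots> = (\<Sum>k\<in>J. \<Sum>l\<in>J. if l = k then prob (E k) - prob (E k) * prob (E k) else 0)"
    by (intro sum.cong refl) (auto simp: indep)
  also have "\<dots> = (\<Sum>k\<in>J. prob (E k) - prob (E k) * prob (E k))"
    using J by simp
  also have "\<dots> \<le> S"
    unfolding S_def by (intro sum_mono) auto
  finally have "prob ?A * S * S \<le> 1 * S" by (simp add: power2_eq_square)
  then have "prob ?A * S \<le> 1"
    using S_pos by (subst (asm) mult_le_cancel_right) (simp add: S_def)
  then show ?thesis using S_pos by (simp add: S_def field_simps)
qed

section \<open>Counting the points of a Poisson sample\<close>

locale poisson_process = prob_space M for M :: "'w measure" +
  fixes N :: "'w \<Rightarrow> nat" and X :: "nat \<Rightarrow> 'w \<Rightarrow> 'a::euclidean_space" and t :: real and \<nu> :: "'a measure"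
  assumes sample: "poisson_sample M N X t \<nu>" and t_pos: "t > 0"
begin

lemma N_measurable[measurable]: "N \<in> measurable M (count_space UNIV)"
  using sample by (simp add: poisson_sample_def)

lemma N_distr: "distr M (count_space UNIV) N = measure_pmf (poisson_pmf t)"
  using sample by (simp add: poisson_sample_def)

lemma X_indep: "indep_vars (\<lambda>_. borel) X UNIV"
  using sample by (simp add: poisson_sample_def)

lemma X_distr: "distr M borel (X i) = \<nu>"
  using sample by (simp add: poisson_sample_def)

lemma X_measurable[measurable]: "X i \<in> borel_measurable M"
  using X_indep by (auto simp: indep_vars_def)

lemma sets_\<nu>[measurable_cong, simp]: "sets \<nu> = sets borel"
  using X_distr[of 0] by auto

lemma space_\<nu>[simp]: "space \<nu> = UNIV"
  using X_distr[of 0] by auto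

lemma prob_space_\<nu>: "prob_space \<nu>"
  using X_distr[of 0] prob_space_distr[of "X 0" borel] by simp

lemma emeasure_N: "emeasure M {\<omega>\<in>space M. N \<omega> = m} = ennreal (exp (- t) * t ^ m / fact m)"
proof -
  have "emeasure M {\<omega>\<in>space M. N \<omega> = m} = emeasure (distr M (count_space UNIV) N) {m}"
    by (subst emeasure_distr) (auto intro!: arg_cong[where f = "emeasure M"])
  also have "\<dots> = ennreal (exp (- t) * t ^ m / fact m)"
    using t_pos by (simp add: N_distr emeasure_pmf_single pmf_poisson mult.commute)
  finally show ?thesis .
qed

text \<open>Counts sample indices, hence points with multiplicity. In this form powers factor over
  the independent \<open>X i\<close>; for an atomless law it agrees almost surely with the
  cardinality of the set of points in \<open>A\<close>.\<close>

definition npoints :: "'a set \<Rightarrow> 'w \<Rightarrow> nat" where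
  "npoints A \<omega> = card {i. i < N \<omega> \<and> X i \<omega> \<in> A}"

lemma npoints_0_iff: "npoints A \<omega> = 0 \<longleftrightarrow> (\<forall>i<N \<omega>. X i \<omega> \<notin> A)"
  by (auto simp: npoints_def)

lemma npoints_eq_sum: "npoints A \<omega> = (\<Sum>i<N \<omega>. if X i \<omega> \<in> A then 1 else 0)"
  by (simp add: npoints_def sum.If_cases Int_def)

lemma measurable_compose_N:
  assumes "\<And>m. f m \<in> measurable M L"
  shows "(\<lambda>\<omega>. f (N \<omega>) \<omega>) \<in> measurable M L"
  using assms by (rule measurable_compose_countable) simp

lemma npoints_measurable[measurable]:
  assumes [measurable]: "A \<in> sets borel"
  shows "npoints A \<in> measurable M (count_space UNIV)"
  unfolding npoints_eq_sum[abs_def]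
  by (rule measurable_compose_N) measurable

text \<open>Used with \<open>z = 0\<close> (where \<open>0 ^ 0 = 1\<close> leaves the void probability) and with \<open>z = exp s\<close>.\<close>

lemma npoints_generating_function:
  assumes [measurable]: "A \<in> sets borel" and z: "z \<ge> 0"
  shows "(\<integral>\<^sup>+\<omega>. ennreal (z ^ npoints A \<omega>) \<partial>M) = ennreal (exp (t * measure \<nu> A * (z - 1)))"
proof -
  interpret \<nu>: prob_space \<nu> by (rule prob_space_\<nu>)
  define p where "p = measure \<nu> A"
  have p: "0 \<le> p" "p \<le> 1" by (auto simp: p_def)
  define f :: "'a \<Rightarrow> real" where "f x = (if x \<in> A then z else 1)" for x
  have [measurable]: "f \<in> borel_measurable borel" unfolding f_def by measurable
  have f_nonneg: "f x \<ge> 0" for x using z by (auto simp: f_def)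
  define Y where "Y m \<omega> = (\<Prod>i<m. f (X i \<omega>))" for m \<omega>
  have [measurable]: "Y m \<in> borel_measurable M" for m unfolding Y_def by measurable
  have Y_nonneg: "Y m \<omega> \<ge> 0" for m \<omega> using f_nonneg by (auto simp: Y_def intro: prod_nonneg)
  have pow: "z ^ npoints A \<omega> = Y (N \<omega>) \<omega>" for \<omega>
    by (simp add: Y_def f_def npoints_def prod.If_cases Int_def)
  have Ef: "(\<integral>\<^sup>+\<omega>. ennreal (f (X i \<omega>)) \<partial>M) = ennreal (1 + p * (z - 1))" for i
  proof -
    have "(\<integral>\<^sup>+\<omega>. ennreal (f (X i \<omega>)) \<partial>M) = (\<integral>\<^sup>+x. ennreal (f x) \<partial>\<nu>)"
      by (subst X_distr[of i, symmetric], subst nn_integral_distr) auto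
    also have "\<dots> = (\<integral>\<^sup>+x. ennreal z * indicator A x + indicator (- A) x \<partial>\<nu>)"
      by (intro nn_integral_cong) (auto simp: f_def indicator_def)
    also have "\<dots> = ennreal z * emeasure \<nu> A + emeasure \<nu> (- A)"
      by (subst nn_integral_add) (auto simp: nn_integral_cmult)
    also have "emeasure \<nu> (- A) = ennreal (1 - p)"
      using \<nu>.prob_compl[of A] by (simp add: \<nu>.emeasure_eq_measure p_def Compl_eq_Diff_UNIV)
    also have "ennreal z * emeasure \<nu> A + ennreal (1 - p) = ennreal (1 + p * (z - 1))"
      using z p by (simp add: \<nu>.emeasure_eq_measure flip: p_def ennreal_mult ennreal_plus)
        (simp add: algebra_simps)
    finally show ?thesis .
  qed
  have nn: "0 \<le> 1 + p * (z - 1)"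
    using p mult_nonneg_nonneg[OF p(1) z] unfolding right_diff_distrib by linarith
  have EY: "(\<integral>\<^sup>+\<omega>. ennreal (Y m \<omega>) \<partial>M) = ennreal ((1 + p * (z - 1)) ^ m)" for m
  proof -
    have "indep_vars (\<lambda>_. borel) (\<lambda>i \<omega>. ennreal (f (X i \<omega>))) {..<m}"
      by (rule indep_vars_compose2[OF indep_vars_subset[OF X_indep]]) auto
    then have "(\<integral>\<^sup>+\<omega>. (\<Prod>i<m. ennreal (f (X i \<omega>))) \<partial>M) = (\<Prod>i<m. \<integral>\<^sup>+\<omega>. ennreal (f (X i \<omega>)) \<partial>M)"
      by (intro indep_vars_nn_integral) auto
    then show ?thesis
      using f_nonneg nn by (simp add: Ef prod_ennreal Y_def ennreal_power)
  qed
  define J where "J m = {\<omega>\<in>space M. N \<omega> = m}" for m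
  have J[measurable]: "J m \<in> sets M" for m unfolding J_def by measurable
  \<comment> \<open>The indicator of \<open>N = m\<close> is measurable for the sigma-algebra of
    \<open>N\<close>, and \<open>Y m\<close> for that of the whole sequence; the independence
    postulated for these two sigma-algebras therefore factors the integral.\<close>
  have indepY: "(\<integral>\<^sup>+\<omega>. indicator (J m) \<omega> * ennreal (Y m \<omega>) \<partial>M)
      = emeasure M (J m) * (\<integral>\<^sup>+\<omega>. ennreal (Y m \<omega>) \<partial>M)" for m
  proof -
    let ?VN = "vimage_algebra (space M) N (count_space UNIV)"
    let ?VX = "vimage_algebra (space M) (\<lambda>\<omega> i. X i \<omega>) (\<Pi>\<^sub>M i\<in>UNIV. borel)"
    have ind: "indep_set (sets ?VN) (sets ?VX)"
      using sample by (simp add: poisson_sample_def)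
    have "J m \<in> sets ?VN"
      using in_vimage_algebra[of "{m}" "count_space UNIV" N "space M"]
      by (simp add: J_def vimage_def Int_def conj_commute)
    then have I_N: "(\<lambda>\<omega>. indicator (J m) \<omega> :: ennreal) \<in> borel_measurable ?VN"
      by measurable
    have "(\<lambda>\<omega> i. X i \<omega>) \<in> measurable ?VX (\<Pi>\<^sub>M i\<in>UNIV. borel)"
      by (rule measurable_vimage_algebra1) (auto simp: space_PiM)
    then have "(\<lambda>\<omega>. X i \<omega>) \<in> borel_measurable ?VX" for i
      by (rule measurable_compose[OF _ measurable_component_singleton]) auto
    then have Y_X: "(\<lambda>\<omega>. ennreal (Y m \<omega>)) \<in> borel_measurable ?VX"
      unfolding Y_def by measurable
    have "indep_set (sigma_sets (space M) {(\<lambda>\<omega>. indicator (J m) \<omega> :: ennreal) -` A \<inter> space M |A. A \<in> sets borel})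
        (sigma_sets (space M) {(\<lambda>\<omega>. ennreal (Y m \<omega>)) -` A \<inter> space M |A. A \<in> sets borel})"
      unfolding indep_set_def
    proof (rule indep_sets_mono_sets[OF ind[unfolded indep_set_def]])
      fix i :: bool
      have "sigma_sets (space M) {(\<lambda>\<omega>. indicator (J m) \<omega> :: ennreal) -` A \<inter> space M |A. A \<in> sets borel} \<subseteq> sets ?VN"
        by (rule sets.sigma_sets_subset[of _ ?VN, simplified]) (use measurable_sets[OF I_N] in auto)
      moreover have "sigma_sets (space M) {(\<lambda>\<omega>. ennreal (Y m \<omega>)) -` A \<inter> space M |A. A \<in> sets borel} \<subseteq> sets ?VX"
        by (rule sets.sigma_sets_subset[of _ ?VX, simplified]) (use measurable_sets[OF Y_X] in auto)
      ultimately show "case_bool (sigma_sets (space M) {(\<lambda>\<omega>. indicator (J m) \<omega> :: ennreal) -` A \<inter> space M |A. A \<in> sets borel})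
        (sigma_sets (space M) {(\<lambda>\<omega>. ennreal (Y m \<omega>)) -` A \<inter> space M |A. A \<in> sets borel}) i
        \<subseteq> case_bool (sets ?VN) (sets ?VX) i"
        by (cases i) auto
    qed
    then have "indep_var borel (\<lambda>\<omega>. indicator (J m) \<omega> :: ennreal) borel (\<lambda>\<omega>. ennreal (Y m \<omega>))"
      unfolding indep_var_eq by auto
    then have "indep_vars (\<lambda>_. borel) (case_bool (\<lambda>\<omega>. indicator (J m) \<omega> :: ennreal) (\<lambda>\<omega>. ennreal (Y m \<omega>))) UNIV"
      unfolding indep_var_def by (subst (asm) indep_vars_cong[OF refl refl, of _ _ "\<lambda>_. borel"]) (auto split: bool.split)
    from indep_vars_nn_integral[OF _ this] show ?thesis
      by (simp add: UNIV_bool mult.commute)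
  qed
  \<comment> \<open>Decomposition by the value of \<open>N\<close>: at each outcome a single term
    survives, and the Poisson weights turn the powers into an exponential series.\<close>
  have "(\<integral>\<^sup>+\<omega>. ennreal (z ^ npoints A \<omega>) \<partial>M) = (\<integral>\<^sup>+\<omega>. (\<Sum>m. indicator (J m) \<omega> * ennreal (Y m \<omega>)) \<partial>M)"
  proof (intro nn_integral_cong)
    fix \<omega> assume \<omega>: "\<omega> \<in> space M"
    have "(\<Sum>m. indicator (J m) \<omega> * ennreal (Y m \<omega>)) = (\<Sum>m\<in>{N \<omega>}. indicator (J m) \<omega> * ennreal (Y m \<omega>))"
      by (rule suminf_finite) (auto simp: J_def)
    then show "ennreal (z ^ npoints A \<omega>) = (\<Sum>m. indicator (J m) \<omega> * ennreal (Y m \<omega>))"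
      using \<omega> by (simp add: pow J_def)
  qed
  also have "\<dots> = (\<Sum>m. \<integral>\<^sup>+\<omega>. indicator (J m) \<omega> * ennreal (Y m \<omega>) \<partial>M)"
    by (rule nn_integral_suminf) measurable
  also have "\<dots> = (\<Sum>m. ennreal (exp (- t) * t ^ m / fact m * (1 + p * (z - 1)) ^ m))"
    using nn t_pos by (simp only: indepY EY emeasure_N[folded J_def]) (subst ennreal_mult, auto)
  also have "\<dots> = ennreal (exp (- t) * exp (t * (1 + p * (z - 1))))"
  proof (rule suminf_ennreal_eq)
    have "(\<lambda>m. exp (- t) * ((t * (1 + p * (z - 1))) ^ m /\<^sub>R fact m)) sums (exp (- t) * exp (t * (1 + p * (z - 1))))"
      by (intro sums_mult exp_converges)
    then show "(\<lambda>m. exp (- t) * t ^ m / fact m * (1 + p * (z - 1)) ^ m) sums (exp (- t) * exp (t * (1 + p * (z - 1))))"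
      unfolding power_mult_distrib by (simp add: divide_inverse mult_ac)
  qed (use nn t_pos in auto)
  also have "exp (- t) * exp (t * (1 + p * (z - 1))) = exp (t * p * (z - 1))"
    by (simp flip: exp_add) (simp add: algebra_simps)
  finally show ?thesis by (simp add: p_def)
qed

lemma prob_npoints_0:
  assumes [measurable]: "A \<in> sets borel"
  shows "prob {\<omega>\<in>space M. npoints A \<omega> = 0} = exp (- (t * measure \<nu> A))"
proof -
  have "emeasure M {\<omega>\<in>space M. npoints A \<omega> = 0} = (\<integral>\<^sup>+\<omega>. indicator {\<omega>\<in>space M. npoints A \<omega> = 0} \<omega> \<partial>M)"
    by simp
  also have "\<dots> = (\<integral>\<^sup>+\<omega>. ennreal (0 ^ npoints A \<omega>) \<partial>M)"
    by (intro nn_integral_cong) (auto simp: indicator_def power_0_left)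
  also have "\<dots> = ennreal (exp (- (t * measure \<nu> A)))"
    using npoints_generating_function[OF assms, of 0] by simp
  finally show ?thesis by (simp add: measure_def)
qed

text \<open>The exponential Markov inequality. The factor \<open>s\<close> on both sides of the
  event lets one statement serve both tails: a negative \<open>s\<close> reverses the
  inequality.\<close>

lemma chernoff:
  assumes [measurable]: "A \<in> sets borel"
  shows "prob {\<omega>\<in>space M. s * c \<le> s * real (npoints A \<omega>)} \<le> exp (t * measure \<nu> A * (exp s - 1) - s * c)"
proof -
  have "emeasure M {\<omega>\<in>space M. s * c \<le> s * real (npoints A \<omega>)}
      = (\<integral>\<^sup>+\<omega>. indicator {\<omega>\<in>space M. s * c \<le> s * real (npoints A \<omega>)} \<omega> \<partial>M)"
    by simp
  also have "\<dots> \<le> (\<integral>\<^sup>+\<omega>. ennreal (exp (- s * c)) * ennreal (exp s ^ npoints A \<omega>) \<partial>M)"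
  proof (intro nn_integral_mono)
    fix \<omega>
    have "ennreal (exp (- s * c)) * ennreal (exp s ^ npoints A \<omega>) = ennreal (exp (s * real (npoints A \<omega>) - s * c))"
      by (simp add: mult.commute exp_diff exp_minus divide_inverse flip: ennreal_mult' exp_of_nat_mult)
    then show "indicator {\<omega>\<in>space M. s * c \<le> s * real (npoints A \<omega>)} \<omega>
        \<le> ennreal (exp (- s * c)) * ennreal (exp s ^ npoints A \<omega>)"
      by (auto simp: indicator_def ennreal_ge_1)
  qed
  also have "\<dots> = ennreal (exp (t * measure \<nu> A * (exp s - 1) - s * c))"
    by (subst nn_integral_cmult)
       (simp_all add: npoints_generating_function flip: ennreal_mult' exp_add)
  finally show ?thesis by (simp add: emeasure_eq_measure)
qed

text \<open>With \<open>exp s - 1 \<le> s + s\<^sup>2\<close> the exponents are at most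
  \<open>\<mu> * (s\<^sup>2 - g * s)\<close> for the upper and
  \<open>\<mu> * (s\<^sup>2 + g * s)\<close> for the lower tail; they are minimal at
  \<open>s = g/2\<close> and \<open>s = - g/2\<close>.\<close>

lemma npoints_concentration:
  assumes [measurable]: "A \<in> sets borel" and g: "0 < g" "g \<le> 1"
  defines "\<mu> \<equiv> t * measure \<nu> A"
  shows "prob {\<omega>\<in>space M. \<not> ((1 - g) * \<mu> \<le> real (npoints A \<omega>) \<and> real (npoints A \<omega>) \<le> (1 + g) * \<mu>)}
    \<le> 2 * exp (- (\<mu> * g\<^sup>2 / 4))"
proof -
  have \<mu>: "\<mu> \<ge> 0" using t_pos by (simp add: \<mu>_def)
  have q: "\<mu> * (exp s - 1) \<le> \<mu> * (s + s\<^sup>2)" if "\<bar>s\<bar> \<le> 1" for s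
    using exp_le_quadratic[OF that] \<mu> by (intro mult_left_mono) auto
  let ?U = "{\<omega>\<in>space M. (g/2) * ((1 + g) * \<mu>) \<le> (g/2) * real (npoints A \<omega>)}"
  let ?L = "{\<omega>\<in>space M. (- g/2) * ((1 - g) * \<mu>) \<le> (- g/2) * real (npoints A \<omega>)}"
  have "prob ?U \<le> exp (\<mu> * (exp (g/2) - 1) - (g/2) * ((1 + g) * \<mu>))"
    unfolding \<mu>_def by (rule chernoff) simp
  also have "\<dots> \<le> exp (- (\<mu> * g\<^sup>2 / 4))"
    using q[of "g/2"] g by (simp add: power2_eq_square ring_distribs) (simp add: algebra_simps)?
  finally have U: "prob ?U \<le> exp (- (\<mu> * g\<^sup>2 / 4))" .
  have "prob ?L \<le> exp (\<mu> * (exp (- g/2) - 1) - (- g/2) * ((1 - g) * \<mu>))"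
    unfolding \<mu>_def by (rule chernoff) simp
  also have "\<dots> \<le> exp (- (\<mu> * g\<^sup>2 / 4))"
    using q[of "-g/2"] g by (simp add: power2_eq_square ring_distribs) (simp add: algebra_simps)?
  finally have L: "prob ?L \<le> exp (- (\<mu> * g\<^sup>2 / 4))" .
  have "prob {\<omega>\<in>space M. \<not> ((1 - g) * \<mu> \<le> real (npoints A \<omega>) \<and> real (npoints A \<omega>) \<le> (1 + g) * \<mu>)}
    \<le> prob (?U \<union> ?L)"
    using g by (intro finite_measure_mono) (auto simp: not_le)
  also have "\<dots> \<le> prob ?U + prob ?L"
    by (intro measure_Un_le) auto
  finally show ?thesis using U L by simp
qed

section \<open>Coincident points and measurability\<close>

text \<open>By independence and Fubini the diagonal is a null set of
  \<open>\<nu> \<Otimes>\<^sub>M \<nu>\<close>, and there are only countably many pairs of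
  indices.\<close>

lemma X_distinct_AE:
  assumes "\<And>x. emeasure \<nu> {x} = 0"
  shows "AE \<omega> in M. \<forall>i j. i \<noteq> j \<longrightarrow> X i \<omega> \<noteq> X j \<omega>"
proof -
  interpret \<nu>: prob_space \<nu> by (rule prob_space_\<nu>)
  have "AE \<omega> in M. X i \<omega> \<noteq> X j \<omega>" if "i \<noteq> j" for i j
  proof -
    let ?D = "{z :: 'a \<times> 'a. fst z = snd z}"
    have D: "?D \<in> sets (borel \<Otimes>\<^sub>M borel)"
      unfolding borel_prod by (intro borel_closed closed_Collect_eq continuous_intros)
    have "indep_var borel (X i) borel (X j)"
    proof -
      have "indep_var (PiM {i} (\<lambda>_. borel)) (\<lambda>\<omega>. restrict (\<lambda>i. X i \<omega>) {i}) (PiM {j} (\<lambda>_. borel)) (\<lambda>\<omega>. restrict (\<lambda>i. X i \<omega>) {j})"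
        using that by (intro indep_var_restrict[OF X_indep]) auto
      then have "indep_var borel ((\<lambda>f. f i) \<circ> (\<lambda>\<omega>. restrict (\<lambda>i. X i \<omega>) {i})) borel ((\<lambda>f. f j) \<circ> (\<lambda>\<omega>. restrict (\<lambda>i. X i \<omega>) {j}))"
        by (rule indep_var_compose) auto
      then show ?thesis by (simp add: comp_def)
    qed
    then have "distr M (borel \<Otimes>\<^sub>M borel) (\<lambda>\<omega>. (X i \<omega>, X j \<omega>)) = \<nu> \<Otimes>\<^sub>M \<nu>"
      by (subst (asm) indep_var_distribution_eq) (simp add: X_distr)
    then have "emeasure M ((\<lambda>\<omega>. (X i \<omega>, X j \<omega>)) -` ?D \<inter> space M) = emeasure (\<nu> \<Otimes>\<^sub>M \<nu>) ?D"
      using D by (subst (asm) eq_commute) (simp add: emeasure_distr)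
    also have "\<dots> = (\<integral>\<^sup>+x. emeasure \<nu> (Pair x -` ?D) \<partial>\<nu>)"
      using D by (intro \<nu>.emeasure_pair_measure_alt) (simp cong: sets_pair_measure_cong)
    also have "\<dots> = 0"
      using assms by (simp add: vimage_def)
    finally have "emeasure M {\<omega>\<in>space M. X i \<omega> = X j \<omega>} = 0"
      by (simp add: vimage_def Int_def conj_commute)
    then show ?thesis
      by (subst AE_iff_measurable[OF _ refl]) auto
  qed
  then show ?thesis by (simp add: AE_all_countable)
qed

lemma card_points_eq_npoints:
  assumes "\<And>i j. i \<noteq> j \<Longrightarrow> X i \<omega> \<noteq> X j \<omega>"
  shows "card (poisson_points N X \<omega> \<inter> A) = npoints A \<omega>"
proof -
  have "poisson_points N X \<omega> \<inter> A = (\<lambda>i. X i \<omega>) ` {i. i < N \<omega> \<and> X i \<omega> \<in> A}"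
    by (auto simp: poisson_points_def)
  then show ?thesis
    using assms by (auto simp: npoints_def intro!: card_image inj_onI)
qed

lemma npoints_eq_0_iff_disjoint: "npoints A \<omega> = 0 \<longleftrightarrow> poisson_points N X \<omega> \<inter> A = {}"
  by (auto simp: npoints_0_iff poisson_points_def)

text \<open>Each point is counted at the first index where it occurs, which gives the cardinality
  everywhere and not only almost surely. The concentration event is thus measurable, as the
  comparison with the corresponding event for \<open>npoints\<close> requires.\<close>

lemma card_points_measurable[measurable]:
  assumes [measurable]: "A \<in> sets borel"
  shows "(\<lambda>\<omega>. card (poisson_points N X \<omega> \<inter> A)) \<in> measurable M (count_space UNIV)"
proof -
  have "card (poisson_points N X \<omega> \<inter> A)
      = (\<Sum>i<N \<omega>. if X i \<omega> \<in> A \<and> (\<forall>j<i. X j \<omega> \<noteq> X i \<omega>) then 1 else 0)" for \<omega>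
  proof -
    let ?I = "{i. i < N \<omega> \<and> X i \<omega> \<in> A \<and> (\<forall>j<i. X j \<omega> \<noteq> X i \<omega>)}"
    have "poisson_points N X \<omega> \<inter> A = (\<lambda>i. X i \<omega>) ` ?I"
    proof safe
      fix x assume x: "x \<in> poisson_points N X \<omega>" "x \<in> A"
      define i where "i = (LEAST i. X i \<omega> = x)"
      obtain k where k: "k < N \<omega>" "X k \<omega> = x" using x by (auto simp: poisson_points_def)
      have "X i \<omega> = x" "i \<le> k"
        unfolding i_def using k by (auto intro: LeastI Least_le)
      moreover have "X j \<omega> \<noteq> x" if "j < i" for j
        using not_less_Least[of j "\<lambda>i. X i \<omega> = x"] that by (auto simp: i_def)
      ultimately show "x \<in> (\<lambda>i. X i \<omega>) ` ?I" using k x by (intro image_eqI[of _ _ i]) auto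
    qed (auto simp: poisson_points_def)
    moreover have "inj_on (\<lambda>i. X i \<omega>) ?I"
      by (rule linorder_inj_onI) auto
    ultimately show ?thesis
      by (simp add: card_image sum.If_cases Int_def)
  qed
  then show ?thesis
    by (simp only:) (rule measurable_compose_N, measurable)
qed

text \<open>Reachability is moved to the countable index set, where paths of length
  \<open>n + 1\<close> form a countable union over the last intermediate index. Distinct indices may
  carry the same point; \<open>R'\<close> links them explicitly, because for nonpositive
  \<open>r\<close> the distance condition does not.\<close>

lemma not_connected_measurable:
  "{\<omega>\<in>space M. \<not> Digraph_Component.connected (geometric_graph (poisson_points N X \<omega>) r)} \<in> events"
proof -
  define R where "R \<omega> = {(i, j). i < N \<omega> \<and> j < N \<omega> \<and> dist (X i \<omega>) (X j \<omega>) < r}" for \<omega>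
  define D where "D \<omega> = {(x, y). x \<in> poisson_points N X \<omega> \<and> y \<in> poisson_points N X \<omega> \<and> dist x y < r}" for \<omega>
  define R' where "R' \<omega> = R \<omega> \<union> {(i, j). i < N \<omega> \<and> j < N \<omega> \<and> X i \<omega> = X j \<omega>}" for \<omega>
  have step: "{\<omega>\<in>space M. (i, j) \<in> R' \<omega>} \<in> events" for i j
    unfolding R'_def R_def by simp
  have pow: "{\<omega>\<in>space M. (i, j) \<in> R' \<omega> ^^ n} \<in> events" for i j n
  proof (induction n arbitrary: j)
    case (Suc n)
    have "{\<omega>\<in>space M. (i, j) \<in> R' \<omega> ^^ Suc n}
        = (\<Union>k. {\<omega>\<in>space M. (i, k) \<in> R' \<omega> ^^ n} \<inter> {\<omega>\<in>space M. (k, j) \<in> R' \<omega>})"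
      by auto
    also have "\<dots> \<in> events" using Suc step by auto
    finally show ?case .
  qed auto
  have rtr: "(X i \<omega>, X j \<omega>) \<in> (D \<omega>)\<^sup>* \<longleftrightarrow> (i, j) \<in> (R' \<omega>)\<^sup>*" if "i < N \<omega>" "j < N \<omega>" for i j \<omega>
  proof
    assume "(X i \<omega>, X j \<omega>) \<in> (D \<omega>)\<^sup>*"
    \<comment> \<open>The induction runs over points, which do not determine their indices; hence
      the claim for every index of the endpoint.\<close>
    then have "\<forall>j<N \<omega>. X j \<omega> = y \<longrightarrow> (i, j) \<in> (R' \<omega>)\<^sup>*" if "y = X j \<omega>" for y
      unfolding that[symmetric]
    proof induction
      case base
      then show ?case using \<open>i < N \<omega>\<close> by (auto simp: R'_def)
    next
      case (step y z)
      then obtain k where k: "k < N \<omega>" "X k \<omega> = y" by (auto simp: D_def poisson_points_def)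
      then have "(i, k) \<in> (R' \<omega>)\<^sup>*" using step by auto
      moreover have "(k, l) \<in> R' \<omega>" if "l < N \<omega>" "X l \<omega> = z" for l
        using step that k by (auto simp: D_def R'_def R_def)
      ultimately show ?case by (auto intro: rtrancl_into_rtrancl)
    qed
    then show "(i, j) \<in> (R' \<omega>)\<^sup>*" using that by auto
  next
    assume "(i, j) \<in> (R' \<omega>)\<^sup>*"
    then show "(X i \<omega>, X j \<omega>) \<in> (D \<omega>)\<^sup>*"
    proof induction
      case (step j k)
      then have "(X j \<omega>, X k \<omega>) \<in> (D \<omega>)\<^sup>*"
        by (auto simp: R'_def R_def D_def poisson_points_def)
      with step show ?case by auto
    qed auto
  qed
  have "Digraph_Component.connected (geometric_graph (poisson_points N X \<omega>) r) \<longleftrightarrow>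
      N \<omega> \<noteq> 0 \<and> (\<forall>i j. i < N \<omega> \<longrightarrow> j < N \<omega> \<longrightarrow> (\<exists>n. (i, j) \<in> R' \<omega> ^^ n))" for \<omega>
    unfolding connected_geometric_graph_iff D_def[symmetric] rtrancl_power[symmetric]
    by (auto simp: poisson_points_def rtr)
  then have "{\<omega>\<in>space M. \<not> Digraph_Component.connected (geometric_graph (poisson_points N X \<omega>) r)} =
     space M - {\<omega>\<in>space M. N \<omega> \<noteq> 0 \<and> (\<forall>i j. i < N \<omega> \<longrightarrow> j < N \<omega> \<longrightarrow> (\<exists>n. (i, j) \<in> R' \<omega> ^^ n))}"
    by (simp only: set_eq_iff mem_Collect_eq Diff_iff) blast
  also have "\<dots> \<in> events"
  proof -
    have [measurable]: "Measurable.pred M (\<lambda>\<omega>. (i, j) \<in> R' \<omega> ^^ n)" for i j n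
      using pow by (simp add: pred_def)
    show ?thesis by measurable
  qed
  finally show ?thesis .
qed

section \<open>Isolated clusters and simultaneous concentration\<close>

lemma prob_isolated_event:
  assumes [measurable]: "B \<in> sets borel" "D \<in> sets borel" and "B \<subseteq> D"
  shows "prob {\<omega>\<in>space M. npoints B \<omega> = 0 \<and> npoints D \<omega> \<noteq> 0}
    = exp (- (t * measure \<nu> B)) - exp (- (t * measure \<nu> D))"
proof -
  have "prob ({\<omega>\<in>space M. npoints B \<omega> = 0} - {\<omega>\<in>space M. npoints D \<omega> = 0})
    = exp (- (t * measure \<nu> B)) - exp (- (t * measure \<nu> D))"
    using assms(3) by (subst finite_measure_Diff) (auto simp: prob_npoints_0, auto simp: npoints_0_iff)
  moreover have "{\<omega>\<in>space M. npoints B \<omega> = 0} - {\<omega>\<in>space M. npoints D \<omega> = 0}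
    = {\<omega>\<in>space M. npoints B \<omega> = 0 \<and> npoints D \<omega> \<noteq> 0}" by auto
  ultimately show ?thesis by simp
qed

text \<open>Void probabilities suffice: inclusion-exclusion expresses the intersection through the
  void events of the four unions of \<open>B\<close> or \<open>D\<close> with \<open>B'\<close> or
  \<open>D'\<close>. These unions are disjoint, so the exponents add and the alternating sum
  factors.\<close>

lemma isolated_events_indep:
  assumes [measurable]: "B \<in> sets borel" "D \<in> sets borel" "B' \<in> sets borel" "D' \<in> sets borel"
    and "B \<subseteq> D" "B' \<subseteq> D'" "D \<inter> D' = {}"
  shows "prob ({\<omega>\<in>space M. npoints B \<omega> = 0 \<and> npoints D \<omega> \<noteq> 0} \<inter> {\<omega>\<in>space M. npoints B' \<omega> = 0 \<and> npoints D' \<omega> \<noteq> 0})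
    = prob {\<omega>\<in>space M. npoints B \<omega> = 0 \<and> npoints D \<omega> \<noteq> 0} * prob {\<omega>\<in>space M. npoints B' \<omega> = 0 \<and> npoints D' \<omega> \<noteq> 0}"
proof -
  interpret \<nu>: prob_space \<nu> by (rule prob_space_\<nu>)
  let ?F = "\<lambda>A. {\<omega>\<in>space M. npoints A \<omega> = 0}"
  let ?i = "\<lambda>A. indicat_real (?F A)"
  have meet: "?F A \<inter> ?F A' = ?F (A \<union> A')" for A A'
    by (auto simp: npoints_0_iff)
  have F: "prob (?F (A \<union> A')) = exp (- (t * measure \<nu> A)) * exp (- (t * measure \<nu> A'))"
    if [measurable]: "A \<in> sets borel" "A' \<in> sets borel" and "A \<inter> A' = {}" for A A'
    using that by (simp add: prob_npoints_0 \<nu>.finite_measure_Union ring_distribs flip: exp_add)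
  have "prob ({\<omega>\<in>space M. npoints B \<omega> = 0 \<and> npoints D \<omega> \<noteq> 0} \<inter> {\<omega>\<in>space M. npoints B' \<omega> = 0 \<and> npoints D' \<omega> \<noteq> 0})
    = (\<integral>\<omega>. indicat_real ({\<omega>\<in>space M. npoints B \<omega> = 0 \<and> npoints D \<omega> \<noteq> 0} \<inter> {\<omega>\<in>space M. npoints B' \<omega> = 0 \<and> npoints D' \<omega> \<noteq> 0}) \<omega> \<partial>M)"
    by simp
  also have "\<dots> = (\<integral>\<omega>. ?i (B \<union> B') \<omega> - ?i (B \<union> D') \<omega> - ?i (D \<union> B') \<omega> + ?i (D \<union> D') \<omega> \<partial>M)"
  proof (intro Bochner_Integration.integral_cong refl)
    fix \<omega>
    have "npoints D \<omega> = 0 \<Longrightarrow> npoints B \<omega> = 0" "npoints D' \<omega> = 0 \<Longrightarrow> npoints B' \<omega> = 0"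
      using assms(5,6) by (auto simp: npoints_0_iff)
    then show "indicat_real ({\<omega>\<in>space M. npoints B \<omega> = 0 \<and> npoints D \<omega> \<noteq> 0} \<inter> {\<omega>\<in>space M. npoints B' \<omega> = 0 \<and> npoints D' \<omega> \<noteq> 0}) \<omega>
      = ?i (B \<union> B') \<omega> - ?i (B \<union> D') \<omega> - ?i (D \<union> B') \<omega> + ?i (D \<union> D') \<omega>"
      unfolding meet[symmetric] indicator_inter_arith
      by (cases "npoints D \<omega> = 0"; cases "npoints D' \<omega> = 0"; cases "npoints B \<omega> = 0"; cases "npoints B' \<omega> = 0")
         (simp_all add: indicator_def)
  qed
  also have "\<dots> = prob (?F (B \<union> B')) - prob (?F (B \<union> D')) - prob (?F (D \<union> B')) + prob (?F (D \<union> D'))"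
    by (simp add: integrable_real_indicator less_top[symmetric])
  also have "\<dots> = (exp (- (t * measure \<nu> B)) - exp (- (t * measure \<nu> D))) * (exp (- (t * measure \<nu> B')) - exp (- (t * measure \<nu> D')))"
    using assms(5-7) by (subst (1 2 3 4) F) (auto simp: algebra_simps)
  finally show ?thesis using assms(5,6) by (simp only: prob_isolated_event assms(1-4))
qed


text \<open>The second moment method applies to the events that the ball around \<open>y k\<close> contains points but
  the surrounding annulus does not; \<open>S\<close> only serves to provide a further point of the graph.\<close>

lemma prob_connected_le:
  fixes y :: "nat \<Rightarrow> 'a" and m s r :: real
  assumes J: "finite J"
    and disj: "\<And>k l. k \<in> J \<Longrightarrow> l \<in> J \<Longrightarrow> k \<noteq> l \<Longrightarrow> ball (y k) (s + r) \<inter> ball (y l) (s + r) = {}"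
    and S: "S \<in> sets borel" "\<And>k. k \<in> J \<Longrightarrow> S \<inter> ball (y k) (s + r) = {}"
    and upper: "\<And>k. k \<in> J \<Longrightarrow> t * measure \<nu> (ball (y k) (s + r)) \<le> 1"
    and lower: "\<And>k. k \<in> J \<Longrightarrow> m \<le> t * measure \<nu> (ball (y k) s)"
    and m: "0 < m" "m \<le> 1" and r: "r > 0" and "J \<noteq> {}"
  shows "prob {\<omega>\<in>space M. \<not> Digraph_Component.connected (geometric_graph (poisson_points N X \<omega>) r)}
    \<ge> 1 - exp (- (t * measure \<nu> S)) - 6 / (card J * m)"
proof -
  interpret \<nu>: prob_space \<nu> by (rule prob_space_\<nu>)
  let ?A = "\<lambda>k. ball (y k) s" and ?D = "\<lambda>k. ball (y k) (s + r)"
  define E where "E k = {\<omega>\<in>space M. npoints (?D k - ?A k) \<omega> = 0 \<and> npoints (?D k) \<omega> \<noteq> 0}" for k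
  have E[measurable]: "E k \<in> events" for k unfolding E_def by measurable
  \<comment> \<open>The shell is empty with probability at least
    \<open>exp (- 1) \<ge> 1 / 3\<close>, the ball is occupied with probability at least
    \<open>1 - exp (- m) \<ge> m / 2\<close>; this is the origin of the constant 6.\<close>
  have p: "m / 6 \<le> prob (E k)" if k: "k \<in> J" for k
  proof -
    have D: "t * measure \<nu> (?D k) = t * measure \<nu> (?D k - ?A k) + t * measure \<nu> (?A k)"
    proof -
      have *: "measure \<nu> (?D k - ?A k) = measure \<nu> (?D k) - measure \<nu> (?A k)"
        using r by (intro \<nu>.finite_measure_Diff subset_ball) auto
      show ?thesis unfolding * right_diff_distrib by linarith
    qed
    have "prob (E k) = exp (- (t * measure \<nu> (?D k - ?A k))) * (1 - exp (- (t * measure \<nu> (?A k))))"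
      unfolding E_def by (subst prob_isolated_event) (auto simp: D right_diff_distrib simp flip: exp_add)
    moreover have "exp (- (t * measure \<nu> (?D k - ?A k))) \<ge> exp (- 1)"
    proof -
      have "0 \<le> t * measure \<nu> (?A k)" using t_pos by simp
      then show ?thesis using upper[OF k] D by simp
    qed
    moreover have "1 - exp (- (t * measure \<nu> (?A k))) \<ge> 1 - exp (- m)"
      using lower[OF k] by simp
    moreover have "1 - exp (- m) \<ge> m / 2"
    proof -
      have "exp (- m) \<le> 1 / (1 + m)"
        using exp_ge_add_one_self[of m] m by (simp add: exp_minus field_simps)
      moreover have "m / 2 \<le> m / (1 + m)"
        using m by (intro divide_left_mono) auto
      moreover have "m / (1 + m) = 1 - 1 / (1 + m)"
        using m by (simp add: field_simps)
      ultimately show ?thesis by linarith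
    qed
    moreover have "exp (- 1) \<ge> (1 / 3 :: real)"
      using exp_le by (simp add: exp_minus field_simps)
    ultimately have "prob (E k) \<ge> (1 / 3) * (m / 2)"
      using m by (simp only:) (intro mult_mono; linarith)
    then show ?thesis by simp
  qed
  have sum: "card J * m / 6 \<le> (\<Sum>k\<in>J. prob (E k))"
    using sum_mono[OF p, of J] by simp
  have pos: "0 < card J * m / 6" using m J \<open>J \<noteq> {}\<close> by (simp add: card_gt_0_iff)
  let ?none = "{\<omega>\<in>space M. \<forall>k\<in>J. \<omega> \<notin> E k}" and ?S = "{\<omega>\<in>space M. npoints S \<omega> = 0}"
  have "prob ?none \<le> 1 / (\<Sum>k\<in>J. prob (E k))"
  proof (rule prob_none_le_inverse_expectation[OF J])
    show "prob (E k \<inter> E l) = prob (E k) * prob (E l)" if "k \<in> J" "l \<in> J" "k \<noteq> l" for k l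
      unfolding E_def using disj[OF that] by (intro isolated_events_indep) auto
    show "(\<Sum>k\<in>J. prob (E k)) > 0" using sum pos by linarith
  qed measurable
  also have "\<dots> \<le> 1 / (card J * m / 6)"
    using sum pos by (intro divide_left_mono mult_pos_pos) auto
  finally have none: "prob ?none \<le> 6 / (card J * m)" by simp
  have sets: "?S \<in> events" "?none \<in> events"
    using S J by measurable
  have "1 - exp (- (t * measure \<nu> S)) - 6 / (card J * m) \<le> 1 - (prob ?S + prob ?none)"
    using none by (simp add: prob_npoints_0[OF S(1)])
  also have "\<dots> \<le> 1 - prob (?S \<union> ?none)"
    using measure_Un_le[OF sets] by simp
  also have "\<dots> = prob (space M - (?S \<union> ?none))"
    using sets by (subst prob_compl) auto
  also have "\<dots> \<le> prob {\<omega>\<in>space M. \<not> Digraph_Component.connected (geometric_graph (poisson_points N X \<omega>) r)}"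
  proof (intro finite_measure_mono not_connected_measurable subsetI)
    fix \<omega> assume "\<omega> \<in> space M - (?S \<union> ?none)"
    then obtain k where \<omega>: "\<omega> \<in> space M" "npoints S \<omega> \<noteq> 0"
      and k: "k \<in> J" "npoints (?D k - ?A k) \<omega> = 0" "npoints (?D k) \<omega> \<noteq> 0"
      by (auto simp: E_def)
    from k(2,3) obtain u where "u \<in> poisson_points N X \<omega> \<inter> ?A k"
      unfolding npoints_eq_0_iff_disjoint by blast
    moreover from \<omega> obtain w where "w \<in> poisson_points N X \<omega> - ?A k"
    proof -
      have "?A k \<subseteq> ?D k" using r by (intro subset_ball) auto
      with \<omega>(2) S(2)[OF k(1)] show ?thesis
        using that unfolding npoints_eq_0_iff_disjoint by blast
    qed
    ultimately have "\<not> Digraph_Component.connected (geometric_graph (poisson_points N X \<omega>) r)"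
      using k by (intro not_connected_if_isolated_ball) (auto simp: npoints_eq_0_iff_disjoint)
    with \<omega> show "\<omega> \<in> {\<omega>\<in>space M. \<not> Digraph_Component.connected (geometric_graph (poisson_points N X \<omega>) r)}"
      by simp
  qed
  finally show ?thesis .
qed

text \<open>A union bound for the counts with multiplicity, transferred to cardinalities because the
  points are almost surely distinct. Weakening \<open>exp (- W)\<close> to \<open>1 / W\<close> is
  affordable: \<open>W\<close> will be a power of \<open>x\<close> that outgrows the number of
  cells.\<close>

lemma simultaneous_concentration:
  assumes atomless: "\<And>x. emeasure \<nu> {x} = 0"
    and J: "finite J" and Q[measurable]: "\<And>i. Q i \<in> sets borel"
    and g: "0 < g" "g \<le> 1" and W: "W > 0" "\<And>i. i \<in> J \<Longrightarrow> W \<le> t * measure \<nu> (Q i) * g\<^sup>2 / 4"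
  shows "1 - card J * (2 / W) \<le> prob {\<omega>\<in>space M. \<forall>i\<in>J.
    (1 - g) * t * measure \<nu> (Q i) \<le> real (card (poisson_points N X \<omega> \<inter> Q i)) \<and>
    real (card (poisson_points N X \<omega> \<inter> Q i)) \<le> (1 + g) * t * measure \<nu> (Q i)}"
proof -
  let ?good = "{\<omega>\<in>space M. \<forall>i\<in>J.
    (1 - g) * t * measure \<nu> (Q i) \<le> real (card (poisson_points N X \<omega> \<inter> Q i)) \<and>
    real (card (poisson_points N X \<omega> \<inter> Q i)) \<le> (1 + g) * t * measure \<nu> (Q i)}"
  let ?good' = "{\<omega>\<in>space M. \<forall>i\<in>J.
    (1 - g) * (t * measure \<nu> (Q i)) \<le> real (npoints (Q i) \<omega>) \<and>
    real (npoints (Q i) \<omega>) \<le> (1 + g) * (t * measure \<nu> (Q i))}"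
  let ?bad = "\<lambda>i. {\<omega>\<in>space M. \<not> ((1 - g) * (t * measure \<nu> (Q i)) \<le> real (npoints (Q i) \<omega>) \<and>
    real (npoints (Q i) \<omega>) \<le> (1 + g) * (t * measure \<nu> (Q i)))}"
  have bad: "prob (?bad i) \<le> 2 / W" if "i \<in> J" for i
  proof -
    have "prob (?bad i) \<le> 2 * exp (- (t * measure \<nu> (Q i) * g\<^sup>2 / 4))"
      using Q g by (rule npoints_concentration)
    also have "\<dots> \<le> 2 * exp (- W)" using W(2)[OF that] by simp
    also have "exp (- W) \<le> 1 / W"
    proof -
      have "W \<le> exp W" using exp_ge_add_one_self[of W] by linarith
      then show ?thesis using W(1) by (simp add: exp_minus inverse_eq_divide divide_left_mono)
    qed
    finally show ?thesis by simp
  qed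
  have bad_sets: "?bad i \<in> events" for i by measurable
  have "prob (\<Union>i\<in>J. ?bad i) \<le> (\<Sum>i\<in>J. prob (?bad i))"
    using J bad_sets by (intro finite_measure_subadditive_finite) auto
  also have "\<dots> \<le> card J * (2 / W)"
    using sum_bounded_above[OF bad] by simp
  finally have "1 - card J * (2 / W) \<le> 1 - prob (\<Union>i\<in>J. ?bad i)" by simp
  also have "\<dots> = prob (space M - (\<Union>i\<in>J. ?bad i))"
    using J bad_sets by (subst prob_compl) auto
  also have "space M - (\<Union>i\<in>J. ?bad i) = ?good'" by auto
  also have "prob ?good' = prob ?good"
  proof (rule finite_measure_eq_AE)
    show "?good' \<in> events" "?good \<in> events" using J by measurable
    show "AE \<omega> in M. \<omega> \<in> ?good' \<longleftrightarrow> \<omega> \<in> ?good"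
      using X_distinct_AE[OF atomless]
      by eventually_elim (simp add: card_points_eq_npoints mult.assoc)
  qed
  finally show ?thesis .
qed

end

section \<open>Cells, spheres and integrals\<close>

lemma grid_cube_measurable[measurable]: "grid_cube s i \<in> sets borel"
  unfolding grid_cube_def by measurable

lemma cell_measurable[measurable]: "cell s R i \<in> sets borel"
  unfolding cell_def by (intro sets.countable_UN' sets.Int grid_cube_measurable) auto

lemma cell_subset_ball: "cell s R i \<subseteq> ball 0 R"
  by (auto simp: cell_def)

text \<open>Distinct centres have positive distance, so an index is strictly nearest to itself.
  Every cell thus inherits the volume bound of a full cube.\<close>

lemma grid_cube_subset_cell:
  assumes "s > 0" "i \<in> inner_cubes s R"
  shows "grid_cube s i \<subseteq> cell s R i"
proof -
  have "dist (cube_centre s i) (cube_centre s i') > 0" if "i' \<noteq> i" for i'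
  proof -
    obtain k where "i' $ k \<noteq> i $ k" using \<open>i' \<noteq> i\<close> by (auto simp: vec_eq_iff)
    then have "cube_centre s i $ k \<noteq> cube_centre s i' $ k" using assms(1) by (simp add: cube_centre_def)
    then show ?thesis by auto
  qed
  then have "i \<in> cell_indices s R i" by (auto simp: cell_indices_def dist_commute)
  then show ?thesis using assms(2) by (auto simp: cell_def inner_cubes_def)
qed

lemma measure_grid_cube_ge:
  fixes i :: "int ^ 'd"
  assumes "s > 0"
  shows "ennreal (s ^ CARD('d)) \<le> emeasure lborel (grid_cube s i)"
proof -
  let ?c = "cube_centre s i" and ?h = "(\<chi> k. s / 2) :: real ^ 'd"
  have "emeasure lborel (box (?c - ?h) (?c + ?h)) = ennreal (\<Prod>b\<in>(Basis :: (real ^ 'd) set). s)"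
  proof -
    have h: "?h \<bullet> b = s / 2" if "b \<in> Basis" for b
      using that by (auto simp: Basis_vec_def inner_axis)
    have "(\<Prod>b\<in>Basis. ((?c + ?h) - (?c - ?h)) \<bullet> b) = (\<Prod>b\<in>(Basis :: (real ^ 'd) set). s)"
      unfolding inner_diff_left inner_add_left by (intro prod.cong refl) (simp add: h)
    moreover have "(?c - ?h) \<bullet> b \<le> (?c + ?h) \<bullet> b" if "b \<in> Basis" for b
      unfolding inner_diff_left inner_add_left using assms that by (simp add: h)
    ultimately show ?thesis
      by (simp only: emeasure_lborel_box)
  qed
  moreover have "box (?c - ?h) (?c + ?h) \<subseteq> grid_cube s i"
    by (auto simp: grid_cube_def mem_box_cart less_imp_le)
  ultimately show ?thesis
    using emeasure_mono[of "box (?c - ?h) (?c + ?h)" "grid_cube s i" lborel] by simp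
qed

text \<open>The centre of an inner cube lies in the ball, so each coordinate of its index has
  modulus at most \<open>R / s\<close>, and the integer vectors in this box are counted.\<close>

lemma inner_cubes_card:
  fixes s R :: real
  assumes "s > 0" "R > 0"
  shows "finite (inner_cubes s R :: (int ^ 'd) set)"
    "real (card (inner_cubes s R :: (int ^ 'd) set)) \<le> (2 * R / s + 1) ^ CARD('d)"
proof -
  define m where "m = \<lfloor>R / s\<rfloor>"
  have m: "0 \<le> m" "m \<le> R / s" using assms by (auto simp: m_def)
  let ?V = "vec_lambda ` (PiE UNIV (\<lambda>_. {- m..m})) :: (int ^ 'd) set"
  have "inner_cubes s R \<subseteq> ?V"
  proof
    fix i :: "int ^ 'd" assume "i \<in> inner_cubes s R"
    moreover have "cube_centre s i \<in> grid_cube s i" using assms by (simp add: grid_cube_def)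
    ultimately have n: "norm (cube_centre s i) < R" by (auto simp: inner_cubes_def)
    have "i $ k \<in> {- m..m}" for k
    proof -
      have "\<bar>s * real_of_int (i $ k)\<bar> < R"
        using component_le_norm_cart[of "cube_centre s i" k] n by (simp add: cube_centre_def)
      then have "real_of_int \<bar>i $ k\<bar> \<le> R / s" using assms by (simp add: abs_mult field_simps)
      then have "\<bar>i $ k\<bar> \<le> m" by (simp add: m_def le_floor_iff)
      then show ?thesis by auto
    qed
    then show "i \<in> ?V" by (intro image_eqI[of _ _ "vec_nth i"]) auto
  qed
  moreover have fin: "finite (PiE (UNIV :: 'd set) (\<lambda>_. {- m..m}))" by (intro finite_PiE) auto
  ultimately show "finite (inner_cubes s R :: (int ^ 'd) set)"
    by (meson finite_imageI finite_subset)
  have "card (inner_cubes s R :: (int ^ 'd) set) \<le> card ?V"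
    using \<open>inner_cubes s R \<subseteq> ?V\<close> fin by (intro card_mono) auto
  also have "\<dots> \<le> card (PiE (UNIV :: 'd set) (\<lambda>_. {- m..m}))"
    by (rule card_image_le[OF fin])
  also have "\<dots> = nat (2 * m + 1) ^ CARD('d)"
    by (subst card_PiE) (auto simp: algebra_simps)
  finally have "real (card (inner_cubes s R :: (int ^ 'd) set)) \<le> real (nat (2 * m + 1) ^ CARD('d))"
    by (rule of_nat_mono)
  also have "\<dots> = (2 * real_of_int m + 1) ^ CARD('d)" using m by simp
  also have "\<dots> \<le> (2 * R / s + 1) ^ CARD('d)"
    using m by (intro power_mono) auto
  finally show "real (card (inner_cubes s R :: (int ^ 'd) set)) \<le> (2 * R / s + 1) ^ CARD('d)" .
qed

text \<open>The points lie in the plane of two basis vectors, which takes dimension 2, and their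
  coordinate along \<open>a\<close> is \<open>8 * k\<close>. Separation uses this coordinate alone
  and so persists for large \<open>k\<close>, where the square root has a negative argument. The
  distance 8 is ample for disjoint balls of radius below 2.\<close>

lemma separated_points_on_sphere:
  fixes R :: real
  assumes "DIM('a::euclidean_space) \<ge> 2" "R > 0"
  obtains y :: "nat \<Rightarrow> 'a::euclidean_space"
  where "\<And>k. real k \<le> R / 8 \<Longrightarrow> norm (y k) = R" "\<And>k l. k \<noteq> l \<Longrightarrow> 8 \<le> dist (y k) (y l)"
proof -
  obtain a c :: 'a where ac: "a \<in> Basis" "c \<in> Basis" "a \<noteq> c"
    using assms(1) card_le_Suc0_iff_eq[of "Basis :: 'a set"] by (auto simp: not_less_eq_eq[symmetric] numeral_2_eq_2)
  define y where "y k = (8 * real k) *\<^sub>R a + sqrt (R\<^sup>2 - (8 * real k)\<^sup>2) *\<^sub>R c" for k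
  have "norm (y k) = R" if "real k \<le> R / 8" for k
  proof -
    have "(8 * real k)\<^sup>2 \<le> R\<^sup>2" using that by (intro power_mono) auto
    then have "(norm (y k))\<^sup>2 = R\<^sup>2"
      using ac by (simp add: power2_norm_eq_inner y_def inner_add_left inner_add_right inner_Basis power2_eq_square[symmetric])
    then show ?thesis using assms(2) by (simp add: power2_eq_iff_nonneg)
  qed
  moreover have "8 \<le> dist (y k) (y l)" if "k \<noteq> l" for k l
  proof -
    have "8 * 1 \<le> 8 * \<bar>real k - real l\<bar>"
      using that by (intro mult_left_mono) (auto simp: abs_if)
    also have "\<dots> = \<bar>(y k - y l) \<bullet> a\<bar>"
      using ac by (simp add: y_def inner_diff_left inner_add_left inner_Basis abs_if)
    also have "\<dots> \<le> dist (y k) (y l)"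
      using ac by (simp add: dist_norm Basis_le_norm)
    finally show ?thesis by simp
  qed
  ultimately show ?thesis by (rule that)
qed

section \<open>An integrable majorant and bounds for masses\<close>

lemma nn_integral_inverse_1_plus_square:
  "(\<integral>\<^sup>+x. ennreal (1 / (1 + x\<^sup>2)) \<partial>lborel) = ennreal pi"
proof -
  have "integrable lborel (\<lambda>x::real. inverse (1 + x\<^sup>2))"
    "(LBINT x. inverse (1 + x\<^sup>2)) = pi"
    using integrable_inverse_1_plus_square LBINT_inverse_1_plus_square
    by (simp_all add: set_integrable_def interval_lebesgue_integral_def set_lebesgue_integral_def einterval_eq)
  then show ?thesis
    by (subst nn_integral_eq_integral) (auto simp: divide_inverse)
qed

text \<open>Away from the unit ball this product dominates a constant multiple of the norm to the
  power \<open>- 2 * DIM('a)\<close>, and it integrates coordinatewise, without polar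
  coordinates.\<close>

lemma nn_integral_prod_inverse_1_plus_square:
  "(\<integral>\<^sup>+x. ennreal (\<Prod>b\<in>Basis. 1 / (1 + (x \<bullet> b)\<^sup>2)) \<partial>(lborel :: 'a::euclidean_space measure)) = ennreal (pi ^ DIM('a))"
proof -
  have "(\<integral>\<^sup>+x. ennreal (\<Prod>b\<in>Basis. 1 / (1 + (x \<bullet> b)\<^sup>2)) \<partial>(lborel :: 'a measure))
      = (\<integral>\<^sup>+x. (\<Prod>b\<in>Basis. (\<lambda>b y. ennreal (1 / (1 + y\<^sup>2))) b (x \<bullet> b)) \<partial>(lborel :: 'a measure))"
    by (intro nn_integral_cong) (simp add: prod_ennreal)
  also have "\<dots> = (\<Prod>b\<in>(Basis :: 'a set). \<integral>\<^sup>+y. ennreal (1 / (1 + y\<^sup>2)) \<partial>lborel)"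
    by (subst nn_integral_lborel_prod) auto
  finally show ?thesis by (simp add: nn_integral_inverse_1_plus_square ennreal_power)
qed

lemma prod_1_plus_square_le:
  fixes x :: "'a::euclidean_space"
  assumes "1 \<le> norm x"
  shows "(\<Prod>b\<in>Basis. 1 + (x \<bullet> b)\<^sup>2) \<le> (2 * (norm x)\<^sup>2) ^ DIM('a)"
proof -
  have "1 + (x \<bullet> b)\<^sup>2 \<le> 2 * (norm x)\<^sup>2" if "b \<in> Basis" for b
  proof -
    have "\<bar>x \<bullet> b\<bar>\<^sup>2 \<le> (norm x)\<^sup>2" using that by (intro power_mono Basis_le_norm) auto
    moreover have "1\<^sup>2 \<le> (norm x)\<^sup>2" using assms by (intro power_mono) auto
    ultimately show ?thesis by simp
  qed
  then have "(\<Prod>b\<in>Basis. 1 + (x \<bullet> b)\<^sup>2) \<le> (\<Prod>b\<in>(Basis :: 'a set). 2 * (norm x)\<^sup>2)"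
    by (intro prod_mono) auto
  then show ?thesis by simp
qed

lemma measure_density_ge:
  fixes q :: "'a::euclidean_space \<Rightarrow> real"
  assumes [measurable]: "q \<in> borel_measurable borel" "A \<in> sets borel"
    and "finite_measure (density lborel (\<lambda>x. ennreal (q x)))"
    and "\<And>x. x \<in> A \<Longrightarrow> c \<le> q x" "c \<ge> 0" "w \<ge> 0" "ennreal w \<le> emeasure lborel A"
  shows "c * w \<le> measure (density lborel (\<lambda>x. ennreal (q x))) A"
proof -
  interpret finite_measure "density lborel (\<lambda>x. ennreal (q x))" by fact
  have "ennreal (c * w) \<le> ennreal c * emeasure lborel A"
    using assms by (simp add: ennreal_mult mult_left_mono)
  also have "\<dots> = (\<integral>\<^sup>+x. ennreal c * indicator A x \<partial>lborel)"
    by (simp add: nn_integral_cmult_indicator)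
  also have "\<dots> \<le> (\<integral>\<^sup>+x. ennreal (q x) * indicator A x \<partial>lborel)"
    using assms by (intro nn_integral_mono) (auto simp: indicator_def intro: ennreal_leI)
  also have "\<dots> = emeasure (density lborel (\<lambda>x. ennreal (q x))) A"
    by (subst emeasure_density) auto
  finally show ?thesis by (simp add: emeasure_eq_measure)
qed

text \<open>Used with \<open>f\<close> constant 1 on balls and with the product of Cauchy kernels on
  the exterior of a ball.\<close>

lemma measure_density_le:
  fixes q :: "'a::euclidean_space \<Rightarrow> real"
  assumes [measurable]: "q \<in> borel_measurable borel" "A \<in> sets borel" "f \<in> borel_measurable borel"
    and le: "\<And>x. x \<in> A \<Longrightarrow> q x \<le> c * f x" and "c \<ge> 0" "w \<ge> 0"
    and f: "(\<integral>\<^sup>+x. ennreal (f x) * indicator A x \<partial>lborel) \<le> ennreal w"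
  shows "measure (density lborel (\<lambda>x. ennreal (q x))) A \<le> c * w"
proof -
  have "emeasure (density lborel (\<lambda>x. ennreal (q x))) A = (\<integral>\<^sup>+x. ennreal (q x) * indicator A x \<partial>lborel)"
    by (subst emeasure_density) auto
  also have "\<dots> \<le> (\<integral>\<^sup>+x. ennreal c * (ennreal (f x) * indicator A x) \<partial>lborel)"
  proof (intro nn_integral_mono)
    fix x
    show "ennreal (q x) * indicator A x \<le> ennreal c * (ennreal (f x) * indicator A x)"
      using le[of x] assms(5) by (auto simp: indicator_def ennreal_mult'[symmetric] intro: ennreal_leI)
  qed
  also have "\<dots> = ennreal c * (\<integral>\<^sup>+x. ennreal (f x) * indicator A x \<partial>lborel)"
    by (rule nn_integral_cmult) measurable
  also have "\<dots> \<le> ennreal c * ennreal w"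
    by (intro mult_left_mono f) auto
  also have "\<dots> = ennreal (c * w)"
    using assms by (simp add: ennreal_mult)
  finally have "emeasure (density lborel (\<lambda>x. ennreal (q x))) A \<le> ennreal (c * w)" .
  then show ?thesis
    using assms(5,6) by (auto simp: measure_def intro!: enn2real_leI)
qed

lemma whpI:
  assumes "\<forall>\<^sub>F n in sequentially. prob_space (M n)"
    and "\<forall>\<^sub>F n in sequentially. 1 - e n \<le> measure (M n) {\<omega> \<in> space (M n). A n \<omega>}"
    and "e \<longlonglongrightarrow> 0"
  shows "whp M A"
  unfolding whp_def
proof (rule tendsto_sandwich)
  show "(\<lambda>n. 1 - e n) \<longlonglongrightarrow> 1" using tendsto_diff[OF tendsto_const assms(3), of 1] by simp
  show "\<forall>\<^sub>F n in sequentially. measure (M n) {\<omega> \<in> space (M n). A n \<omega>} \<le> 1"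
    using assms(1) by eventually_elim (rule prob_space.prob_le_1)
qed (use assms in auto)

section \<open>Critical radii\<close>

locale superexponential_density = superexponential +
  fixes q :: "real ^ 'd \<Rightarrow> real" and L :: "real \<Rightarrow> real" and \<alpha> :: real
  assumes q_eq: "\<And>x. q x = L (norm x) * exp (- \<psi> (norm x))"
    and q_meas[measurable]: "q \<in> borel_measurable borel"
    and q_pos: "\<And>x. q x > 0"
    and L_rv: "regularly_varying L \<alpha>"
    and prob: "prob_space (density lborel (\<lambda>x. ennreal (q x)))"
begin

abbreviation \<nu> :: "(real ^ 'd) measure" where "\<nu> \<equiv> density lborel (\<lambda>x. ennreal (q x))"

sublocale \<nu>: prob_space \<nu> by (rule prob)

text \<open>\<open>L\<close> is recovered from the measurable \<open>q\<close> along the ray through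
  a unit vector.\<close>

lemma L_exp_measurable[measurable]: "(\<lambda>x. L (exp x)) \<in> borel_measurable borel"
proof -
  obtain e :: "real ^ 'd" where "e \<in> Basis" using nonempty_Basis by blast
  then have "L (exp x) = q (exp x *\<^sub>R e) * exp (\<psi> (exp x))" for x
    by (simp add: q_eq exp_minus)
  then show ?thesis by simp
qed

lemma L_pos: "x > 0 \<Longrightarrow> L x > 0"
  using L_rv by (auto simp: regularly_varying_def)

lemma L_between_powr:
  obtains \<kappa> where "\<kappa> \<ge> 1" "\<forall>\<^sub>F t in at_top. t powr (- \<kappa>) \<le> L t \<and> L t \<le> t powr \<kappa>"
proof
  show "\<bar>\<alpha>\<bar> + 1 \<ge> 1" by simp
  show "\<forall>\<^sub>F t in at_top. t powr (- (\<bar>\<alpha>\<bar> + 1)) \<le> L t \<and> L t \<le> t powr (\<bar>\<alpha>\<bar> + 1)"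
    by (intro eventually_conj regularly_varying_ge_powr[OF L_rv] regularly_varying_le_powr[OF L_rv]) auto
qed

lemma \<psi>_variation:
  assumes C: "\<And>s. s \<in> {\<rho>/4..4*\<rho>} \<Longrightarrow> deriv \<psi> s \<le> D" and \<rho>: "z1 \<le> \<rho> / 4" and D: "D \<ge> 0"
    and s: "s \<in> {\<rho>/4..4*\<rho>}" "t \<in> {\<rho>/4..4*\<rho>}" "\<bar>s - t\<bar> \<le> \<delta>"
  shows "\<bar>\<psi> s - \<psi> t\<bar> \<le> \<delta> * D"
proof -
  have *: "\<bar>\<psi> y - \<psi> x\<bar> \<le> \<delta> * D" if "x \<le> y" "x \<in> {\<rho>/4..4*\<rho>}" "y \<in> {\<rho>/4..4*\<rho>}" "y - x \<le> \<delta>" for x y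
  proof -
    have "\<psi> y - \<psi> x \<le> (y - x) * deriv \<psi> y"
      using that \<rho> by (intro \<psi>_diff_le) auto
    also have "\<dots> \<le> \<delta> * D"
      using that C[of y] deriv_pos[of y] \<rho> D by (intro mult_mono) auto
    finally show ?thesis using \<psi>_mono[of x y] that \<rho> by auto
  qed
  show ?thesis
    using *[of s t] *[of t s] s by (cases "s \<le> t") (auto simp: abs_minus_commute)
qed

text \<open>The radius \<open>R x\<close> is chosen so that, with \<open>x = ln n\<close>, balls of radius of order \<open>ln x / b x\<close> centred
  at distance \<open>R x\<close> from the origin contain about one point; the density varies on such a ball by
  at most a small power of \<open>x\<close>, whereas \<open>R x\<close> is at least a fixed power of \<open>x\<close>.\<close>

lemma critical_radius:
  obtains \<epsilon> :: real and R m :: "real \<Rightarrow> real"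
  where "\<epsilon> > 0" "filterlim R at_top at_top" "filterlim (\<lambda>x. R x * m x) at_top at_top"
    "\<forall>\<^sub>F x in at_top. 0 < m x \<and> m x \<le> 1 \<and>
       (\<forall>y. norm y = R x \<longrightarrow> exp x * measure \<nu> (ball y (2 * (\<epsilon> * ln x / b x))) \<le> 1 \<and>
                          m x \<le> exp x * measure \<nu> (ball y (\<epsilon> * ln x / b x)))"
proof -
  obtain C where C: "C \<ge> 1"
    "\<forall>\<^sub>F R in at_top. \<forall>s\<in>{R/4..4*R}. deriv \<psi> R / C \<le> deriv \<psi> s \<and> deriv \<psi> s \<le> C * deriv \<psi> R"
    using deriv_comparable by auto
  obtain D where D: "D \<ge> 1" "\<forall>\<^sub>F R in at_top. \<forall>s\<in>{R/4..4*R}. L R / D \<le> L s \<and> L s \<le> D * L R"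
    using regularly_varying_bounded_ratio[OF L_rv] by auto
  obtain \<kappa> where \<kappa>: "\<kappa> \<ge> 1" "\<forall>\<^sub>F t in at_top. t powr (- \<kappa>) \<le> L t \<and> L t \<le> t powr \<kappa>"
    using L_between_powr .
  \<comment> \<open>On a ball of radius \<open>2 * s x\<close> the factor
    \<open>exp (- \<psi>)\<close> varies by \<open>E = x powr (2 * C * \<epsilon>)\<close> either
    way. This choice makes \<open>E * E = x powr (1 / (2 * (v + 1)))\<close>, with half the exponent
    of the lower bound for \<open>\<psi>inv x\<close>, so \<open>R x * m x\<close> still
    grows.\<close>
  define \<epsilon> where "\<epsilon> = 1 / (8 * C * (v + 1))"
  define d where "d = CARD('d)"
  define c where "c = unit_ball_vol (real d)"
  define s where "s x = \<epsilon> * ln x / b x" for x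
  \<comment> \<open>The value of \<psi> at the critical radius for which the upper bound on the
    expected count in a ball of radius \<open>2 * s x\<close> equals 1. \<open>L\<close> is taken at
    \<open>\<psi>inv x\<close>, at the price of \<open>D\<close>, because the radius is itself
    defined through \<open>z\<close>.\<close>
  define z where "z x = x + d * ln (s x) + ln (L (\<psi>inv x)) + ln (c * 2 ^ d * D) + 2 * C * \<epsilon> * ln x" for x
  define K where "K = d + \<kappa> + 1 + 2 * C * \<epsilon>"
  \<comment> \<open>The lower bound for radius \<open>s x\<close> divided by the upper bound for
    radius \<open>2 * s x\<close>: the volumes contribute \<open>2 ^ d\<close>, the variation of
    \<open>L\<close> contributes \<open>D\<close> twice and that of \<psi> contributes
    \<open>E\<close> twice.\<close>
  define m where "m x = x powr (- 1 / (2 * (v + 1))) / (2 ^ d * D\<^sup>2)" for x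
  have \<epsilon>: "\<epsilon> > 0" using C v_gt_1 by (simp add: \<epsilon>_def)
  have c: "c > 0" by (simp add: c_def)
  have ball_vol: "emeasure lborel (ball (y :: real ^ 'd) u) = ennreal (c * u ^ d)" if "u \<ge> 0" for y u
    using that by (simp add: emeasure_ball c_def d_def)
  have "((\<lambda>x. \<epsilon> * (ln x / b x)) \<longlongrightarrow> \<epsilon> * 0) at_top"
    by (intro tendsto_mult tendsto_const ln_over_b)
  then have s_small: "\<forall>\<^sub>F x in at_top. s x < 1"
    by (intro order_tendstoD) (auto simp: s_def)
  have logs: "\<forall>\<^sub>F x in at_top. \<epsilon> * ln x \<ge> 1 \<and> ln x \<ge> \<bar>ln (c * 2 ^ d * D)\<bar> \<and> x \<ge> 1"
  proof (intro eventually_conj)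
    have ln_ge: "\<forall>\<^sub>F x::real in at_top. A \<le> ln x" for A
      using ln_at_top by (auto simp: filterlim_at_top)
    show "\<forall>\<^sub>F x in at_top. \<epsilon> * ln x \<ge> 1"
      using ln_ge[of "1 / \<epsilon>"] by eventually_elim (use \<epsilon> in \<open>simp add: field_simps\<close>)
  qed (use ln_at_top eventually_ge_at_top in \<open>auto simp: filterlim_at_top\<close>)
  have bpos: "\<forall>\<^sub>F x in at_top. b x \<ge> 1" using b_at_top by (auto simp: filterlim_at_top)
  \<comment> \<open>All corrections in \<open>z x\<close> are of order \<open>ln x\<close>:
    \<open>s x\<close> lies between \<open>1 / x\<close> and 1, and \<open>L (\<psi>inv x)\<close>
    between powers of \<open>\<psi>inv x\<close>, which is at most \<open>x\<close>.\<close>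
  have window: "\<forall>\<^sub>F x in at_top. \<bar>z x - x\<bar> \<le> K * ln x"
    using s_small logs b_le bpos eventually_compose_filterlim[OF \<kappa>(2) \<psi>inv_at_top] \<psi>inv_le
      filterlim_at_top[THEN iffD1, OF \<psi>inv_at_top, rule_format, of 1]
  proof eventually_elim
    case (elim x)
    have "1 / x \<le> s x"
      unfolding s_def using elim \<epsilon> by (intro frac_le) auto
    moreover from this have "0 < s x" using elim by (auto intro: less_le_trans[of 0 "1 / x"])
    ultimately have "ln (1 / x) \<le> ln (s x)" "ln (s x) \<le> 0" using elim by (auto simp: ln_le_cancel_iff simp del: ln_div)
    then have s: "\<bar>ln (s x)\<bar> \<le> ln x" using elim by (auto simp: ln_div)
    have "ln (L (\<psi>inv x)) \<le> ln (\<psi>inv x powr \<kappa>)" "ln (\<psi>inv x powr (- \<kappa>)) \<le> ln (L (\<psi>inv x))"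
      using elim L_pos[of "\<psi>inv x"] by (subst ln_le_cancel_iff; simp)+
    then have "\<bar>ln (L (\<psi>inv x))\<bar> \<le> \<kappa> * ln (\<psi>inv x)" using elim by (simp add: ln_powr)
    also have "\<dots> \<le> \<kappa> * ln x" using elim \<kappa> by (intro mult_left_mono) auto
    finally have L: "\<bar>ln (L (\<psi>inv x))\<bar> \<le> \<kappa> * ln x" .
    have "\<bar>d * ln (s x)\<bar> \<le> d * ln x" using s by (simp add: abs_mult mult_left_mono)
    moreover have "0 \<le> 2 * C * \<epsilon> * ln x" using C \<epsilon> elim by simp
    ultimately have "\<bar>z x - x\<bar> \<le> d * ln x + \<kappa> * ln x + ln x + 2 * C * \<epsilon> * ln x"
      using L elim unfolding z_def by linarith
    then show ?case by (simp add: K_def ring_distribs)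
  qed
  have loc: "\<forall>\<^sub>F x in at_top. \<psi> (\<psi>inv (z x)) = z x \<and> \<psi>inv x / 2 \<le> \<psi>inv (z x) \<and> \<psi>inv (z x) \<le> 2 * \<psi>inv x"
    using \<psi>inv_window[of K] window by eventually_elim auto
  have big: "\<forall>\<^sub>F x in at_top. \<psi>inv x \<ge> A" for A
    using \<psi>inv_at_top by (auto simp: filterlim_at_top)
  show ?thesis
  proof (rule that[of \<epsilon> "\<lambda>x. \<psi>inv (z x)" m])
    have half: "filterlim (\<lambda>x. \<psi>inv x / 2) at_top at_top"
      using filterlim_tendsto_pos_mult_at_top[OF tendsto_const[of "1/2"] _ \<psi>inv_at_top] by simp
    show "filterlim (\<lambda>x. \<psi>inv (z x)) at_top at_top"
      by (rule filterlim_at_top_mono[OF half]) (use loc in eventually_elim, auto)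
    have "filterlim (\<lambda>x. 1 / (2 * (2 ^ d * D\<^sup>2)) * x powr (1 / (2 * (v + 1)))) at_top at_top"
    proof (rule filterlim_tendsto_pos_mult_at_top[OF tendsto_const])
      have "1 / (2 * (v + 1)) > 0" using v_gt_1 by simp
      then show "filterlim (\<lambda>x. x powr (1 / (2 * (v + 1)))) at_top at_top" by real_asymp
    qed (use D in simp)
    also have "(\<lambda>x. 1 / (2 * (2 ^ d * D\<^sup>2)) * x powr (1 / (2 * (v + 1)))) = (\<lambda>x. (x powr (1 / (v + 1)) / 2) * m x)"
    proof
      fix x :: real
      have "1 / (2 * (v + 1)) = 1 / (v + 1) + - 1 / (2 * (v + 1))"
        using v_gt_1 by (simp add: divide_simps)
      then show "1 / (2 * (2 ^ d * D\<^sup>2)) * x powr (1 / (2 * (v + 1))) = (x powr (1 / (v + 1)) / 2) * m x"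
        unfolding m_def by (simp only: powr_add) simp
    qed
    finally have "filterlim (\<lambda>x. (x powr (1 / (v + 1)) / 2) * m x) at_top at_top" .
    then show "filterlim (\<lambda>x. \<psi>inv (z x) * m x) at_top at_top"
    proof (rule filterlim_at_top_mono)
      show "\<forall>\<^sub>F x in at_top. (x powr (1 / (v + 1)) / 2) * m x \<le> \<psi>inv (z x) * m x"
        using loc \<psi>inv_ge_powr
        by eventually_elim (intro mult_right_mono, auto simp: m_def)
    qed
    show "\<forall>\<^sub>F x in at_top. 0 < m x \<and> m x \<le> 1 \<and>
       (\<forall>y. norm y = \<psi>inv (z x) \<longrightarrow> exp x * measure \<nu> (ball y (2 * (\<epsilon> * ln x / b x))) \<le> 1 \<and>
                          m x \<le> exp x * measure \<nu> (ball y (\<epsilon> * ln x / b x)))"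
      unfolding s_def[symmetric]
      using loc s_small logs bpos eventually_compose_filterlim[OF C(2) \<psi>inv_at_top]
        eventually_compose_filterlim[OF D(2) \<psi>inv_at_top] big[of 8] big[of "4 * z1"]
    proof eventually_elim
      case (elim x)
      let ?\<rho> = "\<psi>inv x" and ?R = "\<psi>inv (z x)" and ?s = "s x"
      define E where "E = exp (2 * C * \<epsilon> * ln x)"
      have s: "0 < ?s" "?s < 1" using elim \<epsilon> by (auto simp: s_def)
      have sb: "?s * b x = \<epsilon> * ln x" using elim by (simp add: s_def)
      have L: "L ?\<rho> > 0" using elim by (intro L_pos) auto
      have E: "E > 0" by (simp add: E_def)
      have exp_R: "exp (- \<psi> ?R) = 1 / (exp x * ?s ^ d * L ?\<rho> * (c * 2 ^ d * D) * E)"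
      proof -
        have "exp (\<psi> ?R) = exp x * exp (d * ln ?s) * exp (ln (L ?\<rho>)) * exp (ln (c * 2 ^ d * D)) * E"
          using elim by (simp add: z_def E_def exp_add)
        also have "\<dots> = exp x * ?s ^ d * L ?\<rho> * (c * 2 ^ d * D) * E"
          using s L c D by (simp add: exp_of_nat_mult)
        finally show ?thesis by (simp add: exp_minus divide_inverse)
      qed
      \<comment> \<open>The norm varies by at most \<open>2 * s x\<close> from the centre and the
        slope of \<psi> is at most \<open>C * b x\<close>; since
        \<open>s x * b x = \<epsilon> * ln x\<close>, \<psi> changes by at most
        \<open>2 * C * \<epsilon> * ln x\<close>.\<close>
      have q: "L ?\<rho> / D * (exp (- \<psi> ?R) / E) \<le> q w" "q w \<le> D * L ?\<rho> * (exp (- \<psi> ?R) * E)"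
        if w: "w \<in> ball y (2 * ?s)" and y: "norm y = ?R" for y w
      proof -
        have wy: "\<bar>norm w - ?R\<bar> \<le> 2 * ?s"
          using w y norm_triangle_ineq3[of w y] by (auto simp: dist_norm norm_minus_commute)
        then have win: "norm w \<in> {?\<rho>/4..4*?\<rho>}" using elim s by (auto simp: abs_le_iff)
        have "\<bar>\<psi> (norm w) - \<psi> ?R\<bar> \<le> 2 * ?s * (C * b x)"
          using elim wy win C by (intro \<psi>_variation[of ?\<rho>]) auto
        also have "\<dots> = 2 * C * (?s * b x)" by simp
        finally have "\<bar>\<psi> (norm w) - \<psi> ?R\<bar> \<le> 2 * C * \<epsilon> * ln x" by (simp add: sb)
        then have "exp (- \<psi> ?R - 2 * C * \<epsilon> * ln x) \<le> exp (- \<psi> (norm w))"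
          "exp (- \<psi> (norm w)) \<le> exp (- \<psi> ?R + 2 * C * \<epsilon> * ln x)"
          by (auto simp: abs_le_iff)
        then have e: "exp (- \<psi> ?R) / E \<le> exp (- \<psi> (norm w))" "exp (- \<psi> (norm w)) \<le> exp (- \<psi> ?R) * E"
          unfolding E_def by (simp_all only: exp_diff exp_add)
        have l: "L ?\<rho> / D \<le> L (norm w)" "L (norm w) \<le> D * L ?\<rho>" using elim win by auto
        have "0 < L (norm w)" using win elim by (intro L_pos) auto
        then show "L ?\<rho> / D * (exp (- \<psi> ?R) / E) \<le> q w" "q w \<le> D * L ?\<rho> * (exp (- \<psi> ?R) * E)"
          unfolding q_eq using mult_mono[OF l(1) e(1)] mult_mono[OF l(2) e(2)] L D(1) E by auto
      qed
      have nz: "exp x \<noteq> 0" "?s ^ d \<noteq> 0" "L ?\<rho> \<noteq> 0" "c \<noteq> 0" "D \<noteq> 0" "E \<noteq> 0"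
        using s L c D E by auto
      have "exp x * measure \<nu> (ball y (2 * ?s)) \<le> 1" if y: "norm y = ?R" for y
      proof -
        have "measure \<nu> (ball y (2 * ?s)) \<le> (D * L ?\<rho> * (exp (- \<psi> ?R) * E)) * (c * (2 * ?s) ^ d)"
          using q(2)[OF _ y] s c D L E
          by (intro measure_density_le[where f = "\<lambda>_. 1"]) (auto simp: ball_vol)
        also have "\<dots> = 1 / exp x"
          using nz by (simp add: exp_R power_mult_distrib)
        finally show ?thesis by (simp add: field_simps)
      qed
      moreover have "m x \<le> exp x * measure \<nu> (ball y ?s)" if y: "norm y = ?R" for y
      proof -
        have E2: "1 / (E * E) = x powr (- 1 / (2 * (v + 1)))"
        proof -
          have "1 / (E * E) = exp (- (4 * C * \<epsilon> * ln x))"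
            unfolding E_def by (simp add: exp_minus divide_inverse flip: exp_add)
          also have "4 * C * \<epsilon> * ln x = 1 / (2 * (v + 1)) * ln x"
            using C(1) v_gt_1 by (simp add: \<epsilon>_def divide_simps)
          finally show ?thesis using elim by (simp add: powr_def)
        qed
        have "(L ?\<rho> / D * (exp (- \<psi> ?R) / E)) * (c * ?s ^ d) \<le> measure \<nu> (ball y ?s)"
        proof (rule measure_density_ge)
          show "L ?\<rho> / D * (exp (- \<psi> ?R) / E) \<le> q w" if "w \<in> ball y ?s" for w
            using q(1)[of w y] y that s by auto
          show "finite_measure \<nu>" by (rule \<nu>.finite_measure_axioms)
        qed (use s c D L E in \<open>auto simp: ball_vol\<close>)
        moreover have "(L ?\<rho> / D * (exp (- \<psi> ?R) / E)) * (c * ?s ^ d) = m x / exp x"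
          unfolding m_def E2[symmetric] exp_R using nz by (simp add: field_simps power2_eq_square)
        ultimately have "m x / exp x \<le> measure \<nu> (ball y ?s)" by (simp only:)
        then show ?thesis by (simp add: pos_divide_le_eq mult.commute)
      qed
      moreover have "0 < m x" using elim D by (auto simp: m_def)
      moreover have "m x \<le> 1"
      proof -
        have "x powr (- 1 / (2 * (v + 1))) \<le> x powr 0"
          using elim v_gt_1 by (intro powr_mono) auto
        moreover have "1 * 1 \<le> 2 ^ d * D\<^sup>2"
          using D by (intro mult_mono) auto
        ultimately show ?thesis using elim by (auto simp: m_def divide_le_eq)
      qed
      ultimately show ?case by auto
    qed
  qed (rule \<epsilon>)
qed

section \<open>Outer radius, inner radius and the gap between them\<close>

text \<open>Once the derivative of \<psi> exceeds \<beta>, the function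
  \<open>t powr \<beta> * exp (- \<psi> t)\<close> decreases for \<open>t \<ge> 1\<close>. With
  \<open>\<beta> = 2 * d + \<kappa>\<close> and \<open>L t \<le> t powr \<kappa>\<close> this bounds
  the density beyond \<open>r\<close> by its value at \<open>r\<close> times the integrable
  \<open>t powr (- 2 * d)\<close>. As \<open>exp x * exp (- \<psi> r) = x powr (- K)\<close> and
  \<open>r \<le> 2 * x\<close>, the choice \<open>K \<ge> \<beta> + 1\<close> leaves order
  \<open>1 / x\<close>.\<close>

lemma tail_radius:
  obtains K' A where "\<And>K. K \<ge> K' \<Longrightarrow> \<forall>\<^sub>F x in at_top. exp x * measure \<nu> (- ball 0 (\<psi>inv (x + K * ln x))) \<le> A / x"
proof -
  obtain \<kappa> where \<kappa>: "\<kappa> \<ge> 1" "\<forall>\<^sub>F t in at_top. t powr (- \<kappa>) \<le> L t \<and> L t \<le> t powr \<kappa>"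
    using L_between_powr .
  define d where "d = CARD('d)"
  define \<beta> where "\<beta> = 2 * d + \<kappa>"
  obtain t0 where t0: "\<And>t. t \<ge> t0 \<Longrightarrow> L t \<le> t powr \<kappa>"
    using \<kappa>(2) by (auto simp: eventually_at_top_linorder)
  have \<beta>: "\<beta> \<ge> 1" using \<kappa> by (simp add: \<beta>_def)
  \<comment> \<open>\<open>2 ^ d\<close> comes from \<open>prod_1_plus_square_le\<close>,
    \<open>2 powr \<beta>\<close> from \<open>r \<le> 2 * x\<close>, and \<open>pi ^ d\<close> from
    the Cauchy integrals.\<close>
  define A where "A = 2 ^ d * 2 powr \<beta> * pi ^ d"
  show ?thesis
  proof (rule that[of "\<beta> + 1" A])
    fix K assume K: "K \<ge> \<beta> + 1"
    define R where "R x = \<psi>inv (x + K * ln x)" for x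
    have win: "\<forall>\<^sub>F x in at_top. \<psi> (R x) = x + K * ln x \<and> \<psi>inv x / 2 \<le> R x \<and> R x \<le> 2 * \<psi>inv x"
      using \<psi>inv_window[of K] eventually_ge_at_top[of 1]
    proof eventually_elim
      case (elim x)
      have "\<bar>x + K * ln x - x\<bar> \<le> K * ln x" using elim \<beta> K by simp
      with elim show ?case unfolding R_def by blast
    qed
    have half: "filterlim (\<lambda>x. \<psi>inv x / 2) at_top at_top"
      using filterlim_tendsto_pos_mult_at_top[OF tendsto_const[of "1/2"] _ \<psi>inv_at_top] by simp
    have R_lim: "filterlim R at_top at_top"
      by (rule filterlim_at_top_mono[OF half]) (use win in eventually_elim, auto)
    have big: "\<forall>\<^sub>F x in at_top. R x \<ge> B" for B
      using R_lim by (auto simp: filterlim_at_top)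
    have deriv_big: "\<forall>\<^sub>F x in at_top. deriv \<psi> (R x) \<ge> B" for B
    proof -
      have "\<forall>\<^sub>F R in at_top. deriv \<psi> R \<ge> R powr ((v - 1) / 2)"
      proof -
        have "1 + (v - 1) / 2 < v" using v_gt_1 by (simp add: field_simps)
        from \<psi>_ge_powr[OF this] show ?thesis
          using deriv_ge eventually_gt_at_top[of 0]
        proof eventually_elim
          case (elim R)
          have "R powr ((v - 1) / 2) = R powr (1 + (v - 1) / 2) / R" using elim by (simp add: powr_add)
          also have "\<dots> \<le> \<psi> R / R" using elim by (intro divide_right_mono) auto
          finally show ?case using elim by auto
        qed
      qed
      moreover have "filterlim (\<lambda>R::real. R powr ((v - 1) / 2)) at_top at_top"
      proof -
        have "(v - 1) / 2 > 0" using v_gt_1 by simp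
        then show ?thesis by real_asymp
      qed
      ultimately have "filterlim (deriv \<psi>) at_top at_top" by (rule filterlim_at_top_mono[rotated])
      then have "filterlim (\<lambda>x. deriv \<psi> (R x)) at_top at_top" by (rule filterlim_compose[OF _ R_lim])
      then show ?thesis by (auto simp: filterlim_at_top)
    qed
    show "\<forall>\<^sub>F x in at_top. exp x * measure \<nu> (- ball 0 (\<psi>inv (x + K * ln x))) \<le> A / x"
      unfolding R_def[symmetric]
      using win big[of 1] big[of t0] big[of z1] deriv_big[of \<beta>] \<psi>inv_le eventually_ge_at_top[of 1]
    proof eventually_elim
      case (elim x)
      define r where "r = R x"
      have r: "r \<ge> 1" "r \<ge> t0" "r \<ge> z1" "deriv \<psi> r \<ge> \<beta>" "r \<le> 2 * x" "\<psi> r = x + K * ln x"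
        using elim by (auto simp: r_def)
      define G where "G = 2 ^ d * (r powr \<beta> * exp (- \<psi> r))"
      have G: "G \<ge> 0" by (simp add: G_def)
      have q: "q w \<le> G * (\<Prod>b\<in>Basis. 1 / (1 + (w \<bullet> b)\<^sup>2))" if "w \<in> - ball 0 r" for w
      proof -
        let ?t = "norm w"
        have t: "?t \<ge> r" "?t \<ge> 1" using that r by auto
        then have w: "w \<noteq> 0" by auto
        have "ln ?t - ln r = ln (1 + (?t / r - 1))" using w r by (simp add: ln_div)
        also have "\<dots> \<le> ?t / r - 1" using t r by (intro ln_add_one_self_le_self) (simp add: field_simps)
        also have "\<dots> = (?t - r) / r" using r by (simp add: field_simps)
        also have "\<dots> \<le> ?t - r" using t r mult_left_mono[of 1 r "?t - r"] by (simp add: divide_le_eq)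
        finally have "\<beta> * (ln ?t - ln r) \<le> \<beta> * (?t - r)" using \<beta> by (intro mult_left_mono) auto
        also have "\<dots> \<le> deriv \<psi> r * (?t - r)" using r t by (intro mult_right_mono) auto
        also have "\<dots> \<le> \<psi> ?t - \<psi> r" using \<psi>_diff_ge[of r ?t] r t by (simp add: mult.commute)
        finally have "exp (\<beta> * ln ?t - \<psi> ?t) \<le> exp (\<beta> * ln r - \<psi> r)" by (simp add: algebra_simps)
        then have g: "?t powr \<beta> * exp (- \<psi> ?t) \<le> r powr \<beta> * exp (- \<psi> r)"
          using w r(1) by (simp add: powr_def exp_diff exp_minus divide_inverse)
        have "q w \<le> ?t powr \<kappa> * exp (- \<psi> ?t)"
          unfolding q_eq using t0[of ?t] t r by (intro mult_right_mono) auto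
        also have "?t powr \<kappa> = ?t powr \<beta> / (?t\<^sup>2) ^ d"
        proof -
          have "(?t\<^sup>2) ^ d = ?t powr (2 * d)"
            using powr_realpow[of ?t "2 * d"] w by (simp add: power_mult[symmetric])
          then show ?thesis using t by (simp add: \<beta>_def powr_add)
        qed
        also have "?t powr \<beta> / (?t\<^sup>2) ^ d * exp (- \<psi> ?t) \<le> (r powr \<beta> * exp (- \<psi> r)) / (?t\<^sup>2) ^ d"
          using divide_right_mono[OF g, of "(?t\<^sup>2) ^ d"] by simp
        also have "\<dots> = G * (1 / (2 * ?t\<^sup>2) ^ d)"
          by (simp add: G_def power_mult_distrib)
        also have "\<dots> \<le> G * (1 / (\<Prod>b\<in>Basis. 1 + (w \<bullet> b)\<^sup>2))"
        proof (intro mult_left_mono divide_left_mono G mult_pos_pos)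
          show "(\<Prod>b\<in>Basis. 1 + (w \<bullet> b)\<^sup>2) \<le> (2 * ?t\<^sup>2) ^ d"
            using prod_1_plus_square_le[of w] t by (simp add: d_def)
        qed (use w in \<open>auto intro!: prod_pos add_pos_nonneg\<close>)
        finally show ?thesis by (simp add: prod_dividef)
      qed
      have "measure \<nu> (- ball 0 r) \<le> G * pi ^ d"
      proof (rule measure_density_le[where f = "\<lambda>w. \<Prod>b\<in>Basis. 1 / (1 + (w \<bullet> b)\<^sup>2)"])
        have "(\<integral>\<^sup>+w. ennreal (\<Prod>b\<in>Basis. 1 / (1 + (w \<bullet> b)\<^sup>2)) * indicator (- ball 0 r) w \<partial>(lborel :: (real ^ 'd) measure))
          \<le> (\<integral>\<^sup>+w. ennreal (\<Prod>b\<in>Basis. 1 / (1 + (w \<bullet> b)\<^sup>2)) \<partial>(lborel :: (real ^ 'd) measure))"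
          by (intro nn_integral_mono) (auto simp: indicator_def)
        then show "(\<integral>\<^sup>+w. ennreal (\<Prod>b\<in>Basis. 1 / (1 + (w \<bullet> b)\<^sup>2)) * indicator (- ball 0 r) w \<partial>(lborel :: (real ^ 'd) measure)) \<le> ennreal (pi ^ d)"
          by (simp add: nn_integral_prod_inverse_1_plus_square d_def)
      qed (use q G in auto)
      then have "exp x * measure \<nu> (- ball 0 r) \<le> exp x * (G * pi ^ d)" by simp
      also have "\<dots> = 2 ^ d * pi ^ d * (r powr \<beta> * (exp x * exp (- \<psi> r)))" by (simp add: G_def)
      also have "exp x * exp (- \<psi> r) = x powr (- K)"
        using elim by (simp add: r powr_def flip: exp_add)
      also have "r powr \<beta> * x powr (- K) \<le> (2 * x) powr \<beta> * x powr (- K)"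
        using r \<beta> by (intro mult_right_mono powr_mono2) auto
      also have "(2 * x) powr \<beta> * x powr (- K) = 2 powr \<beta> * (x powr \<beta> * x powr (- K))"
        using elim by (simp add: powr_mult)
      also have "x powr \<beta> * x powr (- K) \<le> x powr (- 1)"
        using elim K unfolding powr_add[symmetric] by (intro powr_mono) auto
      finally show ?case using elim by (simp add: A_def r_def powr_minus_divide mult_ac)
    qed
  qed
qed

text \<open>In the core of radius \<open>max t0 z1\<close> the local lower bound on \<open>q\<close>
  is multiplied by \<open>exp x\<close>, which beats every power of \<open>x\<close>; outside it
  \<psi> is increasing and \<open>L\<close> is bounded below by a power of the norm. \<kappa> is
  produced before the local bound is assumed, so that the radii can be chosen outside the scope of
  that assumption.\<close>

lemma inner_radius:
  obtains \<kappa> where "\<kappa> \<ge> 0" "\<And>K. locally_bounded_away_from_0 q \<Longrightarrow> K \<ge> 0 \<Longrightarrow> \<forall>\<^sub>F x in at_top. \<forall>w\<in>ball 0 (\<psi>inv (x - K * ln x)).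
      x powr (K - \<kappa>) / 2 powr \<kappa> \<le> exp x * q w"
proof -
  obtain \<kappa> where \<kappa>: "\<kappa> \<ge> 1" "\<forall>\<^sub>F t in at_top. t powr (- \<kappa>) \<le> L t \<and> L t \<le> t powr \<kappa>"
    using L_between_powr .
  obtain t0 where t0: "\<And>t. t \<ge> t0 \<Longrightarrow> t powr (- \<kappa>) \<le> L t"
    using \<kappa>(2) by (auto simp: eventually_at_top_linorder)
  show ?thesis
  proof (rule that)
    show "\<kappa> \<ge> 0" using \<kappa> by simp
    fix K :: real assume lb: "locally_bounded_away_from_0 q" and K: "K \<ge> 0"
    obtain c where c: "c > 0" "\<And>w. norm w \<le> max t0 z1 \<Longrightarrow> c \<le> q w"
    proof -
      have "\<exists>c>0. \<forall>w\<in>cball 0 (max t0 z1). c \<le> q w"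
        using lb unfolding locally_bounded_away_from_0_def by blast
      then show ?thesis using that by auto
    qed
    define R where "R x = \<psi>inv (x - K * ln x)" for x
    have win: "\<forall>\<^sub>F x in at_top. \<psi> (R x) = x - K * ln x \<and> R x \<le> 2 * \<psi>inv x"
      using \<psi>inv_window[of K] eventually_ge_at_top[of 1]
    proof eventually_elim
      case (elim x)
      have "\<bar>x - K * ln x - x\<bar> \<le> K * ln x" using elim K by simp
      with elim show ?case unfolding R_def by blast
    qed
    have "\<forall>\<^sub>F x in at_top. x powr (K - \<kappa>) / 2 powr \<kappa> \<le> exp x * c"
      using c(1) by real_asymp
    then show "\<forall>\<^sub>F x in at_top. \<forall>w\<in>ball 0 (\<psi>inv (x - K * ln x)).
      x powr (K - \<kappa>) / 2 powr \<kappa> \<le> exp x * q w"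
      unfolding R_def[symmetric] using win \<psi>inv_le eventually_ge_at_top[of 1]
    proof eventually_elim
      case (elim x)
      show ?case
      proof
        fix w :: "real ^ 'd" assume w: "w \<in> ball 0 (R x)"
        show "x powr (K - \<kappa>) / 2 powr \<kappa> \<le> exp x * q w"
        proof (cases "norm w \<le> max t0 z1")
          case True
          then have "exp x * c \<le> exp x * q w" using c by simp
          then show ?thesis using elim by linarith
        next
          case False
          let ?t = "norm w"
          have t: "?t \<ge> t0" "?t \<ge> z1" "?t > 0" "?t \<le> R x" using False w z1_pos by auto
          have "(2 * x) powr (- \<kappa>) \<le> ?t powr (- \<kappa>)"
            using t elim \<kappa> by (intro powr_mono2') auto
          also have "\<dots> \<le> L ?t" using t0 t by auto
          finally have l: "(2 * x) powr (- \<kappa>) \<le> L ?t" .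
          have e: "exp (- (x - K * ln x)) \<le> exp (- \<psi> ?t)"
            using \<psi>_mono[of ?t "R x"] t elim by simp
          have "x powr (K - \<kappa>) / 2 powr \<kappa> = exp x * ((2 * x) powr (- \<kappa>) * exp (- (x - K * ln x)))"
            using elim by (simp add: powr_mult powr_diff powr_minus exp_diff exp_minus field_simps) (simp add: powr_def)
          also have "\<dots> \<le> exp x * (L ?t * exp (- \<psi> ?t))"
            using l e L_pos[of ?t] t by (intro mult_left_mono mult_mono) auto
          finally show ?thesis by (simp add: q_eq)
        qed
      qed
    qed
  qed
qed

text \<open>\<psi> gains \<open>2 * K * ln x\<close> between the radii, with slope at least
  \<open>b x / C\<close>: the smaller radius lies in the range of \<open>deriv_comparable\<close>,
  and the derivative increases from there.\<close>

lemma radii_gap: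
  assumes "K \<ge> 0"
  obtains C where "C \<ge> 0" "\<forall>\<^sub>F x in at_top. 
     0 \<le> \<psi>inv (x + K * ln x) - \<psi>inv (x - K * ln x) \<and> 
     \<psi>inv (x + K * ln x) - \<psi>inv (x - K * ln x) \<le> C * ln x / b x"
proof -
  obtain C where C: "C \<ge> 1"
    "\<forall>\<^sub>F R in at_top. \<forall>s\<in>{R/4..4*R}. deriv \<psi> R / C \<le> deriv \<psi> s \<and> deriv \<psi> s \<le> C * deriv \<psi> R"
    using deriv_comparable by auto
  have big: "\<forall>\<^sub>F x in at_top. \<psi>inv x \<ge> A" for A
    using \<psi>inv_at_top by (auto simp: filterlim_at_top)
  show ?thesis
  proof (rule that[of "2 * K * C"])
    show "0 \<le> 2 * K * C" using assms C by simp
    show "\<forall>\<^sub>F x in at_top. 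
     0 \<le> \<psi>inv (x + K * ln x) - \<psi>inv (x - K * ln x) \<and> 
     \<psi>inv (x + K * ln x) - \<psi>inv (x - K * ln x) \<le> 2 * K * C * ln x / b x"
      using \<psi>inv_window[of K] eventually_ge_at_top[of 1] big[of "2 * z1"]
        eventually_compose_filterlim[OF C(2) \<psi>inv_at_top]
    proof eventually_elim
      case (elim x)
      define R0 R1 where "R0 = \<psi>inv (x - K * ln x)" and "R1 = \<psi>inv (x + K * ln x)"
      have "\<bar>x - K * ln x - x\<bar> \<le> K * ln x" "\<bar>x + K * ln x - x\<bar> \<le> K * ln x" using elim assms by simp_all
      then have R: "\<psi> R0 = x - K * ln x" "\<psi> R1 = x + K * ln x" "\<psi>inv x / 2 \<le> R0" "\<psi>inv x / 2 \<le> R1"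
        "R0 \<le> 2 * \<psi>inv x" using elim unfolding R0_def R1_def by blast+
      have "0 \<le> K * ln x" using elim assms by simp
      then have le: "R0 \<le> R1"
        using \<psi>_strict_mono[of R1 R0] R elim by (cases "R0 \<le> R1") auto
      have b: "b x > 0" using deriv_pos[of "\<psi>inv x"] elim z1_pos by auto
      have "(R1 - R0) * (b x / C) \<le> (R1 - R0) * deriv \<psi> R0"
        using elim R le z1_pos by (intro mult_left_mono) auto
      also have "\<dots> \<le> 2 * K * ln x" using \<psi>_diff_ge[of R0 R1] R le elim by auto
      finally have "R1 - R0 \<le> 2 * K * C * ln x / b x" using b C by (simp add: field_simps)
      then show ?case using le unfolding R0_def R1_def by auto
    qed
  qed
qed

lemma \<psi>inv_strict_mono:
  obtains z0 where "\<And>x y. z0 \<le> x \<Longrightarrow> x < y \<Longrightarrow> \<psi>inv x < \<psi>inv y"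
proof -
  have "\<forall>\<^sub>F z in at_top. \<psi> (\<psi>inv z) = z \<and> \<psi>inv z \<ge> z1"
    using \<psi>_\<psi>inv \<psi>inv_at_top by (auto simp: filterlim_at_top eventually_conj_iff)
  then obtain z0 where z0: "\<And>z. z \<ge> z0 \<Longrightarrow> \<psi> (\<psi>inv z) = z \<and> \<psi>inv z \<ge> z1"
    by (auto simp: eventually_at_top_linorder)
  show ?thesis
  proof (rule that[of z0])
    fix x y assume xy: "z0 \<le> x" "x < y"
    then show "\<psi>inv x < \<psi>inv y"
      using \<psi>_mono[of "\<psi>inv y" "\<psi>inv x"] z0[of x] z0[of y] by (cases "\<psi>inv x < \<psi>inv y") auto
  qed
qed

end

section \<open>Limit theorems\<close>

text \<open>The critical radii increase only from some index on; below it a linear ramp up to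
  \<open>f k\<close> is substituted.\<close>

lemma strict_mono_extension:
  fixes f :: "nat \<Rightarrow> real"
  assumes "\<And>m n. k \<le> m \<Longrightarrow> m < n \<Longrightarrow> f m < f n" "f k > 0"
  obtains g where "strict_mono g" "\<And>n. g n > 0" "\<And>n. k \<le> n \<Longrightarrow> g n = f n"
proof
  let ?g = "\<lambda>n. if n < k then f k * (real n + 1) / (real k + 1) else f n"
  show "strict_mono ?g"
  proof (rule strict_monoI)
    fix m n :: nat assume "m < n"
    consider "n < k" | "m < k" "k \<le> n" | "k \<le> m" using \<open>m < n\<close> by linarith
    then show "?g m < ?g n"
    proof cases
      case 1
      then show ?thesis using \<open>m < n\<close> assms(2) by (simp add: divide_strict_right_mono)
    next
      case 2
      have "f k * (real m + 1) / (real k + 1) < f k" using 2 assms(2) by (simp add: divide_less_eq)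
      also have "f k \<le> f n" using assms(1)[of k n] 2 by (cases "k = n") auto
      finally show ?thesis using 2 by simp
    next
      case 3
      then show ?thesis using assms(1)[of m n] \<open>m < n\<close> by simp
    qed
  qed
  show "?g n > 0" for n
    using assms(2) assms(1)[of k n] by (cases "k = n") (auto intro!: divide_pos_pos mult_pos_pos add_nonneg_pos)
qed simp

lemma filterlim_ln_real_at_top: "filterlim (\<lambda>n. ln (real n)) at_top sequentially"
  by (rule filterlim_compose[OF ln_at_top filterlim_real_sequentially])

context superexponential_density
begin

lemma emeasure_singleton: "emeasure \<nu> {x} = 0"
  by (subst emeasure_density) (auto simp: nn_integral_indicator_singleton)

text \<open>Makes the unit ball the source of a further point away from the clusters: it is occupied
  with probability tending to 1.\<close>

lemma measure_unit_ball_pos: "measure \<nu> (ball 0 1) > 0"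
proof (rule ccontr)
  assume "\<not> measure \<nu> (ball 0 1) > 0"
  then have "emeasure \<nu> (ball 0 1) = 0"
    by (simp add: \<nu>.emeasure_eq_measure not_less measure_le_0_iff)
  then have "(\<integral>\<^sup>+x. ennreal (q x) * indicator (ball 0 1) x \<partial>lborel) = 0"
    by (subst (asm) emeasure_density) auto
  moreover have "(\<lambda>x. ennreal (q x) * indicator (ball 0 1) x) \<in> borel_measurable lborel"
    by (intro borel_measurable_times_ennreal borel_measurable_indicator) (auto intro: measurable_compose[OF q_meas])
  ultimately have "AE x in lborel. ennreal (q x) * indicator (ball 0 1) x = 0"
    by (subst (asm) nn_integral_0_iff_AE)
  then have "AE x in lborel. x \<notin> (ball 0 1 :: (real ^ 'd) set)"
  proof eventually_elim
    case (elim x)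
    then show ?case using q_pos[of x] by (auto simp: indicator_def ennreal_eq_0_iff split: if_splits)
  qed
  then have "emeasure lborel (ball 0 1 :: (real ^ 'd) set) = 0"
    by (subst (asm) AE_iff_null_sets[symmetric]) auto
  then show False using unit_ball_vol_pos[of "real CARD('d)"] by (simp add: emeasure_ball)
qed

lemma poisson_processI:
  assumes "poisson_sample M N X (real n) \<nu>" "n \<ge> 1"
  shows "poisson_process M N X (real n) \<nu>"
  using assms by (intro poisson_process.intro poisson_process_axioms.intro) (auto simp: poisson_sample_def)

section \<open>Disconnectedness for small connection radii\<close>

lemma whp_not_connected:
  fixes M :: "nat \<Rightarrow> 'w measure"
  assumes dim: "CARD('d) \<ge> 2"
    and r_bounds: "\<And>n. 0 < r n \<and> r n \<le> 1"
    and sample: "\<And>n. n \<ge> 1 \<Longrightarrow> poisson_sample (M n) (N n) (X n) (real n) \<nu>"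
    and small: "(\<lambda>n. r n * b (ln (real n))) \<in> o(\<lambda>n. ln (ln (real n)))"
  shows "whp M (\<lambda>n \<omega>. \<not> Digraph_Component.connected (geometric_graph (poisson_points (N n) (X n) \<omega>) (r n)))"
proof -
  obtain \<epsilon> R m where \<epsilon>: "\<epsilon> > 0" and R: "filterlim R at_top at_top" and Rm: "filterlim (\<lambda>x. R x * m x) at_top at_top"
    and crit: "\<forall>\<^sub>F x in at_top. 0 < m x \<and> m x \<le> 1 \<and>
       (\<forall>y. norm y = R x \<longrightarrow> exp x * measure \<nu> (ball y (2 * (\<epsilon> * ln x / b x))) \<le> 1 \<and>
                          m x \<le> exp x * measure \<nu> (ball y (\<epsilon> * ln x / b x)))"
    using critical_radius by blast
  let ?x = "\<lambda>n. ln (real n)"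
  define s where "s x = \<epsilon> * ln x / b x" for x
  \<comment> \<open>The first term is the probability of an empty unit ball; the second is the error
    \<open>6 / (card J * m)\<close> with at least \<open>R / 8\<close> places.\<close>
  define e where "e n = exp (- (real n * measure \<nu> (ball 0 1))) + 48 / (R (?x n) * m (?x n))" for n
  have "((\<lambda>x. \<epsilon> * (ln x / b x)) \<longlongrightarrow> \<epsilon> * 0) at_top"
    by (intro tendsto_mult tendsto_const ln_over_b)
  then have s_small: "\<forall>\<^sub>F x in at_top. s x < 1"
    by (intro order_tendstoD) (auto simp: s_def)
  have b1: "\<forall>\<^sub>F x in at_top. b x \<ge> 1" using b_at_top by (auto simp: filterlim_at_top)
  have R1: "\<forall>\<^sub>F x in at_top. R x \<ge> 8" using R by (auto simp: filterlim_at_top)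
  have "\<forall>\<^sub>F n in sequentially. norm (r n * b (?x n)) \<le> \<epsilon> * norm (ln (?x n))"
    using small \<epsilon> by (rule landau_o.smallD)
  \<comment> \<open>Consequently the outer ball of radius \<open>s + r\<close> fits into the ball of
    radius \<open>2 * s\<close> controlled by \<open>critical_radius\<close>.\<close>
  then have "\<forall>\<^sub>F n in sequentially. r n \<le> s (?x n)"
    using eventually_compose_filterlim[OF b1 filterlim_ln_real_at_top]
      eventually_compose_filterlim[OF eventually_ge_at_top[of 1] filterlim_ln_real_at_top]
  proof eventually_elim
    case (elim n)
    then have "r n * b (?x n) \<le> \<epsilon> * ln (?x n)" using r_bounds[of n] by (simp add: abs_mult)
    then show ?case using elim by (simp add: s_def field_simps)
  qed
  note rs = this
  show ?thesis
  proof (rule whpI)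
    show "\<forall>\<^sub>F n in sequentially. prob_space (M n)"
      using eventually_ge_at_top[of 1] by eventually_elim (use sample in \<open>auto simp: poisson_sample_def\<close>)
    show "e \<longlonglongrightarrow> 0"
    proof -
      have "(\<lambda>n. exp (- (real n * measure \<nu> (ball 0 1)))) \<longlonglongrightarrow> 0"
      proof -
        define p where "p = measure \<nu> (ball 0 1)"
        have "p > 0" using measure_unit_ball_pos by (simp add: p_def)
        then show ?thesis unfolding p_def[symmetric] by real_asymp
      qed
      moreover have "((\<lambda>x. 48 / (R x * m x)) \<longlongrightarrow> 0) at_top"
        by (rule real_tendsto_divide_at_top[OF tendsto_const Rm])
      then have "(\<lambda>n. 48 / (R (?x n) * m (?x n))) \<longlonglongrightarrow> 0"
        by (rule filterlim_compose[OF _ filterlim_ln_real_at_top])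
      ultimately show ?thesis unfolding e_def by (auto intro: tendsto_eq_intros)
    qed
    show "\<forall>\<^sub>F n in sequentially. 1 - e n \<le> measure (M n) {\<omega> \<in> space (M n).
      \<not> Digraph_Component.connected (geometric_graph (poisson_points (N n) (X n) \<omega>) (r n))}"
      using rs eventually_ge_at_top[of 1] 
        eventually_compose_filterlim[OF s_small filterlim_ln_real_at_top]
        eventually_compose_filterlim[OF R1 filterlim_ln_real_at_top]
        eventually_compose_filterlim[OF crit[folded s_def] filterlim_ln_real_at_top]
    proof eventually_elim
      case (elim n)
      interpret poisson_process "M n" "N n" "X n" "real n" \<nu>
        using sample elim by (intro poisson_processI) auto
      let ?R = "R (?x n)" and ?m = "m (?x n)" and ?s = "s (?x n)"
      obtain y :: "nat \<Rightarrow> real ^ 'd" where y: "\<And>k. real k \<le> ?R / 8 \<Longrightarrow> norm (y k) = ?R"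
        "\<And>k l. k \<noteq> l \<Longrightarrow> 8 \<le> dist (y k) (y l)"
        using separated_points_on_sphere[where 'a = "real ^ 'd", of ?R] dim elim by auto
      define J where "J = {..nat \<lfloor>?R / 8\<rfloor>}"
      have J: "real k \<le> ?R / 8" if "k \<in> J" for k
        using that elim by (auto simp: J_def le_nat_iff le_floor_iff)
      have cardJ: "?R / 8 \<le> card J"
        using elim by (simp add: J_def) linarith
      have n: "exp (?x n) = real n" using elim by simp
      have r: "0 < r n" "r n \<le> 1" "r n \<le> ?s" using r_bounds[of n] elim by auto
      have "1 - exp (- (real n * measure \<nu> (ball 0 1))) - 6 / (card J * ?m)
        \<le> measure (M n) {\<omega> \<in> space (M n).
          \<not> Digraph_Component.connected (geometric_graph (poisson_points (N n) (X n) \<omega>) (r n))}"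
      proof (rule prob_connected_le)
        show "ball (y k) (?s + r n) \<inter> ball (y l) (?s + r n) = {}" if "k \<noteq> l" for k l
        proof -
          have False if "dist (y k) w < ?s + r n" "dist (y l) w < ?s + r n" for w
            using y(2)[OF \<open>k \<noteq> l\<close>] dist_triangle2[of "y k" "y l" w] that r elim by linarith
          then show ?thesis by auto
        qed
        \<comment> \<open>The centres have norm at least 8 and the balls have radius below
          2.\<close>
        show "ball 0 1 \<inter> ball (y k) (?s + r n) = {}" if "k \<in> J" for k
        proof -
          have False if "norm w < 1" "dist (y k) w < ?s + r n" for w
            using y(1)[OF J[OF \<open>k \<in> J\<close>]] norm_triangle_sub[of "y k" w] that r elim
            by (simp add: dist_norm)
          then show ?thesis by auto
        qed
        show "real n * measure \<nu> (ball (y k) (?s + r n)) \<le> 1" if "k \<in> J" for k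
        proof -
          have "measure \<nu> (ball (y k) (?s + r n)) \<le> measure \<nu> (ball (y k) (2 * ?s))"
            using r by (intro \<nu>.finite_measure_mono subset_ball) auto
          then have "real n * measure \<nu> (ball (y k) (?s + r n)) \<le> real n * measure \<nu> (ball (y k) (2 * ?s))"
            by (intro mult_left_mono) auto
          moreover have "real n * measure \<nu> (ball (y k) (2 * ?s)) \<le> 1"
            using elim y(1)[OF J[OF that]] n by auto
          ultimately show ?thesis by linarith
        qed
        show "?m \<le> real n * measure \<nu> (ball (y k) ?s)" if "k \<in> J" for k
          using elim y(1)[OF J[OF that]] n by auto
      qed (use elim r in \<open>auto simp: J_def\<close>)
      moreover have "6 / (card J * ?m) \<le> 6 / (?R / 8 * ?m)"
        using cardJ elim by (intro divide_left_mono mult_right_mono mult_pos_pos) (auto simp: J_def)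
      ultimately show ?case by (simp add: e_def)
    qed
  qed
qed

section \<open>Concentration and the empty exterior for large connection radii\<close>

text \<open>For either sign of \<open>K\<close>, \<open>x + K * ln x\<close> increases strictly once
  \<open>x > \<bar>K\<bar>\<close>, because \<open>ln y - ln x \<le> (y - x) / x\<close>. The inner
  radius uses the negative sign.\<close>

lemma eventually_ln_window_strict_mono:
  fixes K :: real
  obtains k :: nat where "\<And>m n :: nat. k \<le> m \<Longrightarrow> m < n \<Longrightarrow>
      \<psi>inv (ln (real m) + K * ln (ln (real m))) < \<psi>inv (ln (real n) + K * ln (ln (real n)))"
    "\<And>n. n \<ge> k \<Longrightarrow> \<psi>inv (ln (real n) + K * ln (ln (real n))) > 0"
proof -
  obtain z0 where z0: "\<And>x y. z0 \<le> x \<Longrightarrow> x < y \<Longrightarrow> \<psi>inv x < \<psi>inv y"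
    by (rule \<psi>inv_strict_mono) blast
  have lim: "filterlim (\<lambda>x::real. x + K * ln x) at_top at_top" by real_asymp
  have "\<forall>\<^sub>F x in at_top. x + K * ln x \<ge> z0 \<and> \<psi>inv (x + K * ln x) > 0 \<and> x \<ge> \<bar>K\<bar> + 1"
    using lim[unfolded filterlim_at_top, rule_format, of z0]
      filterlim_compose[OF \<psi>inv_at_top lim, unfolded filterlim_at_top, rule_format, of 1]
      eventually_ge_at_top[of "\<bar>K\<bar> + 1"]
    by eventually_elim auto
  from eventually_compose_filterlim[OF this filterlim_ln_real_at_top]
  obtain k where k: "\<And>n. n \<ge> k \<Longrightarrow> ln (real n) + K * ln (ln (real n)) \<ge> z0 \<and>
      \<psi>inv (ln (real n) + K * ln (ln (real n))) > 0 \<and> ln (real n) \<ge> \<bar>K\<bar> + 1"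
    by (auto simp: eventually_sequentially)
  show ?thesis
  proof (rule that[of "max k 1"])
    fix m n :: nat assume mn: "max k 1 \<le> m" "m < n"
    define x y where "x = ln (real m)" and "y = ln (real n)"
    have xy: "x < y" "x \<ge> \<bar>K\<bar> + 1" using mn k[of m] by (auto simp: x_def y_def)
    have "ln y - ln x \<le> (y - x) / x" using xy by (intro ln_diff_le) auto
    then have "\<bar>K\<bar> * (ln y - ln x) \<le> \<bar>K\<bar> * ((y - x) / x)" by (intro mult_left_mono) auto
    also have "\<dots> = (y - x) * (\<bar>K\<bar> / x)" by simp
    also have "\<dots> < (y - x) * 1" using xy by (intro mult_strict_left_mono) (auto simp: divide_less_eq)
    finally have "\<bar>K\<bar> * (ln y - ln x) < y - x" by simp
    moreover have "- \<bar>K\<bar> * (ln y - ln x) \<le> K * (ln y - ln x)"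
      using xy by (intro mult_right_mono) auto
    ultimately have "x + K * ln x < y + K * ln y" by (simp add: algebra_simps)
    then show "\<psi>inv (ln (real m) + K * ln (ln (real m))) < \<psi>inv (ln (real n) + K * ln (ln (real n)))"
      using z0 k[of m] mn by (simp add: x_def y_def)
  qed (use k in auto)
qed

text \<open>Accounting in powers of \<open>x\<close>: \<open>n\<close> times the density is at least
  of order \<open>x powr (K - \<kappa>)\<close>, a cell has volume at least
  \<open>x powr (- 2 * d)\<close>, and the squared tolerance costs two more powers, which gives
  \<open>W\<close>. There are at most of order \<open>x powr (3 * d)\<close> cells, so the union
  bound is of order \<open>1 / x\<close> as soon as
  \<open>K \<ge> \<kappa> + 5 * d + 3\<close>.\<close>

lemma whp_concentration:
  fixes M :: "nat \<Rightarrow> 'w measure"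
  defines "d \<equiv> CARD('d)"
  assumes r_bounds: "\<And>n. 0 < r n \<and> r n \<le> 1"
    and sample: "\<And>n. n \<ge> 1 \<Longrightarrow> poisson_sample (M n) (N n) (X n) (real n) \<nu>"
    and large: "(\<lambda>n. r n * b (ln (real n))) \<in> \<omega>(\<lambda>n. ln (ln (real n)))"
    and inner: "\<forall>\<^sub>F x in at_top. \<forall>w\<in>ball 0 (\<psi>inv (x - K * ln x)). x powr (K - \<kappa>) / 2 powr \<kappa> \<le> exp x * q w"
    and K: "K \<ge> \<kappa> + 5 * d + 3" "\<kappa> \<ge> 0"
    and R0: "\<forall>\<^sub>F n in sequentially. R0 n = \<psi>inv (ln (real n) - K * ln (ln (real n)))" "\<And>n. R0 n > 0"
    and \<gamma>_pos: "\<And>n. \<gamma> n > 0" and \<gamma>_small: "\<gamma> \<in> o(\<lambda>_. 1)"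
    and \<gamma>_large: "(\<lambda>n. \<gamma> n * b (ln (real n))) \<in> \<omega>(\<lambda>_. 1)"
  shows "whp M (\<lambda>n \<omega>. \<forall>i\<in>inner_cubes (\<gamma> n * r n) (R0 n).
    (1 - \<gamma> n) * real n * measure \<nu> (cell (\<gamma> n * r n) (R0 n) i)
      \<le> real (card (poisson_points (N n) (X n) \<omega> \<inter> cell (\<gamma> n * r n) (R0 n) i)) \<and>
    real (card (poisson_points (N n) (X n) \<omega> \<inter> cell (\<gamma> n * r n) (R0 n) i))
      \<le> (1 + \<gamma> n) * real n * measure \<nu> (cell (\<gamma> n * r n) (R0 n) i))"
proof (rule whpI)
  let ?x = "\<lambda>n. ln (real n)"
  show "\<forall>\<^sub>F n in sequentially. prob_space (M n)"
    using eventually_ge_at_top[of 1] by eventually_elim (use sample in \<open>auto simp: poisson_sample_def\<close>)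
  define A where "A = 5 ^ d * 2 * (2 powr \<kappa> * 4)"
  show "(\<lambda>n. A / ?x n) \<longlonglongrightarrow> 0"
    by (rule real_tendsto_divide_at_top[OF tendsto_const filterlim_ln_real_at_top])
  have b1: "\<forall>\<^sub>F x in at_top. 1 \<le> b x \<and> b x \<le> x \<and> 1 \<le> ln x \<and> 1 \<le> x"
  proof (intro eventually_conj b_le)
    show "\<forall>\<^sub>F x in at_top. 1 \<le> b x" using b_at_top by (auto simp: filterlim_at_top)
    show "\<forall>\<^sub>F x::real in at_top. 1 \<le> ln x" using ln_at_top by (auto simp: filterlim_at_top)
  qed (rule eventually_ge_at_top)
  have K0: "K \<ge> 0" using K by simp
  have R0_le: "\<forall>\<^sub>F x in at_top. \<psi>inv (x - K * ln x) \<le> 2 * x"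
    using \<psi>inv_window[of K] \<psi>inv_le eventually_ge_at_top[of 1]
  proof eventually_elim
    case (elim x)
    have "\<bar>x - K * ln x - x\<bar> \<le> K * ln x" using elim K0 by simp
    then have "\<psi>inv (x - K * ln x) \<le> 2 * \<psi>inv x" using elim by blast
    then show ?case using elim by linarith
  qed
  have "\<forall>\<^sub>F n in sequentially. norm (\<gamma> n) \<le> 1 * norm (1::real)"
    using \<gamma>_small zero_less_one by (rule landau_o.smallD)
  moreover have "\<forall>\<^sub>F n in sequentially. norm (\<gamma> n * b (?x n)) \<ge> 1 * norm (1::real)"
    using \<gamma>_large zero_less_one by (rule landau_omega.smallD)
  moreover have "\<forall>\<^sub>F n in sequentially. norm (r n * b (?x n)) \<ge> 1 * norm (ln (?x n))"
    using large zero_less_one by (rule landau_omega.smallD)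
  ultimately show "\<forall>\<^sub>F n in sequentially. 1 - A / ?x n \<le> measure (M n) {\<omega>\<in>space (M n).
    \<forall>i\<in>inner_cubes (\<gamma> n * r n) (R0 n).
    (1 - \<gamma> n) * real n * measure \<nu> (cell (\<gamma> n * r n) (R0 n) i)
      \<le> real (card (poisson_points (N n) (X n) \<omega> \<inter> cell (\<gamma> n * r n) (R0 n) i)) \<and>
    real (card (poisson_points (N n) (X n) \<omega> \<inter> cell (\<gamma> n * r n) (R0 n) i))
      \<le> (1 + \<gamma> n) * real n * measure \<nu> (cell (\<gamma> n * r n) (R0 n) i)}"
    using eventually_ge_at_top[of 1] R0(1)
      eventually_compose_filterlim[OF b1 filterlim_ln_real_at_top]
      eventually_compose_filterlim[OF R0_le filterlim_ln_real_at_top]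
      eventually_compose_filterlim[OF inner filterlim_ln_real_at_top]
  proof eventually_elim
    case (elim n)
    interpret poisson_process "M n" "N n" "X n" "real n" \<nu>
      using sample elim by (intro poisson_processI) auto
    define x s where "x = ?x n" and "s = \<gamma> n * r n"
    have n: "exp x = real n" using elim(4) by (simp add: x_def)
    have x: "1 \<le> b x" "b x \<le> x" "1 \<le> ln x" "1 \<le> x" "R0 n \<le> 2 * x"
      using elim(5,6,7) by (simp_all add: x_def)
    have g: "0 < \<gamma> n" "\<gamma> n \<le> 1" "1 / b x \<le> \<gamma> n"
    proof -
      show "0 < \<gamma> n" by (rule \<gamma>_pos)
      then show "\<gamma> n \<le> 1" using elim(1) by simp
      have "1 \<le> \<gamma> n * b x" using elim(2) \<gamma>_pos[of n] x(1) by (simp add: x_def abs_mult)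
      then show "1 / b x \<le> \<gamma> n" using x(1) by (simp add: divide_le_eq)
    qed
    have "1 \<le> r n * b x" using elim(3) r_bounds[of n] x(1,3) by (simp add: x_def abs_mult)
    then have "1 / b x \<le> r n" using x(1) by (simp add: divide_le_eq)
    then have "(1 / b x) * (1 / b x) \<le> s"
      unfolding s_def using g x by (intro mult_mono) auto
    moreover have "(1 / x) * (1 / x) \<le> (1 / b x) * (1 / b x)"
      using x by (intro mult_mono frac_le) auto
    \<comment> \<open>Both factors of the side width, \<open>\<gamma> n\<close> and
      \<open>r n\<close>, are at least \<open>1 / b x\<close>, and
      \<open>b x \<le> x\<close>.\<close>
    ultimately have s: "1 / x\<^sup>2 \<le> s" by (simp add: power2_eq_square)
    then have s_pos: "s > 0" using x by (auto intro: less_le_trans[of 0 "1 / x\<^sup>2"])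
    define W where "W = x powr (K - \<kappa> - 2 * d - 2) / (2 powr \<kappa> * 4)"
    let ?J = "inner_cubes s (R0 n) :: (int ^ 'd) set"
    have J: "finite ?J" "real (card ?J) \<le> (2 * R0 n / s + 1) ^ d"
      unfolding d_def using inner_cubes_card[OF s_pos R0(2)] by auto
    have W_pos: "W > 0" using x by (simp add: W_def)
    have W: "W \<le> real n * measure \<nu> (cell s (R0 n) i) * (\<gamma> n)\<^sup>2 / 4" if i: "i \<in> ?J" for i
    proof -
      have "(x powr (K - \<kappa>) / 2 powr \<kappa> / real n) * s ^ d \<le> measure \<nu> (cell s (R0 n) i)"
      proof (rule measure_density_ge[OF q_meas cell_measurable \<nu>.finite_measure_axioms])
        show "x powr (K - \<kappa>) / 2 powr \<kappa> / real n \<le> q w" if "w \<in> cell s (R0 n) i" for w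
        proof -
          have "x powr (K - \<kappa>) / 2 powr \<kappa> \<le> real n * q w"
            using that cell_subset_ball[of s "R0 n" i] elim(5,8) n by (auto simp: x_def)
          then show ?thesis using elim(4) by (subst pos_divide_le_eq) (auto simp: mult.commute)
        qed
        show "ennreal (s ^ d) \<le> emeasure lborel (cell s (R0 n) i)"
          unfolding d_def using measure_grid_cube_ge[OF s_pos, of i]
            emeasure_mono[OF grid_cube_subset_cell[OF s_pos i], of lborel] by simp
      qed (use s_pos in auto)
      moreover have "(1 / x\<^sup>2) ^ d \<le> s ^ d" using s by (intro power_mono) auto
      then have "(x powr (K - \<kappa>) / 2 powr \<kappa> / real n) * (1 / x\<^sup>2) ^ d
          \<le> (x powr (K - \<kappa>) / 2 powr \<kappa> / real n) * s ^ d"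
        by (intro mult_left_mono) auto
      moreover have "(1 / x\<^sup>2) ^ d = x powr (- 2 * d)"
        using powr_realpow[of x "2 * d"] x by (simp add: powr_minus_divide power_divide power_mult)
      ultimately have "(x powr (K - \<kappa>) / 2 powr \<kappa> / real n) * x powr (- 2 * d) \<le> measure \<nu> (cell s (R0 n) i)"
        by simp
      then have "real n * ((x powr (K - \<kappa>) / 2 powr \<kappa> / real n) * x powr (- 2 * d)) \<le> real n * measure \<nu> (cell s (R0 n) i)"
        by (intro mult_left_mono) auto
      then have m: "x powr (K - \<kappa>) / 2 powr \<kappa> * x powr (- 2 * d) \<le> real n * measure \<nu> (cell s (R0 n) i)"
        using elim(4) by simp
      have "1 / x \<le> 1 / b x" using x by (intro frac_le) auto
      then have "1 / x \<le> \<gamma> n" using g by linarith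
      then have sq: "(1 / x)\<^sup>2 \<le> (\<gamma> n)\<^sup>2" using x by (intro power_mono) auto
      have "(1 / x)\<^sup>2 = x powr (- 2)"
        using powr_realpow[of x 2] x by (simp add: powr_minus_divide power_divide)
      then have "(x powr (K - \<kappa>) / 2 powr \<kappa> * x powr (- 2 * d)) * x powr (- 2)
          \<le> (real n * measure \<nu> (cell s (R0 n) i)) * (\<gamma> n)\<^sup>2"
        using mult_mono[OF m sq] by simp
      moreover have "(x powr (K - \<kappa>) / 2 powr \<kappa> * x powr (- 2 * d)) * x powr (- 2) = 4 * W"
        by (simp add: W_def flip: powr_add)
      ultimately show ?thesis by simp
    qed
    have "card ?J * (2 / W) \<le> (5 * x ^ 3) ^ d * (2 / W)"
    proof -
      have "2 * R0 n / s \<le> 2 * (2 * x) / (1 / x\<^sup>2)"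
        using x s R0(2)[of n] by (intro frac_le) auto
      moreover have "1 \<le> x ^ 3" using x by simp
      moreover have "2 * (2 * x) / (1 / x\<^sup>2) = 4 * x ^ 3"
        by (simp add: power3_eq_cube power2_eq_square)
      ultimately have "2 * R0 n / s + 1 \<le> 5 * x ^ 3" by linarith
      then have "(2 * R0 n / s + 1) ^ d \<le> (5 * x ^ 3) ^ d"
        using s_pos R0(2)[of n] by (intro power_mono) auto
      then show ?thesis using J W_pos by (intro mult_right_mono) auto
    qed
    also have "\<dots> = A * (x powr (3 * d) * x powr (- (K - \<kappa> - 2 * d - 2)))"
    proof -
      have "(x ^ 3) ^ d = x powr (3 * d)"
        using powr_realpow[of x "3 * d"] x by (simp add: power_mult)
      then have "(5 * x ^ 3) ^ d = 5 ^ d * x powr (3 * d)"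
        by (simp only: power_mult_distrib)
      moreover have "2 / W = 2 * (2 powr \<kappa> * 4) * x powr (- (K - \<kappa> - 2 * d - 2))"
        unfolding W_def powr_minus_divide by simp
      ultimately show ?thesis by (simp only: A_def mult_ac)
    qed
    also have "\<dots> \<le> A * x powr (- 1)"
      unfolding powr_add[symmetric] using K x by (intro mult_left_mono powr_mono) (auto simp: A_def)
    also have "\<dots> = A / x" using x by (simp add: powr_minus_divide)
    finally have "card ?J * (2 / W) \<le> A / ?x n" by (simp add: x_def)
    moreover have "1 - card ?J * (2 / W) \<le> measure (M n) {\<omega>\<in>space (M n). \<forall>i\<in>?J.
    (1 - \<gamma> n) * real n * measure \<nu> (cell s (R0 n) i) \<le> real (card (poisson_points (N n) (X n) \<omega> \<inter> cell s (R0 n) i)) \<and>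
    real (card (poisson_points (N n) (X n) \<omega> \<inter> cell s (R0 n) i)) \<le> (1 + \<gamma> n) * real n * measure \<nu> (cell s (R0 n) i)}"
      by (intro simultaneous_concentration emeasure_singleton J(1) cell_measurable g(1,2) W_pos W)
    ultimately show ?case unfolding s_def by (meson diff_left_mono order_trans)
  qed
qed

lemma whp_empty_outside:
  fixes M :: "nat \<Rightarrow> 'w measure"
  assumes sample: "\<And>n. n \<ge> 1 \<Longrightarrow> poisson_sample (M n) (N n) (X n) (real n) \<nu>"
    and tail: "\<forall>\<^sub>F x in at_top. exp x * measure \<nu> (- ball 0 (\<psi>inv (x + K * ln x))) \<le> A / x"
    and R1: "\<forall>\<^sub>F n in sequentially. R1 n = \<psi>inv (ln (real n) + K * ln (ln (real n)))"
  shows "whp M (\<lambda>n \<omega>. poisson_points (N n) (X n) \<omega> \<inter> - ball 0 (R1 n) = {})"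
proof (rule whpI)
  show "\<forall>\<^sub>F n in sequentially. prob_space (M n)"
    using eventually_ge_at_top[of 1] by eventually_elim (use sample in \<open>auto simp: poisson_sample_def\<close>)
  show "(\<lambda>n. A / ln (real n)) \<longlonglongrightarrow> 0"
    by (rule real_tendsto_divide_at_top[OF tendsto_const filterlim_ln_real_at_top])
  show "\<forall>\<^sub>F n in sequentially. 1 - A / ln (real n) \<le> measure (M n)
      {\<omega> \<in> space (M n). poisson_points (N n) (X n) \<omega> \<inter> - ball 0 (R1 n) = {}}"
    using R1 eventually_ge_at_top[of 1] eventually_compose_filterlim[OF tail filterlim_ln_real_at_top]
  proof eventually_elim
    case (elim n)
    interpret poisson_process "M n" "N n" "X n" "real n" \<nu>
      using sample elim by (intro poisson_processI) auto
    have "1 - A / ln (real n) \<le> 1 + - (real n * measure \<nu> (- ball 0 (R1 n)))"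
      using elim by simp
    also have "\<dots> \<le> exp (- (real n * measure \<nu> (- ball 0 (R1 n))))"
      by (rule exp_ge_add_one_self)
    also have "\<dots> = measure (M n) {\<omega> \<in> space (M n). npoints (- ball 0 (R1 n)) \<omega> = 0}"
      by (rule prob_npoints_0[symmetric]) auto
    finally show ?case by (simp only: npoints_eq_0_iff_disjoint)
  qed
qed

lemma annulus_width_smallo:
  assumes r_bounds: "\<And>n. 0 < r n \<and> r n \<le> 1"
    and large: "(\<lambda>n. r n * b (ln (real n))) \<in> \<omega>(\<lambda>n. ln (ln (real n)))"
    and K: "K \<ge> 0"
    and R0: "\<forall>\<^sub>F n in sequentially. R0 n = \<psi>inv (ln (real n) - K * ln (ln (real n)))"
    and R1: "\<forall>\<^sub>F n in sequentially. R1 n = \<psi>inv (ln (real n) + K * ln (ln (real n)))"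
  shows "(\<lambda>n. R1 n - R0 n) \<in> o(r)"
proof (rule landau_o.smallI)
  fix c :: real assume c: "c > 0"
  obtain C where C: "C \<ge> 0" "\<forall>\<^sub>F x in at_top.
     0 \<le> \<psi>inv (x + K * ln x) - \<psi>inv (x - K * ln x) \<and>
     \<psi>inv (x + K * ln x) - \<psi>inv (x - K * ln x) \<le> C * ln x / b x"
    using radii_gap[OF K] by blast
  have b1: "\<forall>\<^sub>F x in at_top. b x \<ge> 1" using b_at_top by (auto simp: filterlim_at_top)
  \<comment> \<open>The summand 1 keeps the constant positive when \<open>C = 0\<close>.\<close>
  have "\<forall>\<^sub>F n in sequentially. norm (r n * b (ln (real n))) \<ge> ((C + 1) / c) * norm (ln (ln (real n)))"
    using C c by (intro landau_omega.smallD[OF large]) auto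
  then show "\<forall>\<^sub>F n in sequentially. norm (R1 n - R0 n) \<le> c * norm (r n)"
    using R0 R1 eventually_compose_filterlim[OF C(2) filterlim_ln_real_at_top]
      eventually_compose_filterlim[OF b1 filterlim_ln_real_at_top]
      eventually_compose_filterlim[OF eventually_ge_at_top[of 1] filterlim_ln_real_at_top]
  proof eventually_elim
    case (elim n)
    let ?x = "ln (real n)"
    have lnx: "0 \<le> ln ?x" using elim(6) by simp
    have "(C + 1) / c * ln ?x \<le> r n * b ?x"
      using elim(1,5) lnx r_bounds[of n] by (simp add: abs_mult)
    then have "(C + 1) * ln ?x \<le> c * (r n * b ?x)"
      using c by (simp add: pos_divide_le_eq mult.commute)
    moreover have "C * ln ?x \<le> (C + 1) * ln ?x" using lnx by (simp add: algebra_simps)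
    ultimately have "C * ln ?x / b ?x \<le> c * r n"
      using elim(5) by (simp add: pos_divide_le_eq mult.assoc)
    moreover have "0 \<le> R1 n - R0 n" "R1 n - R0 n \<le> C * ln ?x / b ?x"
      using elim(2-4) by simp_all
    ultimately show ?case using r_bounds[of n] by simp
  qed
qed

end

theorem theorem4p3:
  fixes q :: "real ^ 'd \<Rightarrow> real"
    and \<nu> :: "(real ^ 'd) measure"
    and \<psi> \<psi>inv :: "real \<Rightarrow> real"
    and r :: "nat \<Rightarrow> real"
    and M :: "nat \<Rightarrow> 'w measure"
    and N :: "nat \<Rightarrow> 'w \<Rightarrow> nat"
    and X :: "nat \<Rightarrow> nat \<Rightarrow> 'w \<Rightarrow> real ^ 'd"
    and P :: "nat \<Rightarrow> 'w \<Rightarrow> (real ^ 'd) set"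
  assumes dim: "CARD('d) \<ge> 2"
    and q_meas: "q \<in> borel_measurable borel"
    and q_pos: "\<And>x. q x > 0"
    and q_radial: "\<And>x y. norm x = norm y \<Longrightarrow> q x = q y"
    and \<nu>_def: "\<nu> = density lborel (\<lambda>x. ennreal (q x))"
    and \<nu>_prob: "prob_space \<nu>"
    and decay: "superexponential_decay q \<psi>"
    and \<psi>inv: "inverse_at_top \<psi> \<psi>inv"
    and r_bounds: "\<And>n. 0 < r n \<and> r n \<le> 1"
    and r_noninc: "decseq r"
    and sample: "\<And>n. n \<ge> 1 \<Longrightarrow> poisson_sample (M n) (N n) (X n) (real n) \<nu>"
    and P_def: "\<And>n \<omega>. P n \<omega> = poisson_points (N n) (X n) \<omega>"
  shows
    "((\<lambda>n. r n * deriv \<psi> (\<psi>inv (ln (real n)))) \<in> o(\<lambda>n. ln (ln (real n))) \<longrightarrow>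
        whp M (\<lambda>n \<omega>. \<not> Digraph_Component.connected (geometric_graph (P n \<omega>) (r n))))
     \<and>
     ((\<lambda>n. r n * deriv \<psi> (\<psi>inv (ln (real n)))) \<in> \<omega>(\<lambda>n. ln (ln (real n))) \<longrightarrow>
        (\<exists>R0 R1 :: nat \<Rightarrow> real.
           strict_mono R0 \<and> strict_mono R1 \<and> (\<forall>n. R0 n > 0) \<and>
           (\<lambda>n. R1 n - R0 n) \<in> o(r) \<and>
           whp M (\<lambda>n \<omega>. P n \<omega> \<inter> - ball 0 (R1 n) = {}) \<and>
           (locally_bounded_away_from_0 q \<longrightarrow> (\<forall>\<gamma> :: nat \<Rightarrow> real.
              (\<forall>n. \<gamma> n > 0) \<longrightarrow>
              \<gamma> \<in> o(\<lambda>_. 1) \<longrightarrow>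
              (\<lambda>n. \<gamma> n * deriv \<psi> (\<psi>inv (ln (real n)))) \<in> \<omega>(\<lambda>_. 1) \<longrightarrow>
              whp M (\<lambda>n \<omega>. \<forall>i \<in> inner_cubes (\<gamma> n * r n) (R0 n).
                let Q = cell (\<gamma> n * r n) (R0 n) i in
                  (1 - \<gamma> n) * real n * measure \<nu> Q \<le> real (card (P n \<omega> \<inter> Q)) \<and>
                  real (card (P n \<omega> \<inter> Q)) \<le> (1 + \<gamma> n) * real n * measure \<nu> Q)))))"
proof -
  from decay obtain v where v: "v > 1" "regularly_varying \<psi> v"
    and vM: "von_Mises_type \<psi>"
    and "\<exists>L \<alpha>. regularly_varying L \<alpha> \<and> (\<forall>x. q x = L (norm x) * exp (- \<psi> (norm x)))"
    by (auto simp: superexponential_decay_def light_tail_def)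
  then obtain L \<alpha> where L: "regularly_varying L \<alpha>" "\<And>x. q x = L (norm x) * exp (- \<psi> (norm x))"
    by blast
  obtain z1 where z1: "z1 > 0" "mono_on {z1..} (deriv \<psi>)" "\<And>z. z \<ge> z1 \<Longrightarrow> deriv \<psi> z > 0"
    using superexponential_mono_deriv[OF decay] by blast
  have C2: "C2_halfline \<psi>"
    using vM by (auto simp: von_Mises_type_def)
  interpret superexponential_density \<psi> \<psi>inv v z1 q L \<alpha>
  proof (intro superexponential_density.intro superexponential.intro superexponential_density_axioms.intro)
    show "continuous_on {0..} \<psi>"
    proof -
      obtain \<psi>' where "\<forall>z\<ge>0. (\<psi> has_real_derivative \<psi>' z) (at z within {0..})"
        using C2 unfolding C2_halfline_def by blast
      then show ?thesis
        unfolding continuous_on_eq_continuous_within using DERIV_continuous by blast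
    qed
    show "deriv \<psi> x \<le> deriv \<psi> y" if "z1 \<le> x" "x \<le> y" for x y
      using monotone_onD[OF z1(2), of x y] that by auto
    show "prob_space (density lborel (\<lambda>x. ennreal (q x)))"
      using \<nu>_prob unfolding \<nu>_def .
  qed (fact v C2_halfline_has_derivative[OF C2] z1 \<psi>inv L q_meas q_pos)+
  note sample' = sample[unfolded \<nu>_def]
  show ?thesis
  proof (intro conjI impI)
    assume "(\<lambda>n. r n * deriv \<psi> (\<psi>inv (ln (real n)))) \<in> o(\<lambda>n. ln (ln (real n)))"
    then show "whp M (\<lambda>n \<omega>. \<not> Digraph_Component.connected (geometric_graph (P n \<omega>) (r n)))"
      unfolding P_def using dim r_bounds sample' by (intro whp_not_connected) auto
  next
    assume large: "(\<lambda>n. r n * deriv \<psi> (\<psi>inv (ln (real n)))) \<in> \<omega>(\<lambda>n. ln (ln (real n)))"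
    obtain K' A where K': "\<And>K. K \<ge> K' \<Longrightarrow>
        \<forall>\<^sub>F x in at_top. exp x * measure (density lborel (\<lambda>x. ennreal (q x))) (- ball 0 (\<psi>inv (x + K * ln x))) \<le> A / x"
      using tail_radius by blast
    obtain \<kappa> where \<kappa>: "\<kappa> \<ge> 0" "\<And>K. locally_bounded_away_from_0 q \<Longrightarrow> K \<ge> 0 \<Longrightarrow>
        \<forall>\<^sub>F x in at_top. \<forall>w\<in>ball 0 (\<psi>inv (x - K * ln x)). x powr (K - \<kappa>) / 2 powr \<kappa> \<le> exp x * q w"
      using inner_radius by blast
    \<comment> \<open>Large enough both for the empty exterior and for the concentration, and fixed
      before \<gamma>, so the radii do not depend on it.\<close>
    define K where "K = max K' (\<kappa> + 5 * CARD('d) + 3)"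
    have K: "K \<ge> K'" "K \<ge> \<kappa> + 5 * CARD('d) + 3" "K \<ge> 0" using \<kappa>(1) by (auto simp: K_def)
    obtain R0 k0 where R0: "strict_mono R0" "\<And>n. R0 n > 0"
        "\<And>n. n \<ge> k0 \<Longrightarrow> R0 n = \<psi>inv (ln (real n) - K * ln (ln (real n)))"
    proof -
      obtain k0 :: nat where *: "\<And>m n. k0 \<le> m \<Longrightarrow> m < n \<Longrightarrow> \<psi>inv (ln (real m) + (- K) * ln (ln (real m))) < \<psi>inv (ln (real n) + (- K) * ln (ln (real n)))"
        "\<And>n. n \<ge> k0 \<Longrightarrow> \<psi>inv (ln (real n) + (- K) * ln (ln (real n))) > 0"
        using eventually_ln_window_strict_mono[of "- K"] by blast
      show ?thesis
      proof (rule strict_mono_extension[of k0 "\<lambda>n. \<psi>inv (ln (real n) + (- K) * ln (ln (real n)))"])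
        fix g :: "nat \<Rightarrow> real"
        assume "strict_mono g" "\<And>n. g n > 0" "\<And>n. k0 \<le> n \<Longrightarrow> g n = \<psi>inv (ln (real n) + (- K) * ln (ln (real n)))"
        then show thesis by (intro that[of g k0]) auto
      qed (use * in auto)
    qed
    obtain R1 k1 where R1: "strict_mono R1"
        "\<And>n. n \<ge> k1 \<Longrightarrow> R1 n = \<psi>inv (ln (real n) + K * ln (ln (real n)))"
    proof -
      obtain k1 :: nat where *: "\<And>m n. k1 \<le> m \<Longrightarrow> m < n \<Longrightarrow> \<psi>inv (ln (real m) + K * ln (ln (real m))) < \<psi>inv (ln (real n) + K * ln (ln (real n)))"
        "\<And>n. n \<ge> k1 \<Longrightarrow> \<psi>inv (ln (real n) + K * ln (ln (real n))) > 0"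
        using eventually_ln_window_strict_mono[of "K"] by blast
      show ?thesis
      proof (rule strict_mono_extension[of k1 "\<lambda>n. \<psi>inv (ln (real n) + K * ln (ln (real n)))"])
        fix g :: "nat \<Rightarrow> real"
        assume "strict_mono g" "\<And>n. g n > 0" "\<And>n. k1 \<le> n \<Longrightarrow> g n = \<psi>inv (ln (real n) + K * ln (ln (real n)))"
        then show thesis by (intro that[of g k1]) auto
      qed (use * in auto)
    qed
    have R0_ev: "\<forall>\<^sub>F n in sequentially. R0 n = \<psi>inv (ln (real n) - K * ln (ln (real n)))"
      using R0(3) by (auto simp: eventually_sequentially)
    have R1_ev: "\<forall>\<^sub>F n in sequentially. R1 n = \<psi>inv (ln (real n) + K * ln (ln (real n)))"
      using R1(2) by (auto simp: eventually_sequentially)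
    show "\<exists>R0 R1 :: nat \<Rightarrow> real.
           strict_mono R0 \<and> strict_mono R1 \<and> (\<forall>n. R0 n > 0) \<and>
           (\<lambda>n. R1 n - R0 n) \<in> o(r) \<and>
           whp M (\<lambda>n \<omega>. P n \<omega> \<inter> - ball 0 (R1 n) = {}) \<and>
           (locally_bounded_away_from_0 q \<longrightarrow> (\<forall>\<gamma> :: nat \<Rightarrow> real.
              (\<forall>n. \<gamma> n > 0) \<longrightarrow>
              \<gamma> \<in> o(\<lambda>_. 1) \<longrightarrow>
              (\<lambda>n. \<gamma> n * deriv \<psi> (\<psi>inv (ln (real n)))) \<in> \<omega>(\<lambda>_. 1) \<longrightarrow>
              whp M (\<lambda>n \<omega>. \<forall>i \<in> inner_cubes (\<gamma> n * r n) (R0 n).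
                let Q = cell (\<gamma> n * r n) (R0 n) i in
                  (1 - \<gamma> n) * real n * measure \<nu> Q \<le> real (card (P n \<omega> \<inter> Q)) \<and>
                  real (card (P n \<omega> \<inter> Q)) \<le> (1 + \<gamma> n) * real n * measure \<nu> Q)))"
    proof (rule exI[of _ R0], rule exI[of _ R1], intro conjI impI allI R0(1,2) R1(1))
      show "(\<lambda>n. R1 n - R0 n) \<in> o(r)"
        by (rule annulus_width_smallo[OF r_bounds large K(3) R0_ev R1_ev])
      show "whp M (\<lambda>n \<omega>. P n \<omega> \<inter> - ball 0 (R1 n) = {})"
        unfolding P_def by (rule whp_empty_outside[OF sample' K'[OF K(1)] R1_ev])
      fix \<gamma> :: "nat \<Rightarrow> real"
      assume "locally_bounded_away_from_0 q" "\<forall>n. \<gamma> n > 0" "\<gamma> \<in> o(\<lambda>_. 1)"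
        "(\<lambda>n. \<gamma> n * deriv \<psi> (\<psi>inv (ln (real n)))) \<in> \<omega>(\<lambda>_. 1)"
      then show "whp M (\<lambda>n \<omega>. \<forall>i \<in> inner_cubes (\<gamma> n * r n) (R0 n).
                let Q = cell (\<gamma> n * r n) (R0 n) i in
                  (1 - \<gamma> n) * real n * measure \<nu> Q \<le> real (card (P n \<omega> \<inter> Q)) \<and>
                  real (card (P n \<omega> \<inter> Q)) \<le> (1 + \<gamma> n) * real n * measure \<nu> Q)"
        unfolding P_def Let_def \<nu>_def
        using whp_concentration[OF r_bounds sample' large \<kappa>(2)[OF _ K(3)] K(2) \<kappa>(1) R0_ev R0(2)]
        by blast
    qed
  qed
qed

end
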